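(* For every family $\mathcal V$ of $1$-finely open subsets of $X$ there is a countable subfamily $\mathcal V'\subset\mathcal V$ such that $$\mathrm{Cap}_1\left(\bigcup_{U\in\mathcal V}U\setminus\bigcup_{U'\in\mathcal V'}U'\right)=0.$$
   Context: Standing assumptions: $(X,d,\mu)$ is a complete metric space with at least two points, equipped with a Borel regular outer measure $\mu$ that is doubling: there is $C_d\ge 1$ with $0<\mu(B(x,2r))\le C_d\,\mu(B(x,r))<\infty$ for every ball $B(x,r):=\{y\in X: d(y,x)<r\}$. All functions take values in $[-\infty,\infty]$. A curve is a nonconstant rectifiable continuous map from a compact interval into $X$. A nonnegative Borel function $g$ on $X$ is an upper gradient of a function $u$ on $X$ if $|u(x)-u(y)|\le\int_\gamma g\,ds$ for every curve $\gamma$ with end points $x,y$ (where $|u(x)-u(y)|:=\infty$ if at least one of $|u(x)|,|u(y)|$ is infinite). It is assumed that $X$ supports a $(1,1)$-Poincaré inequality: there are $C_P>0$, $\lambda\ge1$ such that for every ball $B(x,r)$, every $u\in L^1_{\mathrm{loc}}(X)$ and every upper gradient $g$ of $u$, $\frac{1}{\mu(B(x,r))}\int_{B(x,r)}|u-u_{B(x,r)}|\,d\mu\le C_P\, r\,\frac{1}{\mu(B(x,\lambda r))}\int_{B(x,\lambda r)}g\,d\mu$, where $u_{B(x,r)}$ is the mean value of $u$ over $B(x,r)$. Newton–Sobolev space: $\|u\|_{N^{1,1}(X)}:=\|u\|_{L^1(X)}+\inf\|g\|_{L^1(X)}$, the infimum over all $1$-weak upper gradients $g$ of $u$ (i.e.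 the upper gradient inequality holds for all curves outside a family of zero $1$-modulus), and $N^{1,1}(X):=\{u:\|u\|_{N^{1,1}(X)}<\infty\}$; such functions are defined at every point of $X$. Capacities: for $A\subset X$, $\mathrm{Cap}_1(A):=\inf\|u\|_{N^{1,1}(X)}$ over all $u\in N^{1,1}(X)$ with $u\ge1$ on $A$. For $A\subset D\subset X$, $\mathrm{cap}_1(A,D):=\inf\int_X g_u\,d\mu$ over all $u\in N^{1,1}(X)$ with $u\ge1$ on $A$ and $u=0$ on $X\setminus D$, and all upper gradients $g_u$ of $u$. A set $A\subset X$ is $1$-thin at $x\in X$ if $\lim_{r\to0} r\,\frac{\mathrm{cap}_1(A\cap B(x,r),B(x,2r))}{\mu(B(x,r))}=0$. A set $U\subset X$ is $1$-finely open if $X\setminus U$ is $1$-thin at every $x\in U$. *)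

theory Defs
  imports "HOL-Analysis.Analysis"
begin

section \<open>Borel regular outer measures\<close>

text \<open>
  An outer measure is a function on all subsets of the space. The associated measure space, with
  respect to which all integrals are taken, lives on the Caratheodory measurable sets.
\<close>

definition borel_regular_outer_measure :: "('a::topological_space set \<Rightarrow> ennreal) \<Rightarrow> bool" where
  "borel_regular_outer_measure \<mu> \<longleftrightarrow>
     outer_measure_space UNIV \<mu> \<and>
     sets borel \<subseteq> lambda_system UNIV UNIV \<mu> \<and>
     (\<forall>A. \<exists>B\<in>sets borel. A \<subseteq> B \<and> \<mu> B = \<mu> A)"

definition caratheodory_measure :: "('a set \<Rightarrow> ennreal) \<Rightarrow> 'a measure" where
  "caratheodory_measure \<mu> = measure_of UNIV (lambda_system UNIV UNIV \<mu>) \<mu>"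

lemma
  assumes "outer_measure_space UNIV \<mu>"
  shows space_caratheodory_measure: "space (caratheodory_measure \<mu>) = UNIV"
    and sets_caratheodory_measure: "sets (caratheodory_measure \<mu>) = lambda_system UNIV UNIV \<mu>"
    and emeasure_caratheodory_measure:
      "A \<in> lambda_system UNIV UNIV \<mu> \<Longrightarrow> emeasure (caratheodory_measure \<mu>) A = \<mu> A"
proof -
  interpret U: sigma_algebra UNIV "UNIV :: 'a set set"
    using sigma_algebra_Pow[of "UNIV :: 'a set"] by simp
  have ms: "measure_space UNIV (lambda_system UNIV UNIV \<mu>) \<mu>"
    using U.caratheodory_lemma[OF assms] by simp
  then interpret L: sigma_algebra UNIV "lambda_system UNIV UNIV \<mu>"
    by (simp add: measure_space_def)
  show "space (caratheodory_measure \<mu>) = UNIV"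
    by (simp add: caratheodory_measure_def)
  show "sets (caratheodory_measure \<mu>) = lambda_system UNIV UNIV \<mu>"
    by (simp add: caratheodory_measure_def L.sets_measure_of_eq)
  show "emeasure (caratheodory_measure \<mu>) A = \<mu> A" if "A \<in> lambda_system UNIV UNIV \<mu>"
    unfolding caratheodory_measure_def
    using ms that by (auto simp: measure_space_def intro!: emeasure_measure_of_sigma)
qed

definition doubling :: "('a::metric_space set \<Rightarrow> ennreal) \<Rightarrow> bool" where
  "doubling \<mu> \<longleftrightarrow>
     (\<exists>C::real. 1 \<le> C \<and>
       (\<forall>x r. 0 < r \<longrightarrow>
          0 < \<mu> (ball x (2 * r)) \<and>
          \<mu> (ball x (2 * r)) \<le> ennreal C * \<mu> (ball x r) \<and>
          ennreal C * \<mu> (ball x r) < \<infinity>))"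


section \<open>Curves and curve integrals\<close>

text \<open>
  A curve \<open>\<gamma> : [a,b] \<rightarrow> X\<close> is the triple \<open>(a, b, \<gamma>)\<close>; the values of \<open>\<gamma>\<close> outside \<open>[a,b]\<close> are
  irrelevant.
\<close>

type_synonym 'a curve = "real \<times> real \<times> (real \<Rightarrow> 'a)"

definition curve_length :: "real \<Rightarrow> real \<Rightarrow> (real \<Rightarrow> 'a::metric_space) \<Rightarrow> ennreal" where
  "curve_length a b \<gamma> =
     (SUP (n, t) \<in> {(n::nat, t::nat \<Rightarrow> real). t 0 = a \<and> t n = b \<and> (\<forall>i<n. t i \<le> t (Suc i))}.
        ennreal (\<Sum>i<n. dist (\<gamma> (t i)) (\<gamma> (t (Suc i)))))"

definition curves :: "'a::metric_space curve set" where
  "curves = {(a, b, \<gamma>). a \<le> b \<and> continuous_on {a..b} \<gamma> \<and> curve_length a b \<gamma> < \<infinity> \<and>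
                        \<not> \<gamma> constant_on {a..b}}"

text \<open>
  The arc-length parametrization \<open>\<gamma>\<^sub>s : [0, \<ell>(\<gamma>)] \<rightarrow> X\<close>: the point of \<open>\<gamma>\<close> reached after length \<open>s\<close>.
  It does not depend on the chosen parameter, because \<open>\<gamma>\<close> is constant between any two parameters
  with the same arc length.
\<close>

definition arc_length_param :: "real \<Rightarrow> real \<Rightarrow> (real \<Rightarrow> 'a::metric_space) \<Rightarrow> real \<Rightarrow> 'a" where
  "arc_length_param a b \<gamma> s = \<gamma> (SOME t. t \<in> {a..b} \<and> curve_length a t \<gamma> = ennreal s)"

definition curve_integral :: "'a::metric_space curve \<Rightarrow> ('a \<Rightarrow> ennreal) \<Rightarrow> ennreal" where
  "curve_integral = (\<lambda>(a, b, \<gamma>) g.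
     \<integral>\<^sup>+ s\<in>{0..enn2real (curve_length a b \<gamma>)}. g (arc_length_param a b \<gamma> s) \<partial>lborel)"


section \<open>Upper gradients and the Poincare inequality\<close>

definition ereal_gap :: "ereal \<Rightarrow> ereal \<Rightarrow> ennreal" where
  "ereal_gap v w = (if \<bar>v\<bar> = \<infinity> \<or> \<bar>w\<bar> = \<infinity> then \<infinity> else e2ennreal \<bar>v - w\<bar>)"

definition upper_gradient_along ::
    "('a::metric_space \<Rightarrow> ereal) \<Rightarrow> ('a \<Rightarrow> ennreal) \<Rightarrow> 'a curve \<Rightarrow> bool" where
  "upper_gradient_along u g = (\<lambda>(a, b, \<gamma>).
     ereal_gap (u (\<gamma> a)) (u (\<gamma> b)) \<le> curve_integral (a, b, \<gamma>) g)"

definition upper_gradient :: "('a::metric_space \<Rightarrow> ereal) \<Rightarrow> ('a \<Rightarrow> ennreal) \<Rightarrow> bool" where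
  "upper_gradient u g \<longleftrightarrow>
     g \<in> borel_measurable borel \<and> (\<forall>c\<in>curves. upper_gradient_along u g c)"

definition modulus1 :: "('a::metric_space set \<Rightarrow> ennreal) \<Rightarrow> 'a curve set \<Rightarrow> ennreal" where
  "modulus1 \<mu> \<Gamma> =
     (INF \<rho> \<in> {\<rho>. \<rho> \<in> borel_measurable borel \<and> (\<forall>c\<in>\<Gamma>. 1 \<le> curve_integral c \<rho>)}.
        \<integral>\<^sup>+ x. \<rho> x \<partial>caratheodory_measure \<mu>)"

definition weak_upper_gradient ::
    "('a::metric_space set \<Rightarrow> ennreal) \<Rightarrow> ('a \<Rightarrow> ereal) \<Rightarrow> ('a \<Rightarrow> ennreal) \<Rightarrow> bool" where
  "weak_upper_gradient \<mu> u g \<longleftrightarrow>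
     g \<in> borel_measurable borel \<and>
     (\<exists>\<Gamma>\<subseteq>curves. modulus1 \<mu> \<Gamma> = 0 \<and> (\<forall>c\<in>curves - \<Gamma>. upper_gradient_along u g c))"

definition L1_loc :: "('a::metric_space set \<Rightarrow> ennreal) \<Rightarrow> ('a \<Rightarrow> ereal) set" where
  "L1_loc \<mu> =
     {u \<in> borel_measurable (caratheodory_measure \<mu>).
        \<forall>x. \<exists>r>0. (\<integral>\<^sup>+ y\<in>ball x r. e2ennreal \<bar>u y\<bar> \<partial>caratheodory_measure \<mu>) < \<infinity>}"

text \<open>
  In a complete space with a doubling measure closed balls are compact, so a locally integrable
  function is integrable, hence almost everywhere finite, on each ball. Passing to real values in
  the mean value is therefore harmless.
\<close>

definition ball_mean ::
    "('a::metric_space set \<Rightarrow> ennreal) \<Rightarrow> ('a \<Rightarrow> ereal) \<Rightarrow> 'a \<Rightarrow> real \<Rightarrow> real" where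
  "ball_mean \<mu> u x r =
     (LINT y:ball x r|caratheodory_measure \<mu>. real_of_ereal (u y)) / enn2real (\<mu> (ball x r))"

definition poincare_1_1 :: "('a::metric_space set \<Rightarrow> ennreal) \<Rightarrow> bool" where
  "poincare_1_1 \<mu> \<longleftrightarrow>
     (\<exists>C \<Lambda> :: real. 0 < C \<and> 1 \<le> \<Lambda> \<and>
       (\<forall>x r u g. 0 < r \<longrightarrow> u \<in> L1_loc \<mu> \<longrightarrow> upper_gradient u g \<longrightarrow>
          (\<integral>\<^sup>+ y\<in>ball x r. e2ennreal \<bar>u y - ereal (ball_mean \<mu> u x r)\<bar> \<partial>caratheodory_measure \<mu>)
            / \<mu> (ball x r)
          \<le> ennreal (C * r) *
             ((\<integral>\<^sup>+ y\<in>ball x (\<Lambda> * r). g y \<partial>caratheodory_measure \<mu>) / \<mu> (ball x (\<Lambda> * r)))))"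


section \<open>Newton-Sobolev functions and capacities\<close>

definition N11_norm :: "('a::metric_space set \<Rightarrow> ennreal) \<Rightarrow> ('a \<Rightarrow> ereal) \<Rightarrow> ennreal" where
  "N11_norm \<mu> u =
     (\<integral>\<^sup>+ x. e2ennreal \<bar>u x\<bar> \<partial>caratheodory_measure \<mu>) +
     (INF g \<in> {g. weak_upper_gradient \<mu> u g}. \<integral>\<^sup>+ x. g x \<partial>caratheodory_measure \<mu>)"

text \<open>
  Measurability has to be demanded explicitly, as \<^const>\<open>nn_integral\<close> is a lower integral for
  non-measurable functions. The elements are functions, not equivalence classes.
\<close>

definition N11 :: "('a::metric_space set \<Rightarrow> ennreal) \<Rightarrow> ('a \<Rightarrow> ereal) set" where
  "N11 \<mu> = {u \<in> borel_measurable (caratheodory_measure \<mu>). N11_norm \<mu> u < \<infinity>}"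

definition Cap1 :: "('a::metric_space set \<Rightarrow> ennreal) \<Rightarrow> 'a set \<Rightarrow> ennreal" where
  "Cap1 \<mu> A = (INF u \<in> {u \<in> N11 \<mu>. \<forall>x\<in>A. 1 \<le> u x}. N11_norm \<mu> u)"

definition rel_cap1 :: "('a::metric_space set \<Rightarrow> ennreal) \<Rightarrow> 'a set \<Rightarrow> 'a set \<Rightarrow> ennreal" where
  "rel_cap1 \<mu> A D =
     (INF (u, g) \<in> {(u, g). u \<in> N11 \<mu> \<and> (\<forall>x\<in>A. 1 \<le> u x) \<and> (\<forall>x\<in>-D. u x = 0) \<and>
                            upper_gradient u g}.
        \<integral>\<^sup>+ x. g x \<partial>caratheodory_measure \<mu>)"


section \<open>Thinness and finely open sets\<close>

definition thin1_at :: "('a::metric_space set \<Rightarrow> ennreal) \<Rightarrow> 'a set \<Rightarrow> 'a \<Rightarrow> bool" where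
  "thin1_at \<mu> A x \<longleftrightarrow>
     ((\<lambda>r::real. ennreal r * (rel_cap1 \<mu> (A \<inter> ball x r) (ball x (2 * r)) / \<mu> (ball x r)))
        \<longlongrightarrow> 0) (at_right 0)"

definition finely_open1 :: "('a::metric_space set \<Rightarrow> ennreal) \<Rightarrow> 'a set \<Rightarrow> bool" where
  "finely_open1 \<mu> U \<longleftrightarrow> (\<forall>x\<in>U. thin1_at \<mu> (- U) x)"

end

theory Submission
  imports Defs
begin

text \<open>
  The principle is reduced to a statement about a single set. For each of countably many pairs of
  concentric balls (centres in a countable dense set, rational radii) some countable subfamily
  minimizes the relative capacity of the part of the smaller ball that it leaves uncovered
  (\<open>countable_minimizing_subfamily\<close>). Let \<open>\<W>\<close> be the union of these subfamilies and \<open>E\<close> the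
  complement of \<open>\<Union>\<W>\<close>. Adding one more member \<open>U\<close> to \<open>\<W>\<close> cannot lower any of these relative
  capacities, so \<open>E\<close> is, up to the choice of the radii, as thin at each point of \<open>U\<close> outside
  \<open>\<Union>\<W>\<close> as the complement of \<open>U\<close> is. Hence the exceptional set is contained in the set of those
  points of \<open>E\<close> at which \<open>E\<close> is thin, and it remains to see that such a set has capacity zero
  (\<open>cap_thin_points\<close>).

  That follows by comparing a capacity with itself. By the boxing inequality (\<open>boxing\<close>), a set
  \<open>A\<close> is covered, up to a set of capacity zero, by balls \<open>B(x\<^sub>i, r\<^sub>i)\<close> with \<open>x\<^sub>i \<in> A\<close> and
  \<open>\<Sum> \<mu>(B(x\<^sub>i, r\<^sub>i)) / r\<^sub>i \<le> C cap A\<close>, the radii being as small as desired if the capacity gives a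
  large weight to the integral of the function. If \<open>A \<subseteq> E\<close> and \<open>E\<close> is uniformly thin at the points
  of \<open>A\<close>, then \<open>cap (A \<inter> B(x\<^sub>i, r\<^sub>i)) \<le> \<epsilon> \<mu>(B(x\<^sub>i, r\<^sub>i)) / r\<^sub>i\<close> for these balls. Therefore
  \<open>cap A \<le> \<epsilon> C cap A\<close>, and \<open>cap A = 0\<close> once \<open>\<epsilon> C < 1\<close>.

  The boxing inequality is the coarea argument in elementary form. Halving intervals of levels, one
  finds \<open>(a\<^sub>n, b\<^sub>n]\<close> of length comparable to \<open>2\<^sup>-\<^sup>n\<close> such that the truncations of \<open>v\<close> between
  \<open>a\<^sub>n\<close> and \<open>b\<^sub>n\<close>, rescaled to \<open>[0, 1]\<close>, keep bounded energy while the set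
  \<open>{a\<^sub>n < v \<le> b\<^sub>n}\<close> disappears. In a ball in which the limiting superlevel set has a density away from
  0 and 1, the Poincare inequality for these truncations gives \<open>\<mu>(B) / r \<le> C \<integral> g\<^sub>n\<close>. If instead
  the superlevel set fills most of the ball of the largest radius, the integral of \<open>v\<close> bounds \<open>\<mu>(B)\<close>.

  Balls of both kinds may be missing only at points where \<open>v = 1\<close> although \<open>{v > 1/2}\<close> has low density
  at all small scales. These points form a set \<open>Z\<close> of capacity zero (\<open>cap_low_density_points\<close>): by the Poincare
  inequality, the measure of a superlevel set within distance \<open>r\<close> of \<open>Z\<close> is at most \<open>C r\<close> times the
  energy near \<open>Z\<close> at somewhat lower levels. So these superlevel sets do not charge the closure of \<open>Z\<close>,
  the energy at high levels near \<open>Z\<close> tends to zero with \<open>r\<close>, and it also pays for a cutoff function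
  of slope \<open>1 / r\<close>.

  Truncation replaces an upper gradient \<open>g\<close> by its restriction to the strip between two levels. This
  can fail on curves along which \<open>g\<close> has infinite integral; adding \<open>\<delta> g\<close> with a small \<open>\<delta> > 0\<close>
  makes the estimate trivial there. In this way all functions keep genuine upper gradients, and
  families of curves of modulus zero enter only through \<open>Cap1_le_cap\<close>.
\<close>


section \<open>Arc length\<close>

definition subdivision :: "real \<Rightarrow> real \<Rightarrow> nat \<Rightarrow> (nat \<Rightarrow> real) \<Rightarrow> bool" where
  "subdivision a b n t \<longleftrightarrow> t 0 = a \<and> t n = b \<and> (\<forall>i<n. t i \<le> t (Suc i))"

abbreviation chord_sum :: "(real \<Rightarrow> 'a::metric_space) \<Rightarrow> nat \<Rightarrow> (nat \<Rightarrow> real) \<Rightarrow> real" where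
  "chord_sum \<gamma> n t \<equiv> \<Sum>i<n. dist (\<gamma> (t i)) (\<gamma> (t (Suc i)))"

lemma chord_sum_le_curve_length:
  "subdivision a b n t \<Longrightarrow>
     ennreal (chord_sum \<gamma> n t) \<le> curve_length a b \<gamma>"
  unfolding curve_length_def subdivision_def by (intro SUP_upper2[of "(n, t)"]) auto

lemma curve_length_least:
  assumes "\<And>n t. subdivision a b n t \<Longrightarrow>
     ennreal (chord_sum \<gamma> n t) \<le> C"
  shows "curve_length a b \<gamma> \<le> C"
  unfolding curve_length_def by (intro SUP_least) (use assms in \<open>auto simp: subdivision_def\<close>)

lemma subdivision_mono:
  assumes "subdivision a b n t" "i \<le> j" "j \<le> n"
  shows "t i \<le> t j"
  using assms(2,3)
proof (induction rule: dec_induct)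
  case (step k)
  then show ?case using assms(1) unfolding subdivision_def
    by (meson Suc_le_lessD dual_order.trans le_SucI less_or_eq_imp_le order_trans)
qed simp

lemma subdivision_butlast:
  "subdivision a b (Suc n) t \<Longrightarrow> subdivision a (t n) n t \<and> a \<le> t n \<and> t n \<le> b"
  using subdivision_mono[of a b "Suc n" t 0 n] by (auto simp: subdivision_def)

lemma dist_le_curve_length:
  assumes "a \<le> b"
  shows "ennreal (dist (\<gamma> a) (\<gamma> b)) \<le> curve_length a b \<gamma>"
  using chord_sum_le_curve_length[of a b 1 "\<lambda>i. if i = 0 then a else b" \<gamma>] assms
  by (simp add: subdivision_def)

text \<open>
  Two subdivisions are concatenated.
\<close>

lemma curve_length_superadditive:
  assumes "a \<le> c" "c \<le> b"
  shows "curve_length a c \<gamma> + curve_length c b \<gamma> \<le> curve_length a b \<gamma>"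
proof -
  define S where "S a b = {(n, t). subdivision a b n t}" for a b
  define f where "f = (\<lambda>(n, t). ennreal (chord_sum \<gamma> n t))"
  have L: "curve_length a b \<gamma> = (SUP p\<in>S a b. f p)" for a b
    by (simp add: curve_length_def S_def f_def subdivision_def case_prod_beta')
  have ne: "S a b \<noteq> {}" if "a \<le> b" for a b
    using that unfolding S_def
    by (auto intro!: exI[of _ 1] exI[of _ "\<lambda>i. if i = 0 then a else b"] simp: subdivision_def)
  have key: "f p + f q \<le> curve_length a b \<gamma>" if "p \<in> S a c" "q \<in> S c b" for p q
  proof -
    obtain n t m s where p: "p = (n, t)" and q: "q = (m, s)" by (metis surj_pair)
    define w where "w i = (if i \<le> n then t i else s (i - n))" for i
    have st: "t n = c" "s 0 = c" using that by (auto simp: p q S_def subdivision_def)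
    have w1: "w i = t i" if "i \<le> n" for i using that by (simp add: w_def)
    have w2: "w (n + i) = s i" for i using st by (simp add: w_def)
    have w3: "w (Suc (n + i)) = s (Suc i)" for i using w2[of "Suc i"] by simp
    have "subdivision a b (n + m) w"
      unfolding subdivision_def
    proof (intro conjI allI impI)
      show "w 0 = a" "w (n + m) = b"
        using that w1[of 0] w2[of m] by (auto simp: p q S_def subdivision_def)
      fix i assume "i < n + m"
      show "w i \<le> w (Suc i)"
      proof (cases "i < n")
        case True then show ?thesis using that w1[of i] w1[of "Suc i"]
          by (auto simp: p q S_def subdivision_def)
      next
        case False
        then obtain j where "i = n + j" using le_Suc_ex not_less by blast
        then show ?thesis using that w2[of j] w3[of j] \<open>i < n + m\<close>
          by (auto simp: p q S_def subdivision_def)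
      qed
    qed
    moreover have "(\<Sum>i<n + m. dist (\<gamma> (w i)) (\<gamma> (w (Suc i)))) =
        (chord_sum \<gamma> n t) + (\<Sum>i<m. dist (\<gamma> (s i)) (\<gamma> (s (Suc i))))"
    proof -
      have "(\<Sum>i<n + m. h i) = (\<Sum>i<n. h i) + (\<Sum>i<m. h (n + i))" for h :: "nat \<Rightarrow> real"
        by (induction m) (simp_all add: add.assoc)
      from this[of "\<lambda>i. dist (\<gamma> (w i)) (\<gamma> (w (Suc i)))"] show ?thesis
        using w1 w2 w3 by simp
    qed
    ultimately show ?thesis
      using chord_sum_le_curve_length[of a b "n + m" w \<gamma>]
      by (simp add: p q f_def sum_nonneg)
  qed
  have "curve_length a c \<gamma> + curve_length c b \<gamma> = (SUP p\<in>S a c. f p + curve_length c b \<gamma>)"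
    using ne[OF assms(1)] by (simp add: L ennreal_SUP_add_left)
  also have "\<dots> \<le> curve_length a b \<gamma>"
  proof (rule SUP_least)
    fix p assume p: "p \<in> S a c"
    have "f p + curve_length c b \<gamma> = (SUP q\<in>S c b. f p + f q)"
      using ne[OF assms(2)] by (simp add: L ennreal_SUP_add_right)
    then show "f p + curve_length c b \<gamma> \<le> curve_length a b \<gamma>"
      using key[OF p] by (simp add: SUP_least)
  qed
  finally show ?thesis .
qed

lemma curve_length_snoc:
  assumes "a \<le> c" "c \<le> b"
  shows "curve_length a c \<gamma> + ennreal (dist (\<gamma> c) (\<gamma> b)) \<le> curve_length a b \<gamma>"
  using curve_length_superadditive[OF assms] dist_le_curve_length[OF assms(2)]
  by (meson add_left_mono order_trans)

text \<open>
  For the upper bound, \<open>c\<close> is inserted into a subdivision of \<open>[a, b]\<close>; the triangle inequality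
  shows that this does not decrease the chord sum.
\<close>

lemma curve_length_split:
  assumes "a \<le> c" "c \<le> b"
  shows "curve_length a b \<gamma> = curve_length a c \<gamma> + curve_length c b \<gamma>"
proof (rule antisym)
  show "curve_length a b \<gamma> \<le> curve_length a c \<gamma> + curve_length c b \<gamma>"
  proof (rule curve_length_least)
    fix n t assume "subdivision a b n t"
    then show "ennreal (chord_sum \<gamma> n t)
        \<le> curve_length a c \<gamma> + curve_length c b \<gamma>"
      using assms
    proof (induction n arbitrary: b)
      case 0
      then show ?case by simp
    next
      case (Suc n)
      note tn = subdivision_butlast[OF Suc.prems(1)]
      have tb: "t (Suc n) = b" using Suc.prems by (simp add: subdivision_def)
      let ?S = "ennreal (chord_sum \<gamma> n t)"
      have eq: "ennreal (chord_sum \<gamma> (Suc n) t) =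
          ?S + ennreal (dist (\<gamma> (t n)) (\<gamma> b))"
        by (simp add: tb sum_nonneg)
      show ?case
      proof (cases "c \<le> t n")
        case True
        have "?S + ennreal (dist (\<gamma> (t n)) (\<gamma> b)) \<le>
            curve_length a c \<gamma> + (curve_length c (t n) \<gamma> + ennreal (dist (\<gamma> (t n)) (\<gamma> b)))"
          using Suc.IH[of "t n"] tn True Suc.prems by (simp add: add.assoc[symmetric] add_right_mono)
        also have "\<dots> \<le> curve_length a c \<gamma> + curve_length c b \<gamma>"
          using curve_length_snoc[of c "t n" b \<gamma>] True tn by (intro add_left_mono) auto
        finally show ?thesis unfolding eq .
      next
        case False
        have "?S + ennreal (dist (\<gamma> (t n)) (\<gamma> b)) \<le>
            curve_length a (t n) \<gamma> + (ennreal (dist (\<gamma> (t n)) (\<gamma> c)) + ennreal (dist (\<gamma> c) (\<gamma> b)))"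
          using tn chord_sum_le_curve_length[of a "t n" n t \<gamma>]
          by (intro add_mono)
            (auto simp flip: ennreal_plus intro!: ennreal_leI dist_triangle)
        also have "\<dots> \<le> curve_length a c \<gamma> + curve_length c b \<gamma>"
          using curve_length_snoc[of a "t n" c \<gamma>] dist_le_curve_length[of c b \<gamma>] tn False Suc.prems
          by (simp add: add.assoc[symmetric] add_mono)
        finally show ?thesis unfolding eq .
      qed
    qed
  qed
qed (rule curve_length_superadditive[OF assms])

lemma curve_length_subinterval:
  assumes "a \<le> c" "c \<le> d" "d \<le> b"
  shows "curve_length c d \<gamma> \<le> curve_length a b \<gamma>"
  using curve_length_split[of a c b \<gamma>] curve_length_split[of c d b \<gamma>] assms
  by (metis add_increasing dual_order.trans le_iff_add zero_le)

text \<open>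
  Inserting a point \<open>s\<close> close to \<open>a\<close> into a fixed subdivision splits only its first nontrivial
  interval. Together with a nearly optimal subdivision this bounds the length of \<open>[a, s]\<close> by the
  chord from \<open>\<gamma> a\<close> to \<open>\<gamma> s\<close> and an error, which gives right continuity of the arc length;
  \<open>chord_sum_near_right\<close> is the counterpart at the other end point.
\<close>

lemma chord_sum_near_left:
  assumes "subdivision a b n t" "a < b"
  shows "\<exists>\<delta>>0. \<forall>s. a \<le> s \<and> s < a + \<delta> \<longrightarrow> s \<le> b \<and>
     ennreal (chord_sum \<gamma> n t)
       \<le> ennreal (dist (\<gamma> a) (\<gamma> s)) + curve_length s b \<gamma>"
  using assms
proof (induction n arbitrary: b)
  case 0 then show ?case by (simp add: subdivision_def)
next
  case (Suc n)
  note tn = subdivision_butlast[OF Suc.prems(1)]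
  have tb: "t (Suc n) = b" using Suc.prems by (simp add: subdivision_def)
  let ?S = "ennreal (chord_sum \<gamma> n t)"
  have eq: "ennreal (chord_sum \<gamma> (Suc n) t) =
      ?S + ennreal (dist (\<gamma> (t n)) (\<gamma> b))"
    by (simp add: tb sum_nonneg)
  show ?case
  proof (cases "t n = a")
    case True
    have "?S \<le> 0"
    proof -
      have "t i = a" if "i \<le> n" for i
        using subdivision_mono[of a "t n" n t 0 i] subdivision_mono[of a "t n" n t i n] tn that True
        by (auto simp: subdivision_def)
      then show ?thesis by simp
    qed
    then have S0: "?S = 0" by simp
    have "?S + ennreal (dist (\<gamma> (t n)) (\<gamma> b)) \<le> ennreal (dist (\<gamma> a) (\<gamma> s)) + curve_length s b \<gamma>"
      if "a \<le> s" "s \<le> b" for s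
    proof -
      have "?S + ennreal (dist (\<gamma> (t n)) (\<gamma> b)) \<le> ennreal (dist (\<gamma> a) (\<gamma> s)) + ennreal (dist (\<gamma> s) (\<gamma> b))"
        by (simp add: S0 True dist_triangle ennreal_leI flip: ennreal_plus)
      also have "\<dots> \<le> ennreal (dist (\<gamma> a) (\<gamma> s)) + curve_length s b \<gamma>"
        using dist_le_curve_length[OF that(2)] by (simp add: add_left_mono)
      finally show ?thesis .
    qed
    then show ?thesis unfolding eq using Suc.prems(2) by (intro exI[of _ "b - a"]) auto
  next
    case False
    then obtain \<delta> where d: "\<delta> > 0" "\<And>s. a \<le> s \<Longrightarrow> s < a + \<delta> \<Longrightarrow> s \<le> t n \<and>
        ?S \<le> ennreal (dist (\<gamma> a) (\<gamma> s)) + curve_length s (t n) \<gamma>"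
      using Suc.IH[of "t n"] tn by auto
    have "s \<le> b \<and> ?S + ennreal (dist (\<gamma> (t n)) (\<gamma> b))
        \<le> ennreal (dist (\<gamma> a) (\<gamma> s)) + curve_length s b \<gamma>" if s: "a \<le> s" "s < a + \<delta>" for s
    proof
      show "s \<le> b" using d(2)[OF s] tn by linarith
      have "?S + ennreal (dist (\<gamma> (t n)) (\<gamma> b)) \<le> ennreal (dist (\<gamma> a) (\<gamma> s)) +
          (curve_length s (t n) \<gamma> + ennreal (dist (\<gamma> (t n)) (\<gamma> b)))"
        using d(2)[OF s] by (simp add: add.assoc[symmetric] add_right_mono)
      also have "\<dots> \<le> ennreal (dist (\<gamma> a) (\<gamma> s)) + curve_length s b \<gamma>"
        using curve_length_snoc[of s "t n" b \<gamma>] d(2)[OF s] tn by (simp add: add_left_mono)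
      finally show "?S + ennreal (dist (\<gamma> (t n)) (\<gamma> b))
        \<le> ennreal (dist (\<gamma> a) (\<gamma> s)) + curve_length s b \<gamma>" .
    qed
    then show ?thesis unfolding eq using d(1) by auto
  qed
qed

lemma chord_sum_near_right:
  assumes "subdivision a b n t" "a < b"
  shows "\<exists>\<delta>>0. \<forall>s. b - \<delta> < s \<and> s \<le> b \<longrightarrow> a \<le> s \<and>
     ennreal (chord_sum \<gamma> n t)
       \<le> curve_length a s \<gamma> + ennreal (dist (\<gamma> s) (\<gamma> b))"
  using assms
proof (induction n)
  case 0 then show ?case by (simp add: subdivision_def)
next
  case (Suc n)
  note tn = subdivision_butlast[OF Suc.prems(1)]
  have tb: "t (Suc n) = b" using Suc.prems by (simp add: subdivision_def)
  let ?S = "ennreal (chord_sum \<gamma> n t)"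
  have eq: "ennreal (chord_sum \<gamma> (Suc n) t) =
      ?S + ennreal (dist (\<gamma> (t n)) (\<gamma> b))"
    by (simp add: tb sum_nonneg)
  show ?case
  proof (cases "t n = b")
    case True
    then show ?thesis unfolding eq using Suc.IH tn Suc.prems(2) by simp
  next
    case False
    have "a \<le> s \<and> ?S + ennreal (dist (\<gamma> (t n)) (\<gamma> b)) \<le> curve_length a s \<gamma> + ennreal (dist (\<gamma> s) (\<gamma> b))"
      if s: "b - (b - t n) < s" "s \<le> b" for s
    proof
      show "a \<le> s" using s tn by linarith
      have "?S + ennreal (dist (\<gamma> (t n)) (\<gamma> b)) \<le>
          curve_length a (t n) \<gamma> + (ennreal (dist (\<gamma> (t n)) (\<gamma> s)) + ennreal (dist (\<gamma> s) (\<gamma> b)))"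
          using tn chord_sum_le_curve_length[of a "t n" n t \<gamma>]
          by (intro add_mono)
            (auto simp flip: ennreal_plus intro!: ennreal_leI dist_triangle)
      also have "\<dots> \<le> curve_length a s \<gamma> + ennreal (dist (\<gamma> s) (\<gamma> b))"
        using curve_length_snoc[of a "t n" s \<gamma>] tn s by (simp add: add.assoc[symmetric] add_right_mono)
      finally show "?S + ennreal (dist (\<gamma> (t n)) (\<gamma> b)) \<le> curve_length a s \<gamma> + ennreal (dist (\<gamma> s) (\<gamma> b))" .
    qed
    then show ?thesis unfolding eq using False tn by (intro exI[of _ "b - t n"]) auto
  qed
qed


text \<open>The arc length as a real number; this is only meaningful for rectifiable curves.\<close>

definition arc_length :: "real \<Rightarrow> (real \<Rightarrow> 'a::metric_space) \<Rightarrow> real \<Rightarrow> real" where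
  "arc_length a \<gamma> t = enn2real (curve_length a t \<gamma>)"

text \<open>
  Constant maps are included, as subcurves of a curve may be constant.
\<close>

locale rectifiable =
  fixes a b :: real and \<gamma> :: "real \<Rightarrow> 'a::metric_space"
  assumes ab: "a \<le> b" and cont: "continuous_on {a..b} \<gamma>" and fin: "curve_length a b \<gamma> < \<infinity>"
begin

abbreviation "L \<equiv> arc_length a \<gamma>"

lemma curve_length_finite:
  assumes "a \<le> c" "c \<le> d" "d \<le> b"
  shows "curve_length c d \<gamma> < \<infinity>"
  using curve_length_subinterval[OF assms] fin by (rule le_less_trans)

lemma curve_length_from_start: "a \<le> t \<Longrightarrow> t \<le> b \<Longrightarrow> curve_length a t \<gamma> = ennreal (L t)"
  using curve_length_finite[of a t] by (simp add: arc_length_def)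

lemma arc_length_nonneg: "0 \<le> L t"
  by (simp add: arc_length_def)

lemma curve_length_eq_diff:
  assumes "a \<le> c" "c \<le> d" "d \<le> b"
  shows "curve_length c d \<gamma> = ennreal (L d - L c)" "L c \<le> L d"
proof -
  obtain x where x: "x \<ge> 0" "curve_length c d \<gamma> = ennreal x"
    using curve_length_finite[OF assms] by (metis ennreal_cases less_irrefl infinity_ennreal_def)
  have "ennreal (L d) = ennreal (L c + x)"
    using curve_length_split[of a c d \<gamma>] assms x curve_length_from_start[of c] curve_length_from_start[of d]
    by (simp add: arc_length_nonneg)
  then have "L d = L c + x" using x arc_length_nonneg[of c] arc_length_nonneg[of d]
    ennreal_inj[of "L d" "L c + x"] by simp
  then show "curve_length c d \<gamma> = ennreal (L d - L c)" "L c \<le> L d" using x by auto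
qed

lemma dist_le_arc_length:
  assumes "a \<le> c" "c \<le> d" "d \<le> b"
  shows "dist (\<gamma> c) (\<gamma> d) \<le> L d - L c"
  using dist_le_curve_length[OF assms(2), of \<gamma>] curve_length_eq_diff[OF assms]
  by (metis diff_ge_0_iff_ge ennreal_le_iff)

lemma arc_length_start: "L a = 0"
proof -
  have "curve_length a a \<gamma> \<le> 0"
  proof (rule curve_length_least)
    fix n t assume *: "subdivision a a n t"
    have "t i = a" if "i \<le> n" for i
      using subdivision_mono[OF *, of 0 i] subdivision_mono[OF *, of i n] that *
      by (auto simp: subdivision_def)
    then show "ennreal (chord_sum \<gamma> n t) \<le> 0" by simp
  qed
  then show ?thesis by (simp add: arc_length_def)
qed

lemma near_optimal_subdivision:
  assumes "a \<le> c" "c \<le> d" "d \<le> b" "0 < e"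
  obtains n t where "subdivision c d n t"
    "ennreal (L d - L c) \<le> ennreal (chord_sum \<gamma> n t) + ennreal e"
proof (rule ccontr)
  note best = that
  assume no: "\<not> thesis"
  have "curve_length c d \<gamma> \<le> ennreal (L d - L c - e)"
  proof (rule curve_length_least)
    fix n t assume s: "subdivision c d n t"
    let ?S = "chord_sum \<gamma> n t"
    have "0 \<le> ?S" by (simp add: sum_nonneg)
    then have "\<not> L d - L c \<le> ?S + e"
      using best[OF s] no assms(4) by (metis ennreal_leI ennreal_plus less_imp_le)
    then show "ennreal ?S \<le> ennreal (L d - L c - e)" by (intro ennreal_leI) linarith
  qed
  then have "ennreal (L d - L c) \<le> ennreal (L d - L c - e)"
    using curve_length_eq_diff[OF assms(1-3)] by simp
  then have "L d - L c \<le> 0"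
    using assms(4) by (cases "L d - L c - e \<ge> 0") (auto simp: ennreal_le_iff ennreal_neg ennreal_eq_0_iff)
  moreover have thesis if "L d - L c \<le> e"
  proof -
    have "L d - L c \<le> dist (\<gamma> c) (\<gamma> d) + e"
      using that zero_le_dist[of "\<gamma> c" "\<gamma> d"] by linarith
    then have "ennreal (L d - L c) \<le> ennreal (dist (\<gamma> c) (\<gamma> d)) + ennreal e"
      using assms(4) by (metis ennreal_leI ennreal_plus less_imp_le zero_le_dist)
    then show thesis
      using best[of 1 "\<lambda>i. if i = 0 then c else d"] assms(2) by (simp add: subdivision_def)
  qed
  ultimately show False using no assms(4) by linarith
qed

text \<open>
  If the chord sum of a subdivision of \<open>[c, d]\<close> almost exhausts the length, a short piece at one end of
  \<open>[c, d]\<close> is not much longer than its chord (\<open>chord_sum_near_left\<close>, \<open>chord_sum_near_right\<close>), and the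
  chord is small by continuity of the curve.
\<close>

lemma continuous_arc_length: "continuous_on {a..b} L"
  unfolding continuous_on_iff
proof (intro ballI allI impI)
  fix x e :: real assume x: "x \<in> {a..b}" and e: "0 < e"
  obtain \<delta>0 where d0: "\<delta>0 > 0" "\<And>y. y \<in> {a..b} \<Longrightarrow> dist y x < \<delta>0 \<Longrightarrow> dist (\<gamma> y) (\<gamma> x) < e / 2"
    using cont x e unfolding continuous_on_iff by (metis half_gt_zero)
  have "\<exists>\<delta>>0. \<forall>y. x \<le> y \<and> y \<le> b \<and> y < x + \<delta> \<longrightarrow> L y - L x < e"
  proof (cases "x = b")
    case True
    then show ?thesis using e by (intro exI[of _ 1]) auto
  next
    case False
    then have xb: "x < b" using x by auto
    obtain n t where s: "subdivision x b n t"
      and S: "ennreal (L b - L x) \<le> ennreal (chord_sum \<gamma> n t) + ennreal (e / 2)"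
      using near_optimal_subdivision[of x b "e / 2"] x e by auto
    obtain \<delta> where d: "\<delta> > 0" "\<And>y. x \<le> y \<Longrightarrow> y < x + \<delta> \<Longrightarrow> y \<le> b \<and>
        ennreal (chord_sum \<gamma> n t) \<le> ennreal (dist (\<gamma> x) (\<gamma> y)) + curve_length y b \<gamma>"
      using chord_sum_near_left[OF s xb, of \<gamma>] by auto
    have "L y - L x < e" if y: "x \<le> y" "y < x + min \<delta> \<delta>0" for y
    proof -
      have yb: "y \<le> b" using d(2)[of y] y by auto
      have "ennreal (L b - L x) \<le> ennreal (dist (\<gamma> x) (\<gamma> y)) + ennreal (L b - L y) + ennreal (e / 2)"
        using S d(2)[of y] y x curve_length_eq_diff(1)[of y b]
        by (auto intro: order_trans add_right_mono)
      then have "L b - L x \<le> dist (\<gamma> x) (\<gamma> y) + (L b - L y) + e / 2"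
        using curve_length_eq_diff(2)[of y b] x y yb e
        by (simp add: ennreal_le_iff flip: ennreal_plus)
      moreover have "dist (\<gamma> x) (\<gamma> y) < e / 2"
        using d0(2)[of y] x y yb by (auto simp: dist_real_def dist_commute)
      ultimately show ?thesis by linarith
    qed
    then show ?thesis using d(1) d0(1) by (intro exI[of _ "min \<delta> \<delta>0"]) auto
  qed
  then obtain \<delta>1 where d1: "\<delta>1 > 0" "\<And>y. x \<le> y \<Longrightarrow> y \<le> b \<Longrightarrow> y < x + \<delta>1 \<Longrightarrow> L y - L x < e" by blast
  have "\<exists>\<delta>>0. \<forall>y. a \<le> y \<and> y \<le> x \<and> x - \<delta> < y \<longrightarrow> L x - L y < e"
  proof (cases "x = a")
    case True
    then show ?thesis using e by (intro exI[of _ 1]) auto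
  next
    case False
    then have xa: "a < x" using x by auto
    obtain n t where s: "subdivision a x n t"
      and S: "ennreal (L x - L a) \<le> ennreal (chord_sum \<gamma> n t) + ennreal (e / 2)"
      using near_optimal_subdivision[of a x "e / 2"] x e by auto
    obtain \<delta> where d: "\<delta> > 0" "\<And>y. x - \<delta> < y \<Longrightarrow> y \<le> x \<Longrightarrow> a \<le> y \<and>
        ennreal (chord_sum \<gamma> n t) \<le> curve_length a y \<gamma> + ennreal (dist (\<gamma> y) (\<gamma> x))"
      using chord_sum_near_right[OF s xa, of \<gamma>] by auto
    have "L x - L y < e" if y: "x - min \<delta> \<delta>0 < y" "y \<le> x" for y
    proof -
      have ya: "a \<le> y" using d(2)[of y] y by auto
      have "ennreal (L x - L a) \<le> ennreal (L y - L a) + ennreal (dist (\<gamma> y) (\<gamma> x)) + ennreal (e / 2)"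
        using S d(2)[of y] y x curve_length_eq_diff(1)[of a y]
        by (auto intro: order_trans add_right_mono)
      then have "L x - L a \<le> (L y - L a) + dist (\<gamma> y) (\<gamma> x) + e / 2"
        using curve_length_eq_diff(2)[of a y] x y ya e
        by (simp add: ennreal_le_iff flip: ennreal_plus)
      moreover have "dist (\<gamma> y) (\<gamma> x) < e / 2"
        using d0(2)[of y] x y ya by (auto simp: dist_real_def)
      ultimately show ?thesis by linarith
    qed
    then show ?thesis using d(1) d0(1) by (intro exI[of _ "min \<delta> \<delta>0"]) auto
  qed
  then obtain \<delta>2 where d2: "\<delta>2 > 0" "\<And>y. a \<le> y \<Longrightarrow> y \<le> x \<Longrightarrow> x - \<delta>2 < y \<Longrightarrow> L x - L y < e" by blast
  have "dist (L y) (L x) < e" if y: "y \<in> {a..b}" "dist y x < min \<delta>1 \<delta>2" for y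
  proof (cases "x \<le> y")
    case True
    then show ?thesis using d1(2)[of y] y x curve_length_eq_diff(2)[of x y] by (auto simp: dist_real_def)
  next
    case False
    then show ?thesis using d2(2)[of y] y x curve_length_eq_diff(2)[of y x] by (auto simp: dist_real_def)
  qed
  then show "\<exists>d>0. \<forall>x'\<in>{a..b}. dist x' x < d \<longrightarrow> dist (L x') (L x) < e"
    using d1(1) d2(1) by (intro exI[of _ "min \<delta>1 \<delta>2"]) auto
qed

lemma arc_length_surj:
  assumes "0 \<le> s" "s \<le> L b"
  obtains t where "a \<le> t" "t \<le> b" "L t = s"
  using IVT'[of L a s b] continuous_arc_length ab assms arc_length_start by auto

abbreviation "p \<equiv> arc_length_param a b \<gamma>"

lemma arc_length_param_eq:
  assumes "a \<le> t" "t \<le> b"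
  shows "p (L t) = \<gamma> t"
proof -
  define t' where "t' = (SOME t'. t' \<in> {a..b} \<and> curve_length a t' \<gamma> = ennreal (L t))"
  have "t' \<in> {a..b} \<and> curve_length a t' \<gamma> = ennreal (L t)"
    unfolding t'_def by (rule someI[of _ t]) (use assms curve_length_from_start in auto)
  moreover have "L t' = enn2real (curve_length a t' \<gamma>)" by (rule arc_length_def)
  ultimately have t': "a \<le> t'" "t' \<le> b" "L t' = L t"
    by (auto simp: arc_length_nonneg)
  have "\<gamma> t' = \<gamma> t"
    using dist_le_arc_length[of t t'] dist_le_arc_length[of t' t] t'(1,2) t'(3) assms 
    by (metis (no_types, opaque_lifting) diff_self dist_le_zero_iff linear)
  then show ?thesis unfolding arc_length_param_def t'_def .
qed

lemma arc_length_param_lipschitz: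
  assumes "0 \<le> s" "s \<le> s'" "s' \<le> L b"
  shows "dist (p s) (p s') \<le> s' - s"
proof -
  obtain t where t: "a \<le> t" "t \<le> b" "L t = s" using arc_length_surj[of s] assms by auto
  obtain t' where t': "a \<le> t'" "t' \<le> b" "L t' = s'" using arc_length_surj[of s'] assms by auto
  show ?thesis
  proof (cases "t \<le> t'")
    case True
    then show ?thesis using dist_le_arc_length[of t t'] t t'
        arc_length_param_eq[of t] arc_length_param_eq[of t'] by auto
  next
    case False
    then have "s = s'" using curve_length_eq_diff(2)[of t' t] t t' assms by auto
    then show ?thesis by simp
  qed
qed

lemma arc_length_param_continuous: "continuous_on {0..L b} p"
  unfolding continuous_on_iff
proof (intro ballI allI impI)
  fix x e :: real assume x: "x \<in> {0..L b}" and e: "0 < e"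
  have "dist (p y) (p x) < e" if "y \<in> {0..L b}" "dist y x < e" for y
    using arc_length_param_lipschitz[of x y] arc_length_param_lipschitz[of y x] x that
    by (cases "x \<le> y") (auto simp: dist_real_def dist_commute)
  then show "\<exists>d>0. \<forall>x'\<in>{0..L b}. dist x' x < d \<longrightarrow> dist (p x') (p x) < e"
    using e by blast
qed

end


section \<open>Curve integrals and truncations of upper gradients\<close>

context rectifiable begin

lemma integrand_measurable:
  assumes "g \<in> borel_measurable borel"
  shows "(\<lambda>s. g (p s) * indicator {0..L b} s :: ennreal) \<in> borel_measurable borel"
proof -
  define q where "q s = p (max 0 (min (L b) s))" for s
  have "continuous_on UNIV q" unfolding q_def
    by (rule continuous_on_compose2[OF arc_length_param_continuous])
      (auto intro!: continuous_intros simp: arc_length_nonneg)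
  then have "q \<in> borel_measurable borel" by (rule borel_measurable_continuous_onI)
  then have "(\<lambda>s. g (q s) * indicator {0..L b} s) \<in> borel_measurable borel"
    using assms by measurable
  moreover have "g (q s) * indicator {0..L b} s = g (p s) * indicator {0..L b} s" for s
    by (auto simp: q_def indicator_def)
  ultimately show ?thesis by simp
qed

lemma curve_integral_eq: "curve_integral (a, b, \<gamma>) g = (\<integral>\<^sup>+ s\<in>{0..L b}. g (p s) \<partial>lborel)"
  by (simp add: curve_integral_def arc_length_def)

lemma subcurve_rectifiable:
  assumes "a \<le> c" "c \<le> d" "d \<le> b"
  shows "rectifiable c d \<gamma>"
  using assms curve_length_finite[OF assms] cont
  by (auto simp: rectifiable_def intro: continuous_on_subset)

text \<open>
  The arc length parametrization of a subcurve is a translate of the one of the whole curve.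
\<close>

lemma subcurve_integral:
  assumes cd: "a \<le> c" "c \<le> d" "d \<le> b" and g: "g \<in> borel_measurable borel"
  shows "curve_integral (c, d, \<gamma>) g = (\<integral>\<^sup>+ s\<in>{L c..L d}. g (p s) \<partial>lborel)"
proof -
  interpret R: rectifiable c d \<gamma> by (rule subcurve_rectifiable[OF cd])
  have RL: "R.L t = L t - L c" if "c \<le> t" "t \<le> d" for t
    using curve_length_eq_diff[of c t] cd that by (simp add: arc_length_def[of c])
  have Rp: "R.p s = p (L c + s)" if s: "s \<in> {0..L d - L c}" for s
  proof -
    obtain t where t: "c \<le> t" "t \<le> d" "R.L t = s" using R.arc_length_surj[of s] s RL[of d] cd by auto
    then show ?thesis using R.arc_length_param_eq[of t] arc_length_param_eq[of t] RL[of t] cd by auto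
  qed
  have Ld: "L c \<le> L d" "0 \<le> L c" "L d \<le> L b"
    using curve_length_eq_diff(2)[of c d] curve_length_eq_diff(2)[of d b] cd ab arc_length_nonneg by auto
  have "(\<integral>\<^sup>+ s\<in>{L c..L d}. g (p s) \<partial>lborel) =
      (\<integral>\<^sup>+ s. (g (p s) * indicator {0..L b} s) * indicator {L c..L d} s \<partial>lborel)"
    using Ld by (intro nn_integral_cong) (auto simp: indicator_def)
  also have "\<dots> = (\<integral>\<^sup>+ s. (g (p (L c + s)) * indicator {0..L b} (L c + s)) * indicator {L c..L d} (L c + s) \<partial>lborel)"
    using integrand_measurable[OF g]
    by (subst nn_integral_real_affine[where c=1 and t="L c"]) auto
  also have "\<dots> = (\<integral>\<^sup>+ s\<in>{0..L d - L c}. g (R.p s) \<partial>lborel)"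
    using Ld by (intro nn_integral_cong) (auto simp: indicator_def Rp)
  also have "\<dots> = curve_integral (c, d, \<gamma>) g"
    using R.curve_integral_eq[of g] RL[of d] cd by simp
  finally show ?thesis by simp
qed

end

lemma rectifiable_curve:
  assumes "(a, b, \<gamma>) \<in> curves" shows "rectifiable a b \<gamma>"
  using assms by (auto simp: curves_def rectifiable_def)

lemma curve_integral_cmult:
  assumes "c \<in> curves" "g \<in> borel_measurable borel"
  shows "curve_integral c (\<lambda>x. k * g x) = k * curve_integral c g"
proof -
  obtain a b \<gamma> where c: "c = (a, b, \<gamma>)" by (metis surj_pair)
  interpret rectifiable a b \<gamma> using assms rectifiable_curve by (simp add: c)
  show ?thesis unfolding c curve_integral_eq
    using nn_integral_cmult[of _ lborel k] integrand_measurable[OF assms(2)]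
    by (simp add: mult.assoc)
qed

lemma curve_integral_add:
  assumes "c \<in> curves" "g \<in> borel_measurable borel" "h \<in> borel_measurable borel"
  shows "curve_integral c (\<lambda>x. g x + h x) = curve_integral c g + curve_integral c h"
proof -
  obtain a b \<gamma> where c: "c = (a, b, \<gamma>)" by (metis surj_pair)
  interpret rectifiable a b \<gamma> using assms rectifiable_curve by (simp add: c)
  show ?thesis unfolding c curve_integral_eq
    using nn_integral_add[of _ lborel] integrand_measurable[OF assms(2)] integrand_measurable[OF assms(3)]
    by (simp add: distrib_right)
qed

lemma curve_integral_mono:
  assumes "\<And>x. g x \<le> h x"
  shows "curve_integral c g \<le> curve_integral c h"
  using assms by (auto simp: curve_integral_def split: prod.split intro!: nn_integral_mono mult_right_mono)

lemma curve_integral_const: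
  assumes "(a, b, \<gamma>) \<in> curves"
  shows "curve_integral (a, b, \<gamma>) (\<lambda>_. k) = k * curve_length a b \<gamma>"
proof -
  interpret rectifiable a b \<gamma> by (rule rectifiable_curve[OF assms])
  show ?thesis unfolding curve_integral_eq
    using ab by (simp add: nn_integral_cmult_indicator arc_length_nonneg curve_length_from_start)
qed

abbreviation upper_gradient_real :: "('a::metric_space \<Rightarrow> real) \<Rightarrow> ('a \<Rightarrow> ennreal) \<Rightarrow> bool" where
  "upper_gradient_real v \<equiv> upper_gradient (\<lambda>x. ereal (v x))"

lemma ereal_gap_real [simp]: "ereal_gap (ereal a) (ereal b) = ennreal \<bar>a - b\<bar>"
  by (simp add: ereal_gap_def)

lemma upper_gradient_real_iff:
  "upper_gradient_real v g \<longleftrightarrow> g \<in> borel_measurable borel \<and>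
     (\<forall>a b \<gamma>. (a, b, \<gamma>) \<in> curves \<longrightarrow> ennreal \<bar>v (\<gamma> a) - v (\<gamma> b)\<bar> \<le> curve_integral (a, b, \<gamma>) g)"
  by (auto simp: upper_gradient_def upper_gradient_along_def)

text \<open>
  The upper gradient inequality on subcurves, in terms of arc length. A subarc on which \<open>\<gamma>\<close> is constant
  is not a curve, but there the left-hand side vanishes.
\<close>

lemma (in rectifiable) upper_gradient_on_subarc:
  assumes ug: "upper_gradient_real v g" and s: "0 \<le> s" "s \<le> s'" "s' \<le> L b"
  shows "ennreal \<bar>v (p s) - v (p s')\<bar> \<le> (\<integral>\<^sup>+ r\<in>{s..s'}. g (p r) \<partial>lborel)"
proof (cases "s = s'")
  case False
  obtain t where t: "a \<le> t" "t \<le> b" "L t = s" using arc_length_surj[of s] s by auto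
  obtain t' where t': "a \<le> t'" "t' \<le> b" "L t' = s'" using arc_length_surj[of s'] s by auto
  have tt: "t \<le> t'" using curve_length_eq_diff(2)[of t' t] t t' s False by (cases "t \<le> t'") auto
  have p: "p s = \<gamma> t" "p s' = \<gamma> t'" using arc_length_param_eq t t' by auto
  show ?thesis
  proof (cases "\<gamma> constant_on {t..t'}")
    case True
    then have "\<gamma> t = \<gamma> t'" using tt by (auto simp: constant_on_def)
    then show ?thesis by (simp add: p)
  next
    case False
    have "(t, t', \<gamma>) \<in> curves"
      using subcurve_rectifiable[of t t'] t t' tt False by (simp add: curves_def rectifiable_def)
    then have "ennreal \<bar>v (\<gamma> t) - v (\<gamma> t')\<bar> \<le> curve_integral (t, t', \<gamma>) g"
      using ug by (simp add: upper_gradient_real_iff)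
    then show ?thesis using subcurve_integral[of t t' g] ug t t' tt
      by (simp add: p upper_gradient_def)
  qed
qed simp

text \<open>
  Absolute continuity of the integral: up to an error \<open>e / 2\<close> the integrand may be replaced by its
  truncation at a height \<open>n\<close>.
\<close>

lemma nn_integral_small_on_short_intervals:
  fixes h :: "real \<Rightarrow> ennreal"
  assumes h: "h \<in> borel_measurable borel" and fin: "(\<integral>\<^sup>+ s. h s \<partial>lborel) < \<infinity>" and e: "0 < (e::real)"
  obtains \<delta> where "0 < \<delta>"
    "\<And>s t. s \<le> t \<Longrightarrow> t - s < \<delta> \<Longrightarrow> (\<integral>\<^sup>+ r\<in>{s..t}. h r \<partial>lborel) < ennreal e"
proof -
  have m [measurable]: "h \<in> borel_measurable lborel" using h by simp
  define H where "H n s = min (h s) (of_nat n)" for n :: nat and s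
  have Hm [measurable]: "H n \<in> borel_measurable lborel" for n unfolding H_def by measurable
  have "incseq H" by (auto simp: H_def incseq_def le_fun_def min_le_iff_disj intro!: min.mono of_nat_mono)
  have "(SUP n. H n s) = h s" for s
  proof (rule antisym)
    show "(SUP n. H n s) \<le> h s" by (auto simp: H_def intro!: SUP_least)
    have up: "H n s \<le> (SUP n. H n s)" for n by (rule SUP_upper) simp
    show "h s \<le> (SUP n. H n s)"
    proof (cases "h s = \<infinity>")
      case True
      then have "H n s = of_nat n" for n by (simp add: H_def)
      then have "(SUP n. H n s) = top" using ennreal_SUP_of_nat_eq_top by presburger
      then show "h s \<le> (SUP n. H n s)" by (metis top_greatest)
    next
      case False
      then obtain n :: nat where "h s \<le> of_nat n"
        using ennreal_Ex_less_of_nat[of "h s"] by (auto simp: top.not_eq_extremum intro: that less_imp_le)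
      then have "h s \<le> H n s" by (simp add: H_def)
      then show ?thesis using up[of n] by simp
    qed
  qed
  then have sup: "(\<integral>\<^sup>+ s. h s \<partial>lborel) = (SUP n. \<integral>\<^sup>+ s. H n s \<partial>lborel)"
    using nn_integral_monotone_convergence_SUP[OF \<open>incseq H\<close> Hm] by simp
  have "\<exists>n\<in>UNIV. (\<integral>\<^sup>+ s. h s \<partial>lborel) < (\<integral>\<^sup>+ s. H n s \<partial>lborel) + ennreal (e/2)"
    by (rule SUP_approx_ennreal[OF _ _ sup]) (use fin e in auto)
  then obtain n where n: "(\<integral>\<^sup>+ s. h s \<partial>lborel) < (\<integral>\<^sup>+ s. H n s \<partial>lborel) + ennreal (e/2)"
    by blast
  have "(\<integral>\<^sup>+ s. h s \<partial>lborel) = (\<integral>\<^sup>+ s. (h s - H n s) + H n s \<partial>lborel)"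
    by (intro nn_integral_cong) (simp add: H_def diff_add_cancel_ennreal)
  also have "\<dots> = (\<integral>\<^sup>+ s. h s - H n s \<partial>lborel) + (\<integral>\<^sup>+ s. H n s \<partial>lborel)"
    by (rule nn_integral_add) measurable
  finally have sum: "(\<integral>\<^sup>+ s. h s \<partial>lborel) =
    (\<integral>\<^sup>+ s. h s - H n s \<partial>lborel) + (\<integral>\<^sup>+ s. H n s \<partial>lborel)" .
  have "(\<integral>\<^sup>+ s. H n s \<partial>lborel) \<noteq> \<infinity>" using fin sum by auto
  then have rest: "(\<integral>\<^sup>+ s. h s - H n s \<partial>lborel) \<le> ennreal (e/2)"
    using n unfolding sum add.commute[of _ "\<integral>\<^sup>+ s. H n s \<partial>lborel"]
    by (simp add: ennreal_add_left_cancel_less)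
  have "(\<integral>\<^sup>+ r\<in>{s..t}. h r \<partial>lborel) < ennreal e" if st: "s \<le> t" "t - s < e / (2 * (real n + 1))" for s t
  proof -
    have "(\<integral>\<^sup>+ r\<in>{s..t}. h r \<partial>lborel) \<le> (\<integral>\<^sup>+ r. (h r - H n r) + of_nat n * indicator {s..t} r \<partial>lborel)"
    proof (rule nn_integral_mono)
      fix r
      have "h r = (h r - H n r) + H n r" by (simp add: H_def diff_add_cancel_ennreal)
      also have "\<dots> \<le> (h r - H n r) + of_nat n" by (intro add_left_mono) (simp add: H_def)
      finally show "h r * indicator {s..t} r \<le> (h r - H n r) + of_nat n * indicator {s..t} r"
        by (auto simp: indicator_def)
    qed
    also have "\<dots> = (\<integral>\<^sup>+ r. h r - H n r \<partial>lborel) + of_nat n * ennreal (t - s)"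
      using st by (subst nn_integral_add) (auto simp: nn_integral_cmult_indicator)
    also have "\<dots> \<le> ennreal (e/2) + of_nat n * ennreal (t - s)" using rest by (rule add_right_mono)
    also have "\<dots> = ennreal (e/2 + real n * (t - s))"
      using e st by (simp add: ennreal_mult' ennreal_of_nat_eq_real_of_nat)
    also have "\<dots> < ennreal e"
    proof (rule ennreal_lessI)
      have "real n * (t - s) \<le> (real n + 1) * (t - s)" using st by (simp add: mult_right_mono)
      also have "\<dots> < e / 2" using st(2) by (simp add: field_simps)
      finally show "e/2 + real n * (t - s) < e" by simp
    qed (fact e)
    finally show ?thesis .
  qed
  then show ?thesis using that[of "e / (2 * (real n + 1))"] e by simp
qed

text \<open>
  The growth of a function between two of its values is already achieved between the last time at
  which it is at the lower value and the next time at which it is at the upper one, and in between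
  it stays strictly between the two values.
\<close>

lemma growth_between_levels:
  fixes F :: "real \<Rightarrow> real" and f :: "real \<Rightarrow> ennreal"
  assumes F: "continuous_on {0..l} F"
    and bd: "\<And>s t. 0 \<le> s \<Longrightarrow> s \<le> t \<Longrightarrow> t \<le> l \<Longrightarrow> ennreal \<bar>F s - F t\<bar> \<le> (\<integral>\<^sup>+ r\<in>{s..t}. f r \<partial>lborel)"
    and l: "0 \<le> l" and AB: "F 0 \<le> A" "A < B" "B \<le> F l"
  shows "ennreal (B - A) \<le> (\<integral>\<^sup>+ s\<in>{0..l}. f s * indicator {s. A < F s \<and> F s < B} s \<partial>lborel)"
proof -
  have "closed ({0..l} \<inter> F -` {..A})"
    using continuous_closed_preimage[OF F] by auto
  then have "compact ({0..l} \<inter> ({0..l} \<inter> F -` {..A}))" by (intro compact_Int_closed) auto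
  also have "{0..l} \<inter> ({0..l} \<inter> F -` {..A}) = {s \<in> {0..l}. F s \<le> A}" by auto
  finally have "compact {s \<in> {0..l}. F s \<le> A}" .
  moreover have "0 \<in> {s \<in> {0..l}. F s \<le> A}" using l AB by simp
  ultimately obtain s0 where s0: "s0 \<in> {0..l}" "F s0 \<le> A" "\<And>s. s \<in> {0..l} \<Longrightarrow> F s \<le> A \<Longrightarrow> s \<le> s0"
    using compact_attains_sup[of "{s \<in> {0..l}. F s \<le> A}"] by blast
  have F': "continuous_on {s0..l} F" using F s0 by (auto intro: continuous_on_subset)
  have "closed ({s0..l} \<inter> F -` {B..})"
    using continuous_closed_preimage[OF F'] by auto
  then have "compact ({s0..l} \<inter> ({s0..l} \<inter> F -` {B..}))" by (intro compact_Int_closed) auto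
  also have "{s0..l} \<inter> ({s0..l} \<inter> F -` {B..}) = {s \<in> {s0..l}. B \<le> F s}" by auto
  finally have "compact {s \<in> {s0..l}. B \<le> F s}" .
  moreover have "l \<in> {s \<in> {s0..l}. B \<le> F s}" using s0 AB by simp
  ultimately obtain t0 where t0: "t0 \<in> {s0..l}" "B \<le> F t0" "\<And>s. s \<in> {s0..l} \<Longrightarrow> B \<le> F s \<Longrightarrow> t0 \<le> s"
    using compact_attains_inf[of "{s \<in> {s0..l}. B \<le> F s}"] by blast
  have "ennreal (B - A) \<le> ennreal \<bar>F s0 - F t0\<bar>" using s0 t0 by (intro ennreal_leI) auto
  also have "\<dots> \<le> (\<integral>\<^sup>+ r\<in>{s0..t0}. f r \<partial>lborel)" using s0 t0 by (intro bd) auto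
  also have "\<dots> \<le> (\<integral>\<^sup>+ s\<in>{0..l}. f s * indicator {s. A < F s \<and> F s < B} s \<partial>lborel)"
  proof (rule nn_integral_mono_AE)
    have "AE s in lborel. s \<noteq> s0" "AE s in lborel. s \<noteq> t0" by (auto intro: AE_lborel_singleton)
    then show "AE s in lborel. f s * indicator {s0..t0} s
        \<le> f s * indicator {s. A < F s \<and> F s < B} s * indicator {0..l} s"
    proof eventually_elim
      case (elim s)
      show ?case
      proof (cases "s \<in> {s0..t0}")
        case True
        then have sl: "s \<in> {0..l}" "s \<in> {s0..l}" using s0(1) t0(1) by auto
        have "A < F s" using s0(3)[OF sl(1)] True elim(1) by (cases "F s \<le> A") auto
        moreover have "F s < B" using t0(3)[OF sl(2)] True elim(2) by (cases "B \<le> F s") auto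
        ultimately show ?thesis using sl(1) by (simp add: indicator_def)
      qed simp
    qed
  qed
  finally show ?thesis .
qed

lemma growth_of_truncation:
  fixes F :: "real \<Rightarrow> real" and f :: "real \<Rightarrow> ennreal"
  assumes f: "(\<lambda>s. f s * indicator {0..l} s) \<in> borel_measurable borel"
    and fin: "(\<integral>\<^sup>+ s\<in>{0..l}. f s \<partial>lborel) < \<infinity>"
    and bd: "\<And>s t. 0 \<le> s \<Longrightarrow> s \<le> t \<Longrightarrow> t \<le> l \<Longrightarrow> ennreal \<bar>F s - F t\<bar> \<le> (\<integral>\<^sup>+ r\<in>{s..t}. f r \<partial>lborel)"
    and l: "0 \<le> l" and \<alpha>\<beta>: "\<alpha> < \<beta>"
  shows "ennreal \<bar>max \<alpha> (min \<beta> (F 0)) - max \<alpha> (min \<beta> (F l))\<bar>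
    \<le> (\<integral>\<^sup>+ s\<in>{0..l}. f s * indicator {s. \<alpha> < F s \<and> F s < \<beta>} s \<partial>lborel)"
proof -
  have bd': "ennreal \<bar>F s - F t\<bar> \<le> (\<integral>\<^sup>+ r\<in>{s..t}. f r * indicator {0..l} r \<partial>lborel)"
    if "0 \<le> s" "s \<le> t" "t \<le> l" for s t
    using bd[OF that] that
    by (subst nn_integral_cong[where v = "\<lambda>r. f r * indicator {s..t} r"]) (auto simp: indicator_def)
  have F: "continuous_on {0..l} F" unfolding continuous_on_iff
  proof (intro ballI allI impI)
    fix x e :: real assume x: "x \<in> {0..l}" and e: "0 < e"
    obtain \<delta> where d: "0 < \<delta>" "\<And>s t. s \<le> t \<Longrightarrow> t - s < \<delta> \<Longrightarrow>
        (\<integral>\<^sup>+ r\<in>{s..t}. f r * indicator {0..l} r \<partial>lborel) < ennreal e"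
      using nn_integral_small_on_short_intervals[OF f fin e] by blast
    have *: "\<bar>F s - F t\<bar> < e" if "0 \<le> s" "s \<le> t" "t \<le> l" "t - s < \<delta>" for s t
      using le_less_trans[OF bd'[OF that(1-3)] d(2)[OF that(2,4)]] by (simp add: ennreal_less_iff)
    have "dist (F y) (F x) < e" if "y \<in> {0..l}" "dist y x < \<delta>" for y
      using *[of x y] *[of y x] x that by (cases "x \<le> y") (auto simp: dist_real_def)
    then show "\<exists>d>0. \<forall>x'\<in>{0..l}. dist x' x < d \<longrightarrow> dist (F x') (F x) < e" using d(1) by blast
  qed
  define \<phi> where "\<phi> y = max \<alpha> (min \<beta> y)" for y :: real
  have mono: "(\<integral>\<^sup>+ s\<in>{0..l}. f s * indicator {s. A < F s \<and> F s < B} s \<partial>lborel)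
      \<le> (\<integral>\<^sup>+ s\<in>{0..l}. f s * indicator {s. \<alpha> < F s \<and> F s < \<beta>} s \<partial>lborel)"
    if "\<alpha> \<le> A" "B \<le> \<beta>" for A B
    using that by (intro nn_integral_mono) (auto simp: indicator_def)
  consider "\<phi> (F 0) < \<phi> (F l)" | "\<phi> (F 0) = \<phi> (F l)" | "\<phi> (F l) < \<phi> (F 0)" by linarith
  then have "ennreal \<bar>\<phi> (F 0) - \<phi> (F l)\<bar>
    \<le> (\<integral>\<^sup>+ s\<in>{0..l}. f s * indicator {s. \<alpha> < F s \<and> F s < \<beta>} s \<partial>lborel)"
  proof cases
    case 1
    then have "F 0 \<le> \<phi> (F 0)" "\<phi> (F l) \<le> F l" "\<alpha> \<le> \<phi> (F 0)" "\<phi> (F l) \<le> \<beta>"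
      using \<alpha>\<beta> by (auto simp: \<phi>_def max_def min_def split: if_splits)
    then show ?thesis
      using growth_between_levels[OF F bd l _ 1] mono[of "\<phi> (F 0)" "\<phi> (F l)"] 1
      by (auto intro: order_trans)
  next
    case 3
    then have *: "- F 0 \<le> - \<phi> (F 0)" "- \<phi> (F l) \<le> - F l" "\<alpha> \<le> \<phi> (F l)" "\<phi> (F 0) \<le> \<beta>" "- \<phi> (F 0) < - \<phi> (F l)"
      using \<alpha>\<beta> by (auto simp: \<phi>_def max_def min_def split: if_splits)
    have "ennreal (- \<phi> (F l) - - \<phi> (F 0)) \<le> (\<integral>\<^sup>+ s\<in>{0..l}. f s *
        indicator {s. - \<phi> (F 0) < - F s \<and> - F s < - \<phi> (F l)} s \<partial>lborel)"
      using growth_between_levels[of l "\<lambda>s. - F s" f, OF _ _ l *(1,5,2)] bd F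
      by (auto simp: abs_minus_commute intro: continuous_intros)
    also have "{s. - \<phi> (F 0) < - F s \<and> - F s < - \<phi> (F l)} = {s. \<phi> (F l) < F s \<and> F s < \<phi> (F 0)}" by auto
    finally show ?thesis using mono[of "\<phi> (F l)" "\<phi> (F 0)"] * 3 by (auto intro: order_trans)
  qed simp
  then show ?thesis by (simp add: \<phi>_def)
qed

text \<open>
  On a curve along which \<open>g\<close> is integrable, \<open>v\<close> is continuous, so the oscillation of the
  truncation is already achieved on a subarc on which \<open>v\<close> stays strictly between \<open>\<alpha>\<close> and \<open>\<beta>\<close>.
  On the other curves \<open>g'\<close> makes the right-hand side infinite. A Borel superset \<open>W\<close> of the strip is
  used because an upper gradient has to be Borel, while \<open>v\<close> need not be.
\<close>

lemma upper_gradient_truncation: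
  assumes ug: "upper_gradient_real v g" and \<alpha>\<beta>: "\<alpha> < \<beta>"
    and W: "W \<in> sets borel" "{x. \<alpha> < v x \<and> v x < \<beta>} \<subseteq> W"
    and g': "g' \<in> borel_measurable borel"
      "\<And>c. c \<in> curves \<Longrightarrow> curve_integral c g = \<infinity> \<Longrightarrow> curve_integral c g' = \<infinity>"
  shows "upper_gradient_real (\<lambda>x. max \<alpha> (min \<beta> (v x))) (\<lambda>x. max (g x * indicator W x) (g' x))"
  unfolding upper_gradient_real_iff
proof (intro conjI allI impI)
  have g: "g \<in> borel_measurable borel" using ug by (simp add: upper_gradient_def)
  show "(\<lambda>x. max (g x * indicator W x) (g' x)) \<in> borel_measurable borel" using g g' W by measurable
  fix a b and \<gamma> :: "real \<Rightarrow> 'a" assume c: "(a, b, \<gamma>) \<in> curves"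
  then interpret rectifiable a b \<gamma> by (rule rectifiable_curve)
  let ?h = "\<lambda>x. max (g x * indicator W x) (g' x)"
  show "ennreal \<bar>max \<alpha> (min \<beta> (v (\<gamma> a))) - max \<alpha> (min \<beta> (v (\<gamma> b)))\<bar> \<le> curve_integral (a, b, \<gamma>) ?h"
  proof (cases "curve_integral (a, b, \<gamma>) g = \<infinity>")
    case True
    then have "curve_integral (a, b, \<gamma>) g' = \<infinity>" by (rule g'(2)[OF c])
    moreover have "curve_integral (a, b, \<gamma>) g' \<le> curve_integral (a, b, \<gamma>) ?h"
      by (rule curve_integral_mono) simp
    ultimately show ?thesis by (simp add: top_unique)
  next
    case False
    have "ennreal \<bar>max \<alpha> (min \<beta> (v (p 0))) - max \<alpha> (min \<beta> (v (p (L b))))\<bar>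
      \<le> (\<integral>\<^sup>+ s\<in>{0..L b}. g (p s) * indicator {s. \<alpha> < v (p s) \<and> v (p s) < \<beta>} s \<partial>lborel)"
      using False integrand_measurable[OF g] upper_gradient_on_subarc[OF ug]
      by (intro growth_of_truncation[where F = "\<lambda>s. v (p s)"])
        (auto simp: curve_integral_eq \<alpha>\<beta> arc_length_nonneg top.not_eq_extremum)
    also have "\<dots> \<le> curve_integral (a, b, \<gamma>) ?h"
      unfolding curve_integral_eq using W
      by (intro nn_integral_mono mult_right_mono) (auto simp: indicator_def)
    finally show ?thesis
      using arc_length_param_eq[of a] arc_length_param_eq[of b] ab by (simp add: arc_length_start)
  qed
qed

lemma upper_gradient_real_affine:
  assumes "upper_gradient_real v g" "0 \<le> k"
  shows "upper_gradient_real (\<lambda>x. k * (v x - c)) (\<lambda>x. ennreal k * g x)"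
  unfolding upper_gradient_real_iff
proof (intro conjI allI impI)
  have g: "g \<in> borel_measurable borel" using assms by (simp add: upper_gradient_def)
  then show "(\<lambda>x. ennreal k * g x) \<in> borel_measurable borel" by measurable
  fix a b and \<gamma> :: "real \<Rightarrow> 'a" assume c: "(a, b, \<gamma>) \<in> curves"
  have "\<bar>k * (v (\<gamma> a) - c) - k * (v (\<gamma> b) - c)\<bar> = k * \<bar>v (\<gamma> a) - v (\<gamma> b)\<bar>"
    using assms(2) by (simp add: abs_mult flip: right_diff_distrib)
  then have "ennreal \<bar>k * (v (\<gamma> a) - c) - k * (v (\<gamma> b) - c)\<bar> = ennreal k * ennreal \<bar>v (\<gamma> a) - v (\<gamma> b)\<bar>"
    using assms(2) by (simp add: ennreal_mult)
  also have "\<dots> \<le> ennreal k * curve_integral (a, b, \<gamma>) g"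
    using assms(1) c by (intro mult_left_mono) (auto simp: upper_gradient_real_iff)
  also have "\<dots> = curve_integral (a, b, \<gamma>) (\<lambda>x. ennreal k * g x)"
    by (rule curve_integral_cmult[OF c g, symmetric])
  finally show "ennreal \<bar>k * (v (\<gamma> a) - c) - k * (v (\<gamma> b) - c)\<bar>
    \<le> curve_integral (a, b, \<gamma>) (\<lambda>x. ennreal k * g x)" .
qed

text \<open>
  The truncation between two levels, rescaled to the unit interval.
\<close>

definition ramp :: "real \<Rightarrow> real \<Rightarrow> real \<Rightarrow> real" where
  "ramp \<alpha> \<beta> t = (max \<alpha> (min \<beta> t) - \<alpha>) / (\<beta> - \<alpha>)"

lemma ramp_simps:
  assumes "\<alpha> < \<beta>"
  shows "0 \<le> ramp \<alpha> \<beta> t" "ramp \<alpha> \<beta> t \<le> 1" "t \<le> \<alpha> \<Longrightarrow> ramp \<alpha> \<beta> t = 0" "\<beta> \<le> t \<Longrightarrow> ramp \<alpha> \<beta> t = 1"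
  using assms by (auto simp: ramp_def field_simps max_def min_def)


section \<open>Separated sets and coverings\<close>

definition separated :: "real \<Rightarrow> 'a::metric_space set \<Rightarrow> bool" where
  "separated r S \<longleftrightarrow> (\<forall>x\<in>S. \<forall>y\<in>S. x \<noteq> y \<longrightarrow> r \<le> dist x y)"

lemma maximal_separated_set:
  assumes "0 < r"
  obtains S where "S \<subseteq> A" "separated r S" "\<And>x. x \<in> A \<Longrightarrow> \<exists>s\<in>S. dist s x < r"
proof -
  have "\<exists>S\<in>{S. S \<subseteq> A \<and> separated r S}. \<forall>X\<in>{S. S \<subseteq> A \<and> separated r S}. S \<subseteq> X \<longrightarrow> X = S"
  proof (rule subset_Zorn_nonempty)
    show "{S. S \<subseteq> A \<and> separated r S} \<noteq> {}" by (auto simp: separated_def)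
    fix \<C> assume C: "\<C> \<noteq> {}" "subset.chain {S. S \<subseteq> A \<and> separated r S} \<C>"
    have "separated r (\<Union>\<C>)"
      unfolding separated_def
    proof (intro ballI impI)
      fix x y assume "x \<in> \<Union>\<C>" "y \<in> \<Union>\<C>" "x \<noteq> y"
      then obtain S where "S \<in> \<C>" "x \<in> S" "y \<in> S"
        using C unfolding subset_chain_def by blast
      then show "r \<le> dist x y" using C \<open>x \<noteq> y\<close> by (auto simp: subset_chain_def separated_def)
    qed
    then show "\<Union>\<C> \<in> {S. S \<subseteq> A \<and> separated r S}" using C by (auto simp: subset_chain_def)
  qed
  then obtain S where S0: "S \<in> {S. S \<subseteq> A \<and> separated r S}"
    and max0: "\<forall>X\<in>{S. S \<subseteq> A \<and> separated r S}. S \<subseteq> X \<longrightarrow> X = S" by (elim bexE)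
  then have S: "S \<subseteq> A" "separated r S" by auto
  have max: "X = S" if "X \<subseteq> A" "separated r X" "S \<subseteq> X" for X
    using bspec[OF max0, of X] that by simp
  have "\<exists>s\<in>S. dist s x < r" if "x \<in> A" for x
  proof (rule ccontr)
    assume "\<not> ?thesis"
    then have "separated r (insert x S)" "x \<notin> S" using S assms
      by (auto simp: separated_def not_less dist_commute)
    then show False using max[of "insert x S"] S that by auto
  qed
  then show ?thesis using that S by blast
qed

text \<open>
  Vitali's covering lemma.
  Among the families of disjoint balls in which every ball of the collection that meets the family
  meets a member of at least half its radius, a maximal one meets every ball: otherwise a ball of
  almost largest radius among those that do not meet it could be added.
\<close>

lemma disjoint_balls_five_cover:
  fixes \<rho> :: "'a::metric_space \<Rightarrow> real"
  assumes \<rho>: "\<And>x. x \<in> K \<Longrightarrow> 0 < \<rho> x \<and> \<rho> x \<le> R"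
  obtains C where "C \<subseteq> K" "disjoint_family_on (\<lambda>x. ball x (\<rho> x)) C" "K \<subseteq> (\<Union>x\<in>C. ball x (5 * \<rho> x))"
proof -
  define meets where "meets x y \<longleftrightarrow> ball x (\<rho> x) \<inter> ball y (\<rho> y) \<noteq> {}" for x y
  define \<F> where "\<F> = {C. C \<subseteq> K \<and> (\<forall>x\<in>C. \<forall>y\<in>C. x \<noteq> y \<longrightarrow> \<not> meets x y) \<and>
     (\<forall>x\<in>K. (\<exists>y\<in>C. meets x y) \<longrightarrow> (\<exists>y\<in>C. meets x y \<and> \<rho> x \<le> 2 * \<rho> y))}"
  have "\<exists>C\<in>\<F>. \<forall>X\<in>\<F>. C \<subseteq> X \<longrightarrow> X = C"
  proof (rule subset_Zorn_nonempty)
    have "{} \<in> \<F>" by (simp add: \<F>_def)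
    then show "\<F> \<noteq> {}" by blast
    fix \<C> assume C: "\<C> \<noteq> {}" "subset.chain \<F> \<C>"
    have CF: "S \<in> \<F>" if "S \<in> \<C>" for S using C that by (auto simp: subset_chain_def)
    have 1: "\<not> meets x y" if xy: "x \<in> \<Union>\<C>" "y \<in> \<Union>\<C>" "x \<noteq> y" for x y
    proof -
      obtain S where "S \<in> \<C>" "x \<in> S" "y \<in> S"
        using C xy unfolding subset_chain_def by blast
      then show ?thesis using CF[of S] \<open>x \<noteq> y\<close> by (auto simp: \<F>_def)
    qed
    have 2: "\<exists>y\<in>\<Union>\<C>. meets x y \<and> \<rho> x \<le> 2 * \<rho> y" if x: "x \<in> K" "y \<in> \<Union>\<C>" "meets x y" for x y
    proof -
      obtain S where S: "S \<in> \<C>" "y \<in> S" using x by blast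
      then have "\<exists>y\<in>S. meets x y \<and> \<rho> x \<le> 2 * \<rho> y" using CF[of S] x by (auto simp: \<F>_def)
      then show ?thesis using S by blast
    qed
    have 3: "\<Union>\<C> \<subseteq> K" using CF unfolding \<F>_def by blast
    show "\<Union>\<C> \<in> \<F>" unfolding \<F>_def
      by (intro CollectI conjI ballI impI 1 3) (assumption | elim bexE | rule 2)+
  qed
  then obtain C where C: "C \<in> \<F>" and max0: "\<forall>X\<in>\<F>. C \<subseteq> X \<longrightarrow> X = C" by (elim bexE)
  have max: "X = C" if "X \<in> \<F>" "C \<subseteq> X" for X using bspec[OF max0 that(1)] that(2) by simp
  have all: "\<exists>y\<in>C. meets x y" if x: "x \<in> K" for x
  proof (rule ccontr)
    assume no: "\<not> (\<exists>y\<in>C. meets x y)"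
    define N where "N = {x \<in> K. \<not> (\<exists>y\<in>C. meets x y)}"
    have N: "x \<in> N" using x no by (simp add: N_def)
    have bdd: "bdd_above (\<rho> ` N)" using \<rho> by (intro bdd_aboveI[of _ R]) (auto simp: N_def)
    have "0 < Sup (\<rho> ` N)" using cSUP_upper[OF N bdd] \<rho>[OF x] by linarith
    then obtain z where z: "z \<in> N" "Sup (\<rho> ` N) / 2 < \<rho> z"
      using less_cSup_iff[of "\<rho> ` N" "Sup (\<rho> ` N) / 2"] N bdd by auto
    have zK: "z \<in> K" "\<rho> z > 0" "\<And>y. y \<in> C \<Longrightarrow> \<not> meets z y"
      using z \<rho> by (auto simp: N_def)
    have sym: "meets x y = meets y x" for x y by (auto simp: meets_def)
    have "meets z z" using zK by (auto simp: meets_def)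
    have 2: "\<exists>y\<in>insert z C. meets w y \<and> \<rho> w \<le> 2 * \<rho> y" if w: "w \<in> K" "y \<in> insert z C" "meets w y" for w y
    proof (cases "w \<in> N")
      case True
      then have "y = z" using w by (auto simp: N_def)
      moreover have "\<rho> w \<le> 2 * \<rho> z" using cSUP_upper[OF True bdd] z by linarith
      ultimately show ?thesis using w by blast
    next
      case False
      then have "\<exists>y\<in>C. meets w y \<and> \<rho> w \<le> 2 * \<rho> y" using w C by (auto simp: N_def \<F>_def)
      then show ?thesis by blast
    qed
    have 1: "\<not> meets x y" if "x \<in> insert z C" "y \<in> insert z C" "x \<noteq> y" for x y
      using that zK(3) C sym unfolding \<F>_def by blast
    have 3: "insert z C \<subseteq> K" using C zK by (auto simp: \<F>_def)
    have "insert z C \<in> \<F>" unfolding \<F>_def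
      by (intro CollectI conjI ballI impI 1 3) (assumption | elim bexE | rule 2)+
    then have "insert z C = C" by (intro max) auto
    then have "z \<in> C" by blast
    then show False using zK(3) \<open>meets z z\<close> by blast
  qed
  show ?thesis
  proof (rule that)
    show "C \<subseteq> K" using C by (simp add: \<F>_def)
    show "disjoint_family_on (\<lambda>x. ball x (\<rho> x)) C"
      using C unfolding \<F>_def meets_def disjoint_family_on_def by blast
    show "K \<subseteq> (\<Union>x\<in>C. ball x (5 * \<rho> x))"
    proof
      fix x assume x: "x \<in> K"
      then obtain y where y: "y \<in> C" "meets x y" "\<rho> x \<le> 2 * \<rho> y"
        using all[OF x] C unfolding \<F>_def by blast
      then obtain z where z: "dist x z < \<rho> x" "dist y z < \<rho> y" by (auto simp: meets_def)
      have "dist y x \<le> dist y z + dist x z" by (metis dist_commute dist_triangle)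
      also have "\<dots> < 5 * \<rho> y" using z y zero_le_dist[of y z] by linarith
      finally show "x \<in> (\<Union>x\<in>C. ball x (5 * \<rho> x))" using y by auto
    qed
  qed
qed

text \<open>
  A form of passing to the limit \<open>r \<rightarrow> 0\<close> that fits estimates with values in \<open>[0, \<infinity>]\<close>.
\<close>

lemma ennreal_zero_if_small:
  assumes "0 < r0" "\<And>r. 0 < r \<Longrightarrow> r < r0 \<Longrightarrow> X \<le> ennreal (c * r)"
  shows "X = 0"
proof (rule ccontr)
  assume "X \<noteq> 0"
  have "X \<le> ennreal (c * (r0 / 2))" by (rule assms(2)) (use assms(1) in auto)
  then obtain m where m: "X = ennreal m" "0 \<le> m"
    by (metis ennreal_cases ennreal_less_top leD)
  then have m0: "0 < m" using \<open>X \<noteq> 0\<close> by (cases "m = 0") auto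
  define r where "r = min (r0 / 2) (m / (2 * (\<bar>c\<bar> + 1)))"
  have r: "0 < r" "r < r0" "r \<le> m / (2 * (\<bar>c\<bar> + 1))" using assms(1) m0 by (auto simp: r_def)
  have "c * r \<le> \<bar>c\<bar> * (m / (2 * (\<bar>c\<bar> + 1)))"
    using r by (intro mult_mono) auto
  also have "\<dots> \<le> m / 2" using m0 by (simp add: field_simps)
  finally have "c * r < m" using m0 by linarith
  moreover have "ennreal m \<le> ennreal (c * r)" using assms(2)[OF r(1,2)] m by simp
  ultimately show False using m0 by (simp add: ennreal_le_iff2)
qed

definition nbhd :: "'a::metric_space set \<Rightarrow> real \<Rightarrow> 'a set" where
  "nbhd Z r = (\<Union>z\<in>Z. ball z r)"

lemma open_nbhd [simp]: "open (nbhd Z r)"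
  by (auto simp: nbhd_def)

lemma nbhd_mono: "r \<le> s \<Longrightarrow> nbhd Z r \<subseteq> nbhd Z s"
  unfolding nbhd_def using subset_ball by blast

lemma closure_subset_nbhd: "0 < r \<Longrightarrow> closure Z \<subseteq> nbhd Z r"
proof
  fix x assume "0 < r" "x \<in> closure Z"
  then obtain z where "z \<in> Z" "dist z x < r" unfolding closure_approachable by blast
  then show "x \<in> nbhd Z r" unfolding nbhd_def by (intro UN_I[of z]) simp_all
qed

lemma Inter_nbhd:
  assumes "\<And>n. 0 < r n" "r \<longlonglongrightarrow> 0"
  shows "(\<Inter>n::nat. nbhd Z (r n)) = closure Z"
proof
  show "closure Z \<subseteq> (\<Inter>n. nbhd Z (r n))" using closure_subset_nbhd assms(1) by blast
  show "(\<Inter>n. nbhd Z (r n)) \<subseteq> closure Z"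
  proof
    fix x assume x: "x \<in> (\<Inter>n. nbhd Z (r n))"
    show "x \<in> closure Z" unfolding closure_approachable
    proof (intro allI impI)
      fix e :: real assume "0 < e"
      then have "eventually (\<lambda>n. r n < e) sequentially" using assms(2) order_tendstoD(2) by blast
      then obtain n where "r n < e" using eventually_happens'[OF sequentially_bot] by blast
      moreover obtain z where "z \<in> Z" "dist z x < r n" using x unfolding nbhd_def by auto
      ultimately show "\<exists>y\<in>Z. dist y x < e" by (intro bexI[of _ z]) auto
    qed
  qed
qed


section \<open>Doubling measures\<close>

locale doubling_poincare_space =
  fixes \<mu> :: "'a::metric_space set \<Rightarrow> ennreal" and Cd CP \<Lambda> :: real
  assumes regular: "borel_regular_outer_measure \<mu>"
    and Cd: "1 \<le> Cd" and CP: "0 < CP" and \<Lambda>: "1 \<le> \<Lambda>"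
    and ball_pos: "0 < r \<Longrightarrow> 0 < \<mu> (ball x r)"
    and ball_fin: "0 < r \<Longrightarrow> \<mu> (ball x r) < \<infinity>"
    and ball_double: "0 < r \<Longrightarrow> \<mu> (ball x (2 * r)) \<le> ennreal Cd * \<mu> (ball x r)"
    and poincare: "0 < r \<Longrightarrow> u \<in> L1_loc \<mu> \<Longrightarrow> upper_gradient u g \<Longrightarrow>
        (\<integral>\<^sup>+ y\<in>ball x r. e2ennreal \<bar>u y - ereal (ball_mean \<mu> u x r)\<bar> \<partial>caratheodory_measure \<mu>)
          / \<mu> (ball x r)
        \<le> ennreal (CP * r) *
           ((\<integral>\<^sup>+ y\<in>ball x (\<Lambda> * r). g y \<partial>caratheodory_measure \<mu>) / \<mu> (ball x (\<Lambda> * r)))"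
begin

abbreviation "M \<equiv> caratheodory_measure \<mu>"

lemma outer: "outer_measure_space UNIV \<mu>"
  using regular by (simp add: borel_regular_outer_measure_def)

lemma space_M [simp]: "space M = UNIV"
  by (rule space_caratheodory_measure[OF outer])

lemma borel_subset_M: "sets borel \<subseteq> sets M"
  using regular by (simp add: borel_regular_outer_measure_def sets_caratheodory_measure[OF outer])

lemma borel_sets_M: "A \<in> sets borel \<Longrightarrow> A \<in> sets M"
  using borel_subset_M by blast

lemma open_sets_M [measurable, simp]: "open A \<Longrightarrow> A \<in> sets M"
  and closed_sets_M [simp]: "closed A \<Longrightarrow> A \<in> sets M"
  by (auto intro: borel_sets_M)

lemma ball_sets_M [measurable, simp]: "ball x r \<in> sets M" by simp

lemma borel_measurable_M [measurable_dest]: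
  "f \<in> borel_measurable borel \<Longrightarrow> f \<in> borel_measurable M"
  by (rule borel_measurable_subalgebra[OF borel_subset_M]) simp

lemma emeasure_M: "A \<in> sets M \<Longrightarrow> emeasure M A = \<mu> A"
  using emeasure_caratheodory_measure[OF outer] sets_caratheodory_measure[OF outer] by blast

definition V :: "'a \<Rightarrow> real \<Rightarrow> real" where "V x r = measure M (ball x r)"

lemma emeasure_ball_finite: "0 < r \<Longrightarrow> emeasure M (ball x r) < \<infinity>"
  using ball_fin by (simp add: emeasure_M)

lemma emeasure_ball: "0 < r \<Longrightarrow> emeasure M (ball x r) = ennreal (V x r)"
  unfolding V_def using emeasure_ball_finite[of r x] by (simp add: emeasure_eq_ennreal_measure)

lemma V_pos: "0 < r \<Longrightarrow> 0 < V x r"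
  using ball_pos[of r x] emeasure_ball[of r x] by (simp add: emeasure_M)

lemma V_nonneg: "0 \<le> V x r"
  by (simp add: V_def)

lemma V_mono: "ball x r \<subseteq> ball y s \<Longrightarrow> 0 < r \<Longrightarrow> 0 < s \<Longrightarrow> V x r \<le> V y s"
  using emeasure_mono[of "ball x r" "ball y s" M] by (simp add: emeasure_ball V_nonneg)

lemma V_double: "0 < r \<Longrightarrow> V x (2 * r) \<le> Cd * V x r"
  using ball_double[of r x] emeasure_ball[of r x] emeasure_ball[of "2 * r" x] Cd
  by (simp add: emeasure_M V_nonneg ennreal_le_iff flip: ennreal_mult'')

lemma V_double_power: "0 < r \<Longrightarrow> V x (2 ^ n * r) \<le> Cd ^ n * V x r"
proof (induction n)
  case (Suc n)
  have "V x (2 ^ Suc n * r) \<le> Cd * V x (2 ^ n * r)"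
    using V_double[of "2 ^ n * r" x] Suc by (simp add: mult.assoc)
  also have "\<dots> \<le> Cd * (Cd ^ n * V x r)" using Suc Cd by (intro mult_left_mono) auto
  finally show ?case by (simp add: mult.assoc)
qed simp

text \<open>
  The first ball is contained in the second one dilated by \<open>2 ^ n\<close>.
\<close>

lemma V_compare:
  assumes "0 < r" "0 < s" "dist x y + r \<le> 2 ^ n * s"
  shows "V x r \<le> Cd ^ n * V y s"
proof -
  have "ball x r \<subseteq> ball y (2 ^ n * s)"
  proof
    fix z assume "z \<in> ball x r"
    then have "dist y z < dist x y + r" using dist_triangle[of y z x] by (simp add: dist_commute)
    then show "z \<in> ball y (2 ^ n * s)" using assms by simp
  qed
  then have "V x r \<le> V y (2 ^ n * s)" using assms by (intro V_mono) auto
  also have "\<dots> \<le> Cd ^ n * V y s" by (rule V_double_power[OF assms(2)])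
  finally show ?thesis .
qed

text \<open>
  The balls of radius \<open>r / 2\<close> around the points of \<open>S\<close> are disjoint, lie in the ball of radius
  \<open>2 ^ (n + 1) * r\<close> around \<open>y\<close>, and each of them carries at least the fraction \<open>Cd ^ -(n + 3)\<close> of
  its measure.
\<close>

lemma separated_card:
  fixes S :: "'a set"
  assumes sep: "separated r S" and r: "0 < r" and S: "S \<subseteq> ball y (2 ^ n * r)"
  shows "finite S \<and> real (card S) \<le> Cd ^ (n + 3)"
proof -
  have card: "real (card F) \<le> Cd ^ (n + 3)" if F: "F \<subseteq> S" "finite F" for F
  proof -
    let ?W = "V y (2 ^ (n + 1) * r)"
    have sub: "(\<Union>s\<in>F. ball s (r / 2)) \<subseteq> ball y (2 ^ (n + 1) * r)"
    proof
      fix z assume "z \<in> (\<Union>s\<in>F. ball s (r / 2))"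
      then obtain s where s: "s \<in> F" "dist s z < r / 2" by auto
      have "dist y s < 2 ^ n * r" using S F s by auto
      moreover have "r / 2 \<le> 2 ^ n * r" using r mult_right_mono[of 1 "2 ^ n" r] one_le_power[of "2::real" n] by linarith
      ultimately have "dist y z < 2 ^ n * r + 2 ^ n * r" using s dist_triangle[of y z s] by linarith
      then show "z \<in> ball y (2 ^ (n + 1) * r)" by (simp add: mult_ac)
    qed
    have disj: "disjoint_family_on (\<lambda>s. ball s (r / 2)) F"
      unfolding disjoint_family_on_def
    proof (intro ballI impI)
      fix s t assume st: "s \<in> F" "t \<in> F" "s \<noteq> t"
      then have "r \<le> dist s t" using sep F by (auto simp: separated_def)
      show "ball s (r / 2) \<inter> ball t (r / 2) = {}"
      proof (rule ccontr)
        assume "\<not> ?thesis"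
        then obtain z where "dist s z < r / 2" "dist t z < r / 2" by auto
        then show False using \<open>r \<le> dist s t\<close> dist_triangle2[of s t z] by linarith
      qed
    qed
    have "real (card F) * ?W \<le> (\<Sum>s\<in>F. Cd ^ (n + 3) * V s (r / 2))"
    proof -
      have "?W \<le> Cd ^ (n + 3) * V s (r / 2)" if "s \<in> F" for s
      proof (rule V_compare)
        have "s \<in> ball y (2 ^ n * r)" using that F(1) S by blast
        then have "dist y s < 2 ^ n * r" by simp
        moreover have "2 ^ (n + 1) * r = 2 * (2 ^ n * r)" "2 ^ (n + 3) * (r / 2) = 4 * (2 ^ n * r)"
          by (simp_all add: power_add)
        moreover have "0 < 2 ^ n * r" using r by simp
        ultimately show "dist y s + 2 ^ (n + 1) * r \<le> 2 ^ (n + 3) * (r / 2)" by linarith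
      qed (use r in auto)
      then have "(\<Sum>s\<in>F. ?W) \<le> (\<Sum>s\<in>F. Cd ^ (n + 3) * V s (r / 2))" by (rule sum_mono)
      then show ?thesis by simp
    qed
    also have "\<dots> = Cd ^ (n + 3) * measure M (\<Union>s\<in>F. ball s (r / 2))"
    proof -
      have "measure M (\<Union>s\<in>F. ball s (r / 2)) = (\<Sum>s\<in>F. measure M (ball s (r / 2)))"
        using F disj r emeasure_ball_finite[of "r / 2"]
        by (intro measure_finite_Union) (auto simp: less_top)
      then show ?thesis by (simp add: V_def sum_distrib_left)
    qed
    also have "\<dots> \<le> Cd ^ (n + 3) * ?W"
      unfolding V_def using sub Cd emeasure_ball_finite[of "2 ^ (n + 1) * r" y] r F(2)
      by (intro mult_left_mono measure_mono_fmeasurable)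
        (auto simp: fmeasurable_def intro!: sets.finite_UN)
    finally show ?thesis using V_pos[of "2 ^ (n + 1) * r" y] r by simp
  qed
  have "finite S"
  proof (rule ccontr)
    assume inf: "infinite S"
    obtain k :: nat where k: "Cd ^ (n + 3) < real k" using reals_Archimedean2 by blast
    obtain F where "finite F" "card F = k" "F \<subseteq> S"
      using infinite_arbitrarily_large[OF inf] by blast
    then show False using card[of F] k by simp
  qed
  then show ?thesis using card by blast
qed

lemma separated_countable:
  fixes S :: "'a set"
  assumes "separated r S" "0 < r"
  shows "countable S"
proof (cases "S = {}")
  case False
  then obtain ctr where "ctr \<in> S" by blast
  have "finite (S \<inter> ball ctr (2 ^ n * r))" for n
    using separated_card[of r "S \<inter> ball ctr (2 ^ n * r)" ctr n] assms by (auto simp: separated_def)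
  then have "countable (S \<inter> ball ctr (2 ^ n * r))" for n by (rule countable_finite)
  then have "countable (\<Union>n. S \<inter> ball ctr (2 ^ n * r))" by (intro countable_UN) blast+
  moreover have "S \<subseteq> (\<Union>n. S \<inter> ball ctr (2 ^ n * r))"
  proof
    fix x assume "x \<in> S"
    obtain n where "dist ctr x / r < 2 ^ n" using real_arch_pow[of 2] by auto
    then have "dist ctr x < 2 ^ n * r" using assms by (simp add: field_simps)
    then show "x \<in> (\<Union>n. S \<inter> ball ctr (2 ^ n * r))" using \<open>x \<in> S\<close> by auto
  qed
  ultimately show ?thesis by (rule countable_subset[rotated])
qed simp

lemma countable_dense:
  obtains D :: "'a set" where "countable D" "\<And>x e. 0 < e \<Longrightarrow> \<exists>d\<in>D. dist d x < e"
proof -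
  have "\<exists>S :: 'a set. separated (1 / real (Suc n)) S \<and> (\<forall>x. \<exists>s\<in>S. dist s x < 1 / real (Suc n))" for n
    using maximal_separated_set[of "1 / real (Suc n)" UNIV] by (metis UNIV_I of_nat_0_less_iff zero_less_Suc zero_less_divide_1_iff)
  then obtain S :: "nat \<Rightarrow> 'a set" where S: "\<And>n. separated (1 / real (Suc n)) (S n)"
    "\<And>n x. \<exists>s\<in>S n. dist s x < 1 / real (Suc n)" by metis
  show ?thesis
  proof (rule that)
    show "countable (\<Union>n. S n)" using separated_countable[OF S(1)] by (intro countable_UN) auto
    fix e :: real and y :: 'a assume "0 < e"
    then obtain n where n: "1 / real (Suc n) < e" using nat_approx_posE by blast
    obtain s where "s \<in> S n" "dist s y < 1 / real (Suc n)" using S(2) by blast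
    then show "\<exists>d\<in>\<Union>n. S n. dist d y < e" using n by (intro bexI[of _ s]) auto
  qed
qed

lemma disjoint_balls_countable:
  fixes \<rho> :: "'a \<Rightarrow> real"
  assumes "disjoint_family_on (\<lambda>x. ball x (\<rho> x)) C" "\<And>x. x \<in> C \<Longrightarrow> 0 < \<rho> x"
  shows "countable C"
proof -
  have "countable {x \<in> C. 1 / real (Suc n) < \<rho> x}" for n
  proof (rule separated_countable)
    show "separated (1 / real (Suc n)) {x \<in> C. 1 / real (Suc n) < \<rho> x}"
      unfolding separated_def
    proof (intro ballI impI)
      fix x y assume xy: "x \<in> {x \<in> C. 1 / real (Suc n) < \<rho> x}" "y \<in> {x \<in> C. 1 / real (Suc n) < \<rho> x}" "x \<noteq> y"
      then have C: "x \<in> C" "y \<in> C" by simp_all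
      have "ball x (\<rho> x) \<inter> ball y (\<rho> y) = {}"
        by (rule disjoint_family_onD[OF assms(1) C \<open>x \<noteq> y\<close>])
      moreover have "y \<in> ball y (\<rho> y)" using assms(2)[OF C(2)] by simp
      ultimately have "y \<notin> ball x (\<rho> x)" by blast
      then show "1 / real (Suc n) \<le> dist x y" using xy by auto
    qed
  qed auto
  then have "countable (\<Union>n. {x \<in> C. 1 / real (Suc n) < \<rho> x})" by (intro countable_UN) auto
  moreover have "C \<subseteq> (\<Union>n. {x \<in> C. 1 / real (Suc n) < \<rho> x})"
  proof
    fix x assume x: "x \<in> C"
    obtain n where "1 / real (Suc n) < \<rho> x" using nat_approx_posE[OF assms(2)[OF x]] .
    then show "x \<in> (\<Union>n. {x \<in> C. 1 / real (Suc n) < \<rho> x})" using x by blast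
  qed
  ultimately show ?thesis by (rule countable_subset[rotated])
qed

lemma sum_integrals_overlap:
  assumes S: "finite S" "\<And>s. s \<in> S \<Longrightarrow> A s \<in> sets M" "\<And>s. s \<in> S \<Longrightarrow> A s \<subseteq> D"
    and N: "\<And>y. card {s \<in> S. y \<in> A s} \<le> N" and f [measurable]: "f \<in> borel_measurable M"
    and D [measurable]: "D \<in> sets M"
  shows "(\<Sum>s\<in>S. \<integral>\<^sup>+ y\<in>A s. f y \<partial>M) \<le> of_nat N * (\<integral>\<^sup>+ y\<in>D. f y \<partial>M)"
proof -
  have "(\<Sum>s\<in>S. \<integral>\<^sup>+ y\<in>A s. f y \<partial>M) = (\<integral>\<^sup>+ y. (\<Sum>s\<in>S. f y * indicator (A s) y) \<partial>M)"
    using S by (intro nn_integral_sum[symmetric]) auto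
  also have "\<dots> \<le> (\<integral>\<^sup>+ y. of_nat N * (f y * indicator D y) \<partial>M)"
  proof (rule nn_integral_mono)
    fix y
    have "(\<Sum>s\<in>S. indicator (A s) y) = (of_nat (card {s \<in> S. y \<in> A s}) :: ennreal)"
      using S(1) by (simp add: indicator_def of_bool_def sum.If_cases Int_def)
    then have "(\<Sum>s\<in>S. f y * indicator (A s) y) = f y * of_nat (card {s \<in> S. y \<in> A s})"
      by (simp add: sum_distrib_left[symmetric])
    also have "\<dots> \<le> of_nat N * (f y * indicator D y)"
    proof (cases "y \<in> D")
      case True
      have "f y * of_nat (card {s \<in> S. y \<in> A s}) \<le> f y * of_nat N"
        by (intro mult_left_mono of_nat_mono N) simp
      then show ?thesis using True by (simp add: mult.commute)
    next
      case False
      then have none: "{s \<in> S. y \<in> A s} = {}" using S(3) by blast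
      show ?thesis unfolding none by simp
    qed
    finally show "(\<Sum>s\<in>S. f y * indicator (A s) y) \<le> of_nat N * (f y * indicator D y)" .
  qed
  also have "\<dots> = of_nat N * (\<integral>\<^sup>+ y\<in>D. f y \<partial>M)" by (rule nn_integral_cmult) measurable
  finally show ?thesis .
qed

text \<open>
  Borel regularity: a measurable set of finite measure differs by a null set from a Borel set that
  contains it.
\<close>

lemma borel_hull:
  assumes A: "A \<in> sets M" "emeasure M A < \<infinity>"
  obtains B where "B \<in> sets borel" "A \<subseteq> B" "AE x in M. x \<in> B \<longrightarrow> x \<in> A"
proof -
  obtain B where B: "B \<in> sets borel" "A \<subseteq> B" "\<mu> B = \<mu> A"
    using regular unfolding borel_regular_outer_measure_def by blast
  have BM: "B \<in> sets M" using B borel_sets_M by blast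
  have "emeasure M (B - A) = emeasure M B - emeasure M A"
    using A B BM by (intro emeasure_Diff) auto
  also have "\<dots> = 0" using A B BM by (simp add: emeasure_M)
  finally have "B - A \<in> null_sets M" using A BM by (auto intro: null_setsI)
  then have "AE x in M. x \<notin> B - A" by (rule AE_not_in)
  then show ?thesis using that[OF B(1,2)] by (auto elim: eventually_mono)
qed


section \<open>Capacities with genuine upper gradients\<close>

text \<open>
  The competitors for the capacities below. Truncation at the levels 0 and 1 costs nothing, and bounded
  real-valued functions with genuine upper gradients are stable under countable suprema.
\<close>

definition admissible :: "('a \<Rightarrow> real) \<Rightarrow> ('a \<Rightarrow> ennreal) \<Rightarrow> bool" where
  "admissible v g \<longleftrightarrow> v \<in> borel_measurable M \<and> (\<forall>x. 0 \<le> v x \<and> v x \<le> 1) \<and> upper_gradient_real v g"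

definition energy :: "real \<Rightarrow> ('a \<Rightarrow> real) \<Rightarrow> ('a \<Rightarrow> ennreal) \<Rightarrow> ennreal" where
  "energy K v g = (\<integral>\<^sup>+ x. g x \<partial>M) + ennreal K * (\<integral>\<^sup>+ x. ennreal (v x) \<partial>M)"

text \<open>
  The Newton-Sobolev capacity with the integral of the function weighted by \<open>K\<close>. With \<open>K = 1 / R\<close>
  both parts of the energy scale in the same way on balls of radius \<open>R\<close>.
\<close>

definition cap :: "real \<Rightarrow> 'a set \<Rightarrow> ennreal" where
  "cap K A = (INF (v, g)\<in>{(v, g). admissible v g \<and> (\<forall>x\<in>A. v x = 1)}. energy K v g)"

lemma admissibleD:
  assumes "admissible v g"
  shows "v \<in> borel_measurable M" "0 \<le> v x" "v x \<le> 1" "upper_gradient_real v g"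
    "g \<in> borel_measurable borel" "g \<in> borel_measurable M"
  using assms borel_measurable_M by (auto simp: admissible_def upper_gradient_def)

lemma cap_le: "admissible v g \<Longrightarrow> (\<And>x. x \<in> A \<Longrightarrow> v x = 1) \<Longrightarrow> cap K A \<le> energy K v g"
  unfolding cap_def by (intro INF_lower2[of "(v, g)"]) auto

lemma cap_approx:
  assumes "cap K A < C"
  obtains v g where "admissible v g" "\<And>x. x \<in> A \<Longrightarrow> v x = 1" "energy K v g < C"
  using assms unfolding cap_def INF_less_iff by auto

lemma cap_mono: "A \<subseteq> B \<Longrightarrow> cap K A \<le> cap K B"
  unfolding cap_def by (intro INF_superset_mono) auto

lemma cap_empty [simp]: "cap K {} = 0"
proof -
  have "upper_gradient_real (\<lambda>_::'a. 0) (\<lambda>_. 0)" by (simp add: upper_gradient_real_iff)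
  then have "admissible (\<lambda>_. 0) (\<lambda>_. 0)" by (simp add: admissible_def)
  then have "cap K {} \<le> energy K (\<lambda>_. 0) (\<lambda>_. 0)" by (rule cap_le) simp
  then show ?thesis by (simp add: energy_def)
qed

lemma term_le_suminf: "f i \<le> suminf f" for f :: "nat \<Rightarrow> ennreal"
  using sum_le_suminf[of f "{i}"] by simp

text \<open>
  The supremum of the upper gradients is an upper gradient of the supremum, as a supremum oscillates
  between two points at most as much as the worst of its members.
\<close>

lemma admissible_SUP:
  assumes admissible: "\<And>i::nat. admissible (v i) (g i)"
  shows "admissible (\<lambda>x. SUP i. v i x) (\<lambda>x. SUP i. g i x)"
  unfolding admissible_def upper_gradient_real_iff
proof (intro conjI allI impI)
  have bdd: "bdd_above (range (\<lambda>i. v i x))" for x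
    using admissibleD(3)[OF admissible] by (intro bdd_aboveI[of _ 1]) auto
  show "(\<lambda>x. SUP i. v i x) \<in> borel_measurable M"
    using admissibleD(1)[OF admissible] bdd by (intro borel_measurable_cSUP) auto
  show "(\<lambda>x. SUP i. g i x) \<in> borel_measurable borel"
    using admissibleD(5)[OF admissible] by (intro borel_measurable_SUP) auto
  show "(SUP i. v i x) \<le> 1" for x using admissibleD(3)[OF admissible] by (intro cSUP_least) auto
  show "0 \<le> (SUP i. v i x)" for x
    using admissibleD(2)[OF admissible, of 0 x] cSUP_upper[OF UNIV_I bdd, of 0 x] by linarith
  fix a b and \<gamma> :: "real \<Rightarrow> 'a" assume c: "(a, b, \<gamma>) \<in> curves"
  show "ennreal \<bar>(SUP i. v i (\<gamma> a)) - (SUP i. v i (\<gamma> b))\<bar> \<le> curve_integral (a, b, \<gamma>) (\<lambda>x. SUP i. g i x)"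
  proof (cases "curve_integral (a, b, \<gamma>) (\<lambda>x. SUP i. g i x)")
    case (real C)
    have each: "\<bar>v i (\<gamma> a) - v i (\<gamma> b)\<bar> \<le> C" for i
    proof -
      have "ennreal \<bar>v i (\<gamma> a) - v i (\<gamma> b)\<bar> \<le> curve_integral (a, b, \<gamma>) (g i)"
        using admissibleD(4)[OF admissible, of i] c by (simp add: upper_gradient_real_iff)
      also have "\<dots> \<le> ennreal C"
        unfolding real(2)[symmetric] by (intro curve_integral_mono SUP_upper) simp
      finally show ?thesis using real(1) by (simp add: ennreal_le_iff)
    qed
    have "(SUP i. v i x) \<le> (SUP i. v i y) + C" if "\<And>i. v i x \<le> v i y + C" for x y
    proof (rule cSUP_least)
      fix i
      show "v i x \<le> (SUP i. v i y) + C" using that[of i] cSUP_upper[OF UNIV_I bdd, of i y] by linarith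
    qed simp
    from this[of "\<gamma> a" "\<gamma> b"] this[of "\<gamma> b" "\<gamma> a"] each
    have "\<bar>(SUP i. v i (\<gamma> a)) - (SUP i. v i (\<gamma> b))\<bar> \<le> C" by (smt (verit))
    then show ?thesis using real by (simp add: ennreal_leI)
  qed simp
qed

text \<open>
  Nearly optimal competitors \<open>v i\<close>, with errors \<open>e * 2 ^ -(i + 1)\<close>, are replaced by their supremum.
  The suprema of the functions and of the upper gradients are bounded by the sums.
\<close>

lemma cap_countable_subadditive: "cap K (\<Union>i. A i) \<le> (\<Sum>i. cap K (A i))"
proof (rule ennreal_le_epsilon)
  fix e :: real assume fin: "(\<Sum>i. cap K (A i)) < top" and e: "0 < e"
  have "\<exists>v g. admissible v g \<and> (\<forall>x\<in>A i. v x = 1) \<and> energy K v g < cap K (A i) + ennreal (e * (1/2) ^ Suc i)" for i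
  proof -
    have "cap K (A i) < top" using term_le_suminf[of "\<lambda>i. cap K (A i)" i] fin by (rule le_less_trans)
    moreover have "0 < ennreal (e * (1/2) ^ Suc i)" using e by simp
    ultimately have "cap K (A i) < cap K (A i) + ennreal (e * (1/2) ^ Suc i)"
      using ennreal_add_left_cancel_less[of "cap K (A i)" 0] by simp
    then show ?thesis by (rule cap_approx) blast
  qed
  then obtain v g where admissible: "\<And>i. admissible (v i) (g i)" and one: "\<And>i x. x \<in> A i \<Longrightarrow> v i x = 1"
    and en: "\<And>i. energy K (v i) (g i) < cap K (A i) + ennreal (e * (1/2) ^ Suc i)" by metis
  have bdd: "bdd_above (range (\<lambda>i. v i x))" for x
    using admissibleD(3)[OF admissible] by (intro bdd_aboveI[of _ 1]) auto
  have [measurable]: "v i \<in> borel_measurable M" "g i \<in> borel_measurable M" for i using admissibleD[OF admissible] by auto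
  have G: "(\<integral>\<^sup>+ x. (SUP i. g i x) \<partial>M) \<le> (\<Sum>i. \<integral>\<^sup>+ x. g i x \<partial>M)"
    unfolding nn_integral_suminf[symmetric, OF \<open>\<And>i. g i \<in> borel_measurable M\<close>]
    by (intro nn_integral_mono SUP_least term_le_suminf[of "\<lambda>i. g i _"])
  have "ennreal (SUP i. v i x) \<le> (\<Sum>i. ennreal (v i x))" for x
  proof -
    show ?thesis
    proof (cases "\<Sum>i. ennreal (v i x)")
      case (real C)
      have "v i x \<le> C" for i
        using term_le_suminf[of "\<lambda>i. ennreal (v i x)" i] real by (simp add: ennreal_le_iff)
      then have "(SUP i. v i x) \<le> C" by (intro cSUP_least) auto
      then show ?thesis unfolding real(2) by (rule ennreal_leI)
    qed simp
  qed
  then have "(\<integral>\<^sup>+ x. ennreal (SUP i. v i x) \<partial>M) \<le> (\<integral>\<^sup>+ x. (\<Sum>i. ennreal (v i x)) \<partial>M)"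
    by (intro nn_integral_mono)
  also have "\<dots> = (\<Sum>i. \<integral>\<^sup>+ x. ennreal (v i x) \<partial>M)" by (rule nn_integral_suminf) measurable
  finally have V: "(\<integral>\<^sup>+ x. ennreal (SUP i. v i x) \<partial>M) \<le> (\<Sum>i. \<integral>\<^sup>+ x. ennreal (v i x) \<partial>M)" .
  have "cap K (\<Union>i. A i) \<le> energy K (\<lambda>x. SUP i. v i x) (\<lambda>x. SUP i. g i x)"
  proof (rule cap_le[OF admissible_SUP[OF admissible]])
    fix x assume "x \<in> (\<Union>i. A i)"
    then obtain i where "x \<in> A i" by blast
    then have "1 \<le> (SUP i. v i x)" using cSUP_upper[OF UNIV_I bdd, of i x] one[of x i] by simp
    moreover have "(SUP i. v i x) \<le> 1" using admissibleD(3)[OF admissible] by (intro cSUP_least) auto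
    ultimately show "(SUP i. v i x) = 1" by simp
  qed
  also have "\<dots> \<le> (\<Sum>i. \<integral>\<^sup>+ x. g i x \<partial>M) + ennreal K * (\<Sum>i. \<integral>\<^sup>+ x. ennreal (v i x) \<partial>M)"
    unfolding energy_def by (intro add_mono mult_left_mono G V) simp
  also have "\<dots> = (\<Sum>i. energy K (v i) (g i))"
    unfolding energy_def by (simp add: suminf_add[symmetric] ennreal_suminf_cmult)
  also have "\<dots> \<le> (\<Sum>i. cap K (A i) + ennreal (e * (1/2) ^ Suc i))"
    by (intro suminf_le less_imp_le[OF en] summableI)
  also have "\<dots> = (\<Sum>i. cap K (A i)) + (\<Sum>i. ennreal (e * (1/2) ^ Suc i))"
    by (rule suminf_add[symmetric]) (rule summableI)+
  also have "(\<Sum>i. ennreal (e * (1/2) ^ Suc i)) = ennreal e"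
    using sums_mult[OF power_half_series, of e] e by (intro suminf_ennreal_eq) auto
  finally show "cap K (\<Union>i. A i) \<le> (\<Sum>i. cap K (A i)) + ennreal e" .
qed

text \<open>
  Countable subadditivity in the form in which covering arguments use it: a bound for the finite
  partial sums is enough.
\<close>

lemma cap_countable_cover:
  assumes I: "countable I" and C: "\<And>F. finite F \<Longrightarrow> F \<subseteq> I \<Longrightarrow> (\<Sum>i\<in>F. cap K (A i)) \<le> C"
  shows "cap K (\<Union>i\<in>I. A i) \<le> C"
proof -
  define J where "J = to_nat_on I ` I"
  define f where "f = inv_into I (to_nat_on I)"
  have inj: "inj_on (to_nat_on I) I" by (rule inj_on_to_nat_on[OF I])
  have f: "f n \<in> I" "to_nat_on I (f n) = n" if "n \<in> J" for n
    using that by (auto simp: J_def f_def inv_into_into f_inv_into_f)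
  have f': "f (to_nat_on I i) = i" if "i \<in> I" for i
    unfolding f_def using inv_into_f_f[OF inj that] .
  define B where "B n = (if n \<in> J then A (f n) else {})" for n
  have "(\<Union>i\<in>I. A i) \<subseteq> (\<Union>n. B n)"
  proof
    fix x assume "x \<in> (\<Union>i\<in>I. A i)"
    then obtain i where "i \<in> I" "x \<in> A i" by blast
    then have "x \<in> B (to_nat_on I i)" using f'[of i] by (simp add: B_def J_def)
    then show "x \<in> (\<Union>n. B n)" by blast
  qed
  then have "cap K (\<Union>i\<in>I. A i) \<le> cap K (\<Union>n. B n)" by (rule cap_mono)
  also have "\<dots> \<le> (\<Sum>n. cap K (B n))" by (rule cap_countable_subadditive)
  also have "\<dots> \<le> C"
  proof (rule suminf_le_const)
    fix n
    have inj': "inj_on f ({..<n} \<inter> J)" using f(2) by (metis IntD2 inj_onI)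
    have "(\<Sum>k<n. cap K (B k)) = (\<Sum>k\<in>{..<n} \<inter> J. cap K (A (f k)))"
      by (intro sum.mono_neutral_cong_right) (auto simp: B_def)
    also have "\<dots> = (\<Sum>i\<in>f ` ({..<n} \<inter> J). cap K (A i))"
      by (simp add: sum.reindex[OF inj'])
    also have "\<dots> \<le> C" by (rule C) (use f(1) in auto)
    finally show "(\<Sum>k<n. cap K (B k)) \<le> C" .
  qed (rule summableI)
  finally show ?thesis .
qed

lemma cap_countable_null:
  assumes "countable I" "\<And>i. i \<in> I \<Longrightarrow> cap K (A i) = 0"
  shows "cap K (\<Union>i\<in>I. A i) = 0"
proof -
  have "(\<Sum>i\<in>F. cap K (A i)) \<le> 0" if "F \<subseteq> I" for F
    using assms(2) that by (simp add: subset_iff)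
  then have "cap K (\<Union>i\<in>I. A i) \<le> 0" by (intro cap_countable_cover[OF assms(1)])
  then show ?thesis by simp
qed

lemma cap_Un: "cap K (A \<union> B) \<le> cap K A + cap K B"
proof -
  have "(\<Sum>i\<in>F. cap K (if i then A else B)) \<le> cap K A + cap K B" for F
  proof -
    have "(\<Sum>i\<in>F. cap K (if i then A else B)) \<le> (\<Sum>i\<in>UNIV. cap K (if i then A else B))"
      by (rule sum_mono2) auto
    also have "\<dots> = cap K A + cap K B" by (simp add: UNIV_bool add.commute)
    finally show ?thesis .
  qed
  then have "cap K (\<Union>i\<in>UNIV. if i then A else B) \<le> cap K A + cap K B"
    by (intro cap_countable_cover) auto
  moreover have "(\<Union>i\<in>UNIV. if i then A else B) = A \<union> B" by (auto simp: UNIV_bool)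
  ultimately show ?thesis by simp
qed

text \<open>
  Every admissible pair competes for the Newton-Sobolev capacity, because a genuine upper gradient is a
  weak one with the empty exceptional family.
\<close>

lemma Cap1_le_cap:
  assumes K: "1 \<le> K"
  shows "Cap1 \<mu> A \<le> cap K A"
  unfolding cap_def
proof (rule INF_greatest, clarify)
  fix v g assume admissible: "admissible v g" and one: "\<forall>x\<in>A. v x = 1"
  show "Cap1 \<mu> A \<le> energy K v g"
  proof (cases "energy K v g = \<infinity>")
    case False
    have "modulus1 \<mu> ({} :: 'a curve set) \<le> (\<integral>\<^sup>+ x. 0 \<partial>M)"
      unfolding modulus1_def by (rule INF_lower) simp
    then have "modulus1 \<mu> ({} :: 'a curve set) = 0" by simp
    then have "weak_upper_gradient \<mu> (\<lambda>x. ereal (v x)) g"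
      using admissibleD(4)[OF admissible] unfolding weak_upper_gradient_def upper_gradient_def
      by (intro conjI exI[of _ "{}"]) auto
    then have "(INF g \<in> {g. weak_upper_gradient \<mu> (\<lambda>x. ereal (v x)) g}. \<integral>\<^sup>+ x. g x \<partial>M) \<le> (\<integral>\<^sup>+ x. g x \<partial>M)"
      by (intro INF_lower) simp
    moreover have "(\<integral>\<^sup>+ x. e2ennreal \<bar>ereal (v x)\<bar> \<partial>M) \<le> ennreal K * (\<integral>\<^sup>+ x. ennreal (v x) \<partial>M)"
    proof -
      have "(\<integral>\<^sup>+ x. e2ennreal \<bar>ereal (v x)\<bar> \<partial>M) = 1 * (\<integral>\<^sup>+ x. ennreal (v x) \<partial>M)"
        using admissibleD(2)[OF admissible] by simp
      also have "\<dots> \<le> ennreal K * (\<integral>\<^sup>+ x. ennreal (v x) \<partial>M)"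
        using K by (intro mult_right_mono) auto
      finally show ?thesis .
    qed
    ultimately have le: "N11_norm \<mu> (\<lambda>x. ereal (v x)) \<le> energy K v g"
      unfolding N11_norm_def energy_def by (metis add.commute add_mono)
    then have "N11_norm \<mu> (\<lambda>x. ereal (v x)) < \<infinity>"
      by (rule le_less_trans) (use False in \<open>simp add: less_top\<close>)
    then have "(\<lambda>x. ereal (v x)) \<in> N11 \<mu>" using admissibleD(1)[OF admissible] by (simp add: N11_def)
    then have "Cap1 \<mu> A \<le> N11_norm \<mu> (\<lambda>x. ereal (v x))"
      unfolding Cap1_def using one by (intro INF_lower) (auto simp: one_ereal_def)
    then show ?thesis using le by (rule order_trans)
  qed simp
qed

text \<open>
  Truncation at the levels 0 and 1 removes infinite values and is a contraction.
\<close>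

lemma admissible_of_N11:
  assumes u: "u \<in> N11 \<mu>" and g: "upper_gradient u g"
  shows "admissible (\<lambda>x. real_of_ereal (max 0 (min 1 (u x)))) g"
  unfolding admissible_def upper_gradient_real_iff
proof (intro conjI allI impI)
  let ?c = "\<lambda>y::ereal. real_of_ereal (max 0 (min 1 y))"
  have [measurable]: "u \<in> borel_measurable M" using u by (simp add: N11_def)
  show "(\<lambda>x. ?c (u x)) \<in> borel_measurable M" by measurable
  show "g \<in> borel_measurable borel" using g by (simp add: upper_gradient_def)
  have c: "0 \<le> ?c y \<and> ?c y \<le> 1" for y
    by (cases y) (auto simp: max_def min_def one_ereal_def zero_ereal_def)
  then show "0 \<le> ?c (u x)" "?c (u x) \<le> 1" for x by auto
  have gap: "ennreal \<bar>?c y - ?c z\<bar> \<le> ereal_gap y z" for y z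
  proof (cases "\<bar>y\<bar> = \<infinity> \<or> \<bar>z\<bar> = \<infinity>")
    case True then show ?thesis by (simp add: ereal_gap_def)
  next
    case False
    then obtain y' z' where yz: "y = ereal y'" "z = ereal z'" by (metis abs_ereal.simps(2,3) ereal_cases)
    have *: "?c (ereal t) = max 0 (min 1 t)" for t by (auto simp: max_def min_def one_ereal_def zero_ereal_def)
    show ?thesis unfolding yz * ereal_gap_real by (rule ennreal_leI) auto
  qed
  fix a b and \<gamma> :: "real \<Rightarrow> 'a" assume "(a, b, \<gamma>) \<in> curves"
  then have "ereal_gap (u (\<gamma> a)) (u (\<gamma> b)) \<le> curve_integral (a, b, \<gamma>) g"
    using g by (auto simp: upper_gradient_def upper_gradient_along_def)
  then show "ennreal \<bar>?c (u (\<gamma> a)) - ?c (u (\<gamma> b))\<bar> \<le> curve_integral (a, b, \<gamma>) g"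
    using gap order_trans by blast
qed

lemma rel_cap1_approx:
  assumes "rel_cap1 \<mu> A D < C"
  obtains v g where "admissible v g" "\<And>x. x \<in> A \<Longrightarrow> v x = 1" "\<And>x. x \<notin> D \<Longrightarrow> v x = 0" "(\<integral>\<^sup>+ x. g x \<partial>M) < C"
proof -
  obtain u g where u: "u \<in> N11 \<mu>" "\<forall>x\<in>A. 1 \<le> u x" "\<forall>x\<in>-D. u x = 0" "upper_gradient u g"
    "(\<integral>\<^sup>+ x. g x \<partial>M) < C"
    using assms unfolding rel_cap1_def INF_less_iff by auto
  show ?thesis
    by (rule that[OF admissible_of_N11[OF u(1,4)] _ _ u(5)]) (use u in \<open>auto simp: min_def max_def\<close>)
qed

text \<open>
  The Poincare inequality without averages. Only the existence of a good constant \<open>c\<close> matters in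
  its applications, and the ratio of the volumes is at most 1.
\<close>

lemma poincare_admissible:
  assumes admissible: "admissible v g" and r: "0 < r"
  obtains c where "(\<integral>\<^sup>+ y\<in>ball x r. ennreal \<bar>v y - c\<bar> \<partial>M)
    \<le> ennreal (CP * r) * (\<integral>\<^sup>+ y\<in>ball x (\<Lambda> * r). g y \<partial>M)"
proof -
  let ?u = "\<lambda>y. ereal (v y)"
  have "\<exists>r>0. (\<integral>\<^sup>+ y\<in>ball x r. e2ennreal \<bar>?u y\<bar> \<partial>M) < \<infinity>" for x
  proof -
    have "(\<integral>\<^sup>+ y\<in>ball x 1. e2ennreal \<bar>?u y\<bar> \<partial>M) \<le> (\<integral>\<^sup>+ y. indicator (ball x 1) y \<partial>M)"
      using admissibleD(2,3)[OF admissible] by (intro nn_integral_mono) (auto simp: indicator_def ennreal_le_1)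
    also have "\<dots> < \<infinity>" using emeasure_ball_finite[of 1 x] by simp
    finally show ?thesis by (intro exI[of _ 1]) simp
  qed
  then have u: "?u \<in> L1_loc \<mu>" using admissibleD(1)[OF admissible] by (simp add: L1_loc_def)
  define c where "c = ball_mean \<mu> ?u x r"
  define X where "X = (\<integral>\<^sup>+ y\<in>ball x r. ennreal \<bar>v y - c\<bar> \<partial>M)"
  define Y where "Y = (\<integral>\<^sup>+ y\<in>ball x (\<Lambda> * r). g y \<partial>M)"
  have \<Lambda>r: "0 < \<Lambda> * r" using r \<Lambda> by simp
  have b: "\<mu> (ball x r) = ennreal (V x r)" "\<mu> (ball x (\<Lambda> * r)) = ennreal (V x (\<Lambda> * r))"
    using emeasure_ball[OF r] emeasure_ball[OF \<Lambda>r] by (simp_all add: emeasure_M)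
  have le: "V x r \<le> V x (\<Lambda> * r)"
  proof (rule V_mono)
    have "r \<le> \<Lambda> * r" using r \<Lambda> by simp
    then show "ball x r \<subseteq> ball x (\<Lambda> * r)" by auto
  qed (use r \<Lambda>r in auto)
  have "X / ennreal (V x r) \<le> ennreal (CP * r) * (Y / ennreal (V x (\<Lambda> * r)))"
    using poincare[OF r u admissibleD(4)[OF admissible], of x]
    unfolding b c_def[symmetric] by (simp add: X_def Y_def)
  then have "X / ennreal (V x r) * ennreal (V x r) \<le> ennreal (CP * r) * (Y / ennreal (V x (\<Lambda> * r))) * ennreal (V x r)"
    by (rule mult_right_mono) simp
  also have "X / ennreal (V x r) * ennreal (V x r) = X"
    using V_pos[OF r, of x] by (simp add: ennreal_divide_times ennreal_divide_self)
  also have "ennreal (CP * r) * (Y / ennreal (V x (\<Lambda> * r))) * ennreal (V x r)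
      \<le> ennreal (CP * r) * (Y / ennreal (V x (\<Lambda> * r))) * ennreal (V x (\<Lambda> * r))"
    by (intro mult_left_mono ennreal_leI le) simp
  also have "\<dots> = ennreal (CP * r) * Y"
    using V_pos[OF \<Lambda>r, of x] by (simp add: mult.assoc ennreal_divide_times ennreal_mult_divide_eq)
  finally show ?thesis using that[of c] by (simp add: X_def Y_def)
qed


section \<open>Consequences of the Poincare inequality\<close>

lemma markov:
  assumes [measurable]: "v \<in> borel_measurable M" "A \<in> sets M" and "0 \<le> \<alpha>"
  shows "ennreal \<alpha> * emeasure M {x \<in> A. \<alpha> \<le> v x} \<le> (\<integral>\<^sup>+ x\<in>A. ennreal (v x) \<partial>M)"
proof -
  have S: "{x \<in> A. \<alpha> \<le> v x} \<in> sets M"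
  proof -
    have "{x \<in> space M. \<alpha> \<le> v x} \<inter> A \<in> sets M" by measurable
    moreover have "{x \<in> A. \<alpha> \<le> v x} = {x \<in> space M. \<alpha> \<le> v x} \<inter> A" by auto
    ultimately show ?thesis by simp
  qed
  have "ennreal \<alpha> * emeasure M {x \<in> A. \<alpha> \<le> v x} = (\<integral>\<^sup>+ x. ennreal \<alpha> * indicator {x \<in> A. \<alpha> \<le> v x} x \<partial>M)"
    using S by (simp add: nn_integral_cmult_indicator)
  also have "\<dots> \<le> (\<integral>\<^sup>+ x\<in>A. ennreal (v x) \<partial>M)"
    by (intro nn_integral_mono) (auto simp: indicator_def ennreal_leI)
  finally show ?thesis .
qed

lemma sets_level:
  fixes v :: "'a \<Rightarrow> real"
  assumes [measurable]: "v \<in> borel_measurable M" "A \<in> sets M"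
  shows "{x \<in> A. \<alpha> < v x} \<in> sets M" "{x \<in> A. \<alpha> \<le> v x} \<in> sets M" "{x \<in> A. v x = \<alpha>} \<in> sets M"
    "{x \<in> A. v x \<le> \<alpha>} \<in> sets M" "{x \<in> A. v x < \<alpha>} \<in> sets M"
proof -
  have *: "{x \<in> A. P (v x)} = {x \<in> space M. P (v x)} \<inter> A" for P by auto
  show "{x \<in> A. \<alpha> < v x} \<in> sets M" "{x \<in> A. \<alpha> \<le> v x} \<in> sets M" "{x \<in> A. v x = \<alpha>} \<in> sets M"
    "{x \<in> A. v x \<le> \<alpha>} \<in> sets M" "{x \<in> A. v x < \<alpha>} \<in> sets M"
    unfolding * by measurable
qed

text \<open>
  On the set where \<open>v\<close> vanishes, \<open>\<bar>v - c\<bar> = \<bar>c\<bar>\<close>. So if this set fills the fraction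
  \<open>\<theta>\<close> of the ball, the Poincare inequality controls \<open>\<bar>c\<bar>\<close> and hence \<open>v\<close> itself.
\<close>

lemma integral_le_of_zero_portion:
  assumes admissible: "admissible v g" and r: "0 < r" and \<theta>: "0 < \<theta>"
    and zero: "ennreal (\<theta> * V x r) \<le> emeasure M {y \<in> ball x r. v y = 0}"
  shows "(\<integral>\<^sup>+ y\<in>ball x r. ennreal (v y) \<partial>M)
    \<le> ennreal ((1 + 1 / \<theta>) * CP * r) * (\<integral>\<^sup>+ y\<in>ball x (\<Lambda> * r). g y \<partial>M)"
proof -
  have [measurable]: "v \<in> borel_measurable M" by (rule admissibleD[OF admissible])
  obtain c where c: "(\<integral>\<^sup>+ y\<in>ball x r. ennreal \<bar>v y - c\<bar> \<partial>M)
    \<le> ennreal (CP * r) * (\<integral>\<^sup>+ y\<in>ball x (\<Lambda> * r). g y \<partial>M)"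
    using poincare_admissible[OF admissible r] .
  define J where "J = (\<integral>\<^sup>+ y\<in>ball x r. ennreal \<bar>v y - c\<bar> \<partial>M)"
  have Z: "{y \<in> ball x r. v y = 0} \<in> sets M" by (rule sets_level) simp_all
  have "ennreal \<bar>c\<bar> * ennreal (\<theta> * V x r) \<le> ennreal \<bar>c\<bar> * emeasure M {y \<in> ball x r. v y = 0}"
    by (intro mult_left_mono zero) simp
  also have "\<dots> = (\<integral>\<^sup>+ y. ennreal \<bar>c\<bar> * indicator {y \<in> ball x r. v y = 0} y \<partial>M)"
    using Z by (simp add: nn_integral_cmult_indicator)
  also have "\<dots> \<le> J" unfolding J_def by (intro nn_integral_mono) (auto simp: indicator_def)
  finally have cJ: "ennreal \<bar>c\<bar> * ennreal (\<theta> * V x r) \<le> J" .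
  have "(\<integral>\<^sup>+ y\<in>ball x r. ennreal (v y) \<partial>M)
      \<le> (\<integral>\<^sup>+ y. ennreal \<bar>v y - c\<bar> * indicator (ball x r) y + ennreal \<bar>c\<bar> * indicator (ball x r) y \<partial>M)"
    by (intro nn_integral_mono) (auto simp: indicator_def intro!: ennreal_leI simp flip: ennreal_plus)
  also have "\<dots> = J + ennreal \<bar>c\<bar> * ennreal (V x r)"
    unfolding J_def using r
    by (subst nn_integral_add) (auto simp: nn_integral_cmult_indicator emeasure_ball)
  also have "ennreal \<bar>c\<bar> * ennreal (V x r) = ennreal (1 / \<theta>) * (ennreal \<bar>c\<bar> * ennreal (\<theta> * V x r))"
    using \<theta> V_nonneg[of x r] by (simp add: ennreal_mult'[symmetric])
  also have "J + \<dots> \<le> J + ennreal (1 / \<theta>) * J" by (intro add_left_mono mult_left_mono cJ) simp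
  also have "\<dots> = ennreal (1 + 1 / \<theta>) * J" using \<theta> by (simp add: distrib_right)
  also have "\<dots> \<le> ennreal (1 + 1 / \<theta>) * (ennreal (CP * r) * (\<integral>\<^sup>+ y\<in>ball x (\<Lambda> * r). g y \<partial>M))"
    using c unfolding J_def by (rule mult_left_mono) simp
  also have "\<dots> = ennreal ((1 + 1 / \<theta>) * CP * r) * (\<integral>\<^sup>+ y\<in>ball x (\<Lambda> * r). g y \<partial>M)"
    using \<theta> CP r by (simp add: mult.assoc[symmetric] ennreal_mult[symmetric] del: ennreal_plus)
  finally show ?thesis .
qed

text \<open>
  A relative isoperimetric inequality: any constant \<open>c\<close> is at distance at least \<open>1/2\<close> from one of the
  values 0 and 1.
\<close>

lemma volume_le_of_zero_one_portions:
  assumes admissible: "admissible v g" and r: "0 < r" and \<theta>: "0 < \<theta>"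
    and zero: "ennreal (\<theta> * V x r) \<le> emeasure M {y \<in> ball x r. v y = 0}"
    and one: "ennreal (\<theta> * V x r) \<le> emeasure M {y \<in> ball x r. v y = 1}"
  shows "ennreal (\<theta> * V x r) \<le> ennreal (CP * r) * (\<integral>\<^sup>+ y\<in>ball x (\<Lambda> * r). g y \<partial>M)"
proof -
  have [measurable]: "v \<in> borel_measurable M" by (rule admissibleD[OF admissible])
  obtain c where c: "(\<integral>\<^sup>+ y\<in>ball x r. ennreal \<bar>v y - c\<bar> \<partial>M)
    \<le> ennreal (CP * r) * (\<integral>\<^sup>+ y\<in>ball x (\<Lambda> * r). g y \<partial>M)"
    using poincare_admissible[OF admissible r] .
  have S: "{y \<in> ball x r. v y = 0} \<in> sets M" "{y \<in> ball x r. v y = 1} \<in> sets M" by (rule sets_level; simp)+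
  have "ennreal (\<theta> * V x r) \<le> ennreal (\<bar>c\<bar> + \<bar>1 - c\<bar>) * ennreal (\<theta> * V x r)"
  proof -
    have "1 * ennreal (\<theta> * V x r) \<le> ennreal (\<bar>c\<bar> + \<bar>1 - c\<bar>) * ennreal (\<theta> * V x r)"
      by (intro mult_right_mono) (auto simp flip: ennreal_1 intro!: ennreal_leI simp del: ennreal_plus)
    then show ?thesis by simp
  qed
  also have "\<dots> = ennreal \<bar>c\<bar> * ennreal (\<theta> * V x r) + ennreal \<bar>1 - c\<bar> * ennreal (\<theta> * V x r)"
    by (simp add: distrib_right)
  also have "\<dots> \<le> ennreal \<bar>c\<bar> * emeasure M {y \<in> ball x r. v y = 0} + ennreal \<bar>1 - c\<bar> * emeasure M {y \<in> ball x r. v y = 1}"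
    by (intro add_mono mult_left_mono zero one) simp_all
  also have "\<dots> = (\<integral>\<^sup>+ y. ennreal \<bar>c\<bar> * indicator {y \<in> ball x r. v y = 0} y +
      ennreal \<bar>1 - c\<bar> * indicator {y \<in> ball x r. v y = 1} y \<partial>M)"
    using S by (subst nn_integral_add) (auto simp: nn_integral_cmult_indicator)
  also have "\<dots> \<le> (\<integral>\<^sup>+ y\<in>ball x r. ennreal \<bar>v y - c\<bar> \<partial>M)"
    by (intro nn_integral_mono) (auto simp: indicator_def)
  finally show ?thesis using c by (rule order_trans)
qed

text \<open>
  The truncation has an upper gradient whose integral over any set is that of \<open>g\<close> over the strip
  between the levels, up to the factor \<open>1 / (\<beta> - \<alpha>)\<close> and a small multiple of the integral of \<open>g\<close>.
  The level \<open>\<alpha>\<close> is positive so that the strip has finite measure and a Borel hull.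
\<close>

lemma admissible_ramp:
  assumes admissible: "admissible v g" and fin: "(\<integral>\<^sup>+ x. ennreal (v x) \<partial>M) < \<infinity>"
    and \<alpha>\<beta>: "0 < \<alpha>" "\<alpha> < \<beta>" and \<delta>: "0 < \<delta>"
  obtains g' where "admissible (\<lambda>x. ramp \<alpha> \<beta> (v x)) g'"
    "\<forall>A\<in>sets M. (\<integral>\<^sup>+ x\<in>A. g' x \<partial>M) \<le> ennreal (1 / (\<beta> - \<alpha>)) *
       ((\<integral>\<^sup>+ x\<in>A. g x * indicator {x. \<alpha> < v x \<and> v x < \<beta>} x \<partial>M) + ennreal \<delta> * (\<integral>\<^sup>+ x\<in>A. g x \<partial>M))"
proof -
  have [measurable]: "v \<in> borel_measurable M" "g \<in> borel_measurable M" "g \<in> borel_measurable borel"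
    by (rule admissibleD[OF admissible])+
  define S where "S = {x. \<alpha> < v x \<and> v x < \<beta>}"
  have S [measurable]: "S \<in> sets M"
  proof -
    have "{x \<in> space M. \<alpha> < v x \<and> v x < \<beta>} \<in> sets M" by measurable
    then show ?thesis by (simp add: S_def)
  qed
  have "ennreal \<alpha> * emeasure M S \<le> ennreal \<alpha> * emeasure M {x \<in> UNIV. \<alpha> \<le> v x}"
    by (intro mult_left_mono emeasure_mono sets_level) (auto simp: S_def sets.top[of M, simplified])
  also have "\<dots> \<le> (\<integral>\<^sup>+ x. ennreal (v x) \<partial>M)"
    using markov[of v UNIV \<alpha>] \<alpha>\<beta> sets.top[of M] by simp
  finally have "ennreal \<alpha> * emeasure M S < \<infinity>" using fin by (rule le_less_trans)
  then have "emeasure M S < \<infinity>" using \<alpha>\<beta>(1) by (auto simp: ennreal_mult_less_top)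
  then obtain W where W: "W \<in> sets borel" "S \<subseteq> W" "AE x in M. x \<in> W \<longrightarrow> x \<in> S"
    using borel_hull[OF S] by blast
  have [measurable]: "W \<in> sets M" "W \<in> sets borel" using W(1) borel_sets_M by auto
  define h where "h x = max (g x * indicator W x) (ennreal \<delta> * g x)" for x
  have "upper_gradient_real (\<lambda>x. max \<alpha> (min \<beta> (v x))) h"
    unfolding h_def
  proof (rule upper_gradient_truncation[OF admissibleD(4)[OF admissible] \<alpha>\<beta>(2) W(1)])
    show "{x. \<alpha> < v x \<and> v x < \<beta>} \<subseteq> W" using W(2) by (simp add: S_def)
    show "(\<lambda>x. ennreal \<delta> * g x) \<in> borel_measurable borel" by measurable
    fix c :: "'a curve" assume "c \<in> curves" "curve_integral c g = \<infinity>"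
    then show "curve_integral c (\<lambda>x. ennreal \<delta> * g x) = \<infinity>"
      using \<delta> by (simp add: curve_integral_cmult ennreal_mult_top)
  qed
  then have ug: "upper_gradient_real (\<lambda>x. (1 / (\<beta> - \<alpha>)) * (max \<alpha> (min \<beta> (v x)) - \<alpha>)) (\<lambda>x. ennreal (1 / (\<beta> - \<alpha>)) * h x)"
    by (rule upper_gradient_real_affine) (use \<alpha>\<beta> in simp)
  show ?thesis
  proof (rule that; (rule ballI)?)
    show "admissible (\<lambda>x. ramp \<alpha> \<beta> (v x)) (\<lambda>x. ennreal (1 / (\<beta> - \<alpha>)) * h x)"
      unfolding admissible_def
    proof (intro conjI allI)
      show "(\<lambda>x. ramp \<alpha> \<beta> (v x)) \<in> borel_measurable M" unfolding ramp_def by measurable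
      show "upper_gradient_real (\<lambda>x. ramp \<alpha> \<beta> (v x)) (\<lambda>x. ennreal (1 / (\<beta> - \<alpha>)) * h x)"
        using ug by (simp add: ramp_def)
    qed (use ramp_simps(1,2)[OF \<alpha>\<beta>(2)] in auto)
    fix A assume [measurable]: "A \<in> sets M"
    have [measurable]: "h \<in> borel_measurable M" unfolding h_def by measurable
    have "(\<integral>\<^sup>+ x\<in>A. ennreal (1 / (\<beta> - \<alpha>)) * h x \<partial>M) = ennreal (1 / (\<beta> - \<alpha>)) * (\<integral>\<^sup>+ x\<in>A. h x \<partial>M)"
      unfolding mult.assoc by (rule nn_integral_cmult) measurable
    also have "(\<integral>\<^sup>+ x\<in>A. h x \<partial>M) \<le> (\<integral>\<^sup>+ x. (g x * indicator S x) * indicator A x + ennreal \<delta> * (g x * indicator A x) \<partial>M)"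
    proof (rule nn_integral_mono_AE)
      show "AE x in M. h x * indicator A x \<le> (g x * indicator S x) * indicator A x + ennreal \<delta> * (g x * indicator A x)"
        using W(3)
      proof eventually_elim
        case (elim x)
        then have "g x * indicator W x \<le> g x * indicator S x" by (auto simp: indicator_def)
        then have "h x \<le> g x * indicator S x + ennreal \<delta> * g x"
          unfolding h_def by (intro max.boundedI) (auto intro: order_trans add_increasing2 add_increasing)
        then show ?case by (auto simp: indicator_def)
      qed
    qed
    also have "\<dots> = (\<integral>\<^sup>+ x\<in>A. g x * indicator S x \<partial>M) + ennreal \<delta> * (\<integral>\<^sup>+ x\<in>A. g x \<partial>M)"
      by (subst nn_integral_add) (auto simp: nn_integral_cmult)
    finally show "(\<integral>\<^sup>+ x\<in>A. ennreal (1 / (\<beta> - \<alpha>)) * h x \<partial>M) \<le> ennreal (1 / (\<beta> - \<alpha>)) *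
       ((\<integral>\<^sup>+ x\<in>A. g x * indicator {x. \<alpha> < v x \<and> v x < \<beta>} x \<partial>M) + ennreal \<delta> * (\<integral>\<^sup>+ x\<in>A. g x \<partial>M))"
      unfolding S_def by (simp add: mult_left_mono)
  qed
qed

end


section \<open>Points of low density\<close>

lemma ramp_lipschitz:
  assumes "\<alpha> < \<beta>"
  shows "\<bar>ramp \<alpha> \<beta> s - ramp \<alpha> \<beta> t\<bar> \<le> 1 / (\<beta> - \<alpha>) * \<bar>s - t\<bar>"
proof -
  have "\<bar>max \<alpha> (min \<beta> s) - max \<alpha> (min \<beta> t)\<bar> \<le> \<bar>s - t\<bar>" by linarith
  then have "\<bar>(max \<alpha> (min \<beta> s) - max \<alpha> (min \<beta> t)) / (\<beta> - \<alpha>)\<bar> \<le> \<bar>s - t\<bar> / (\<beta> - \<alpha>)"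
    using assms by (simp add: divide_right_mono)
  moreover have "ramp \<alpha> \<beta> s - ramp \<alpha> \<beta> t = (max \<alpha> (min \<beta> s) - max \<alpha> (min \<beta> t)) / (\<beta> - \<alpha>)"
    unfolding ramp_def by (simp add: diff_divide_distrib[symmetric])
  ultimately show ?thesis by simp
qed

definition cutoff :: "'a::metric_space set \<Rightarrow> real \<Rightarrow> 'a \<Rightarrow> real" where
  "cutoff Z r x = max 0 (1 - infdist x Z / r)"

lemma cutoff_bounds: "0 < r \<Longrightarrow> 0 \<le> cutoff Z r x" "0 < r \<Longrightarrow> cutoff Z r x \<le> 1"
  using infdist_nonneg[of x Z] by (auto simp: cutoff_def)

lemma cutoff_one: "x \<in> Z \<Longrightarrow> cutoff Z r x = 1"
  by (simp add: cutoff_def)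

lemma cutoff_support:
  assumes "0 < cutoff Z r x" "Z \<noteq> {}" "0 < r"
  shows "x \<in> nbhd Z r"
proof -
  have "infdist x Z < r" using assms by (auto simp: cutoff_def max_def field_simps split: if_splits)
  then have "(INF a\<in>Z. dist x a) < r" using assms(2) by (simp add: infdist_def)
  then obtain z where "z \<in> Z" "dist x z < r"
    using assms(2) by (subst (asm) cINF_less_iff) auto
  then show ?thesis unfolding nbhd_def by (intro UN_I[of z]) (simp_all add: dist_commute)
qed

lemma cutoff_lipschitz:
  assumes "0 < r"
  shows "\<bar>cutoff Z r x - cutoff Z r y\<bar> \<le> 1 / r * dist x y"
proof -
  have "\<bar>cutoff Z r x - cutoff Z r y\<bar> \<le> \<bar>infdist x Z / r - infdist y Z / r\<bar>"
    unfolding cutoff_def by linarith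
  also have "\<dots> = \<bar>infdist x Z - infdist y Z\<bar> / r" using assms by (simp add: diff_divide_distrib[symmetric])
  also have "\<dots> \<le> dist x y / r" using assms infdist_triangle_abs[of x Z y] by (intro divide_right_mono) auto
  finally show ?thesis by simp
qed

lemma continuous_cutoff: "continuous_on UNIV (cutoff Z r)"
proof -
  have "continuous_on UNIV (\<lambda>x. infdist x Z)" by (intro continuous_intros)
  then show ?thesis unfolding cutoff_def divide_inverse by (intro continuous_intros)
qed

lemma upper_gradient_min_cutoff:
  assumes ug: "upper_gradient_real v g" and \<alpha>\<beta>: "\<alpha> < \<beta>" and r: "0 < r"
  shows "upper_gradient_real (\<lambda>x. min (ramp \<alpha> \<beta> (v x)) (cutoff Z r x))
    (\<lambda>x. ennreal (1 / (\<beta> - \<alpha>)) * g x + ennreal (1 / r))"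
  unfolding upper_gradient_real_iff
proof (intro conjI allI impI)
  have g [measurable]: "g \<in> borel_measurable borel" using ug by (simp add: upper_gradient_def)
  show m: "(\<lambda>x. ennreal (1 / (\<beta> - \<alpha>)) * g x + ennreal (1 / r)) \<in> borel_measurable borel" by measurable
  fix a b and \<gamma> :: "real \<Rightarrow> 'a" assume c: "(a, b, \<gamma>) \<in> curves"
  let ?w = "\<lambda>x. min (ramp \<alpha> \<beta> (v x)) (cutoff Z r x)"
  let ?k = "1 / (\<beta> - \<alpha>)"
  have "\<bar>?w (\<gamma> a) - ?w (\<gamma> b)\<bar> \<le> ?k * \<bar>v (\<gamma> a) - v (\<gamma> b)\<bar> + 1 / r * dist (\<gamma> a) (\<gamma> b)"
  proof -
    have "0 \<le> ?k * \<bar>v (\<gamma> a) - v (\<gamma> b)\<bar>" "0 \<le> 1 / r * dist (\<gamma> a) (\<gamma> b)" using \<alpha>\<beta> r by simp_all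
    then show ?thesis
      using ramp_lipschitz[OF \<alpha>\<beta>, of "v (\<gamma> a)" "v (\<gamma> b)"] cutoff_lipschitz[OF r, of Z "\<gamma> a" "\<gamma> b"]
      unfolding min_def abs_le_iff by (smt (verit))
  qed
  then have "ennreal \<bar>?w (\<gamma> a) - ?w (\<gamma> b)\<bar> \<le>
      ennreal (?k * \<bar>v (\<gamma> a) - v (\<gamma> b)\<bar> + 1 / r * dist (\<gamma> a) (\<gamma> b))" by (rule ennreal_leI)
  also have "\<dots> = ennreal ?k * ennreal \<bar>v (\<gamma> a) - v (\<gamma> b)\<bar> + ennreal (1 / r) * ennreal (dist (\<gamma> a) (\<gamma> b))"
  proof -
    have "0 \<le> ?k" "0 \<le> 1 / r" using \<alpha>\<beta> r by simp_all
    then show ?thesis by (simp only: ennreal_plus ennreal_mult mult_nonneg_nonneg abs_ge_zero zero_le_dist)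
  qed
  also have "\<dots> \<le> ennreal ?k * curve_integral (a, b, \<gamma>) g + ennreal (1 / r) * curve_length a b \<gamma>"
  proof (intro add_mono mult_left_mono)
    show "ennreal \<bar>v (\<gamma> a) - v (\<gamma> b)\<bar> \<le> curve_integral (a, b, \<gamma>) g"
      using ug c by (simp add: upper_gradient_real_iff)
    show "ennreal (dist (\<gamma> a) (\<gamma> b)) \<le> curve_length a b \<gamma>"
      using c by (intro dist_le_curve_length) (simp add: curves_def)
  qed simp_all
  also have "\<dots> = curve_integral (a, b, \<gamma>) (\<lambda>x. ennreal ?k * g x + ennreal (1 / r))"
  proof -
    have "curve_integral (a, b, \<gamma>) (\<lambda>x. ennreal ?k * g x + ennreal (1 / r)) =
      curve_integral (a, b, \<gamma>) (\<lambda>x. ennreal ?k * g x) + curve_integral (a, b, \<gamma>) (\<lambda>x. ennreal (1 / r))"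
      by (rule curve_integral_add[OF c]) measurable
    then show ?thesis by (simp only: curve_integral_cmult[OF c g] curve_integral_const[OF c])
  qed
  finally show "ennreal \<bar>?w (\<gamma> a) - ?w (\<gamma> b)\<bar>
    \<le> curve_integral (a, b, \<gamma>) (\<lambda>x. ennreal ?k * g x + ennreal (1 / r))" .
qed

context doubling_poincare_space
begin

definition overlap :: nat where
  "overlap = nat \<lceil>Cd ^ ((LEAST m. 2 * \<Lambda> \<le> 2 ^ m) + 3)\<rceil>"

text \<open>
  The points \<open>s\<close> in question form a separated set in a ball of comparable radius around \<open>y\<close>.
\<close>

lemma overlap_bound:
  fixes S :: "'a set"
  assumes "separated r S" "0 < r"
  shows "card {s \<in> S. y \<in> ball s (2 * \<Lambda> * r)} \<le> overlap"
proof -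
  define m where "m = (LEAST m. 2 * \<Lambda> \<le> 2 ^ m)"
  obtain k where "2 * \<Lambda> < 2 ^ k" using real_arch_pow[of 2 "2 * \<Lambda>"] by auto
  then have m: "2 * \<Lambda> \<le> 2 ^ m" unfolding m_def using LeastI[of "\<lambda>m. 2 * \<Lambda> \<le> 2 ^ m" k] by simp
  have sub: "{s \<in> S. y \<in> ball s (2 * \<Lambda> * r)} \<subseteq> ball y (2 ^ m * r)"
  proof
    fix s assume "s \<in> {s \<in> S. y \<in> ball s (2 * \<Lambda> * r)}"
    then have "dist y s < 2 * \<Lambda> * r" by (simp add: dist_commute)
    also have "\<dots> \<le> 2 ^ m * r" using m assms(2) by (intro mult_right_mono) auto
    finally show "s \<in> ball y (2 ^ m * r)" by simp
  qed
  have "separated r {s \<in> S. y \<in> ball s (2 * \<Lambda> * r)}" using assms(1) by (simp add: separated_def)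
  from separated_card[OF this assms(2) sub]
  have "real (card {s \<in> S. y \<in> ball s (2 * \<Lambda> * r)}) \<le> Cd ^ (m + 3)" by simp
  then have "card {s \<in> S. y \<in> ball s (2 * \<Lambda> * r)} \<le> nat \<lceil>Cd ^ (m + 3)\<rceil>" by linarith
  then show ?thesis by (simp add: overlap_def m_def)
qed

definition level_const :: real where "level_const = real overlap * (3 * CP * 2)"

lemma level_const_nonneg: "0 \<le> level_const"
  using CP by (simp add: level_const_def)

text \<open>
  Near each point of \<open>Z\<close> the truncation between \<open>\<alpha>\<close> and \<open>\<beta>\<close> vanishes on half of the ball,
  so its integral, and with it the measure of \<open>{v \<ge> \<beta>}\<close>, is at most \<open>C r\<close> times the energy in the
  dilated ball. These estimates are summed over balls of the same radius around a maximal separated subset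
  of \<open>Z\<close>, whose dilates have bounded overlap.
\<close>

lemma level_estimate:
  assumes admissible: "admissible v g" and fin: "(\<integral>\<^sup>+ x. ennreal (v x) \<partial>M) < \<infinity>"
    and Z: "Z \<subseteq> ball ctr k"
    and low: "\<And>x \<rho>. x \<in> Z \<Longrightarrow> 0 < \<rho> \<Longrightarrow> \<rho> < \<tau> \<Longrightarrow>
        2 * emeasure M {y \<in> ball x \<rho>. \<alpha> < v y} \<le> emeasure M (ball x \<rho>)"
    and \<alpha>\<beta>: "0 < \<alpha>" "\<alpha> < \<beta>" and r: "0 < r" "2 * r < \<tau>" and \<delta>: "0 < \<delta>"
  shows "emeasure M {y \<in> nbhd Z r. \<beta> \<le> v y} \<le> ennreal (level_const * r / (\<beta> - \<alpha>)) *
     ((\<integral>\<^sup>+ x\<in>nbhd Z (2 * \<Lambda> * r). g x * indicator {x. \<alpha> < v x} x \<partial>M) + ennreal \<delta> * (\<integral>\<^sup>+ x. g x \<partial>M))"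
proof -
  have [measurable]: "v \<in> borel_measurable M" "g \<in> borel_measurable M" by (rule admissibleD[OF admissible])+
  obtain S where S: "S \<subseteq> Z" "separated r S" "\<And>x. x \<in> Z \<Longrightarrow> \<exists>s\<in>S. dist s x < r"
    by (rule maximal_separated_set[OF r(1), of Z]) (rule that; blast)
  \<comment> \<open>\<open>Z\<close> is bounded, and bounded separated sets are finite.\<close>
  have finS: "finite S"
  proof -
    obtain m where "k / r < 2 ^ m" using real_arch_pow[of 2 "k / r"] by auto
    then have "k \<le> 2 ^ m * r" using r by (simp add: field_simps)
    then have "ball ctr k \<subseteq> ball ctr (2 ^ m * r)" by (rule subset_ball)
    then have "S \<subseteq> ball ctr (2 ^ m * r)" using S(1) Z by blast
    then show ?thesis using separated_card[OF S(2) r(1)] by blast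
  qed
  obtain g' where g': "admissible (\<lambda>x. ramp \<alpha> \<beta> (v x)) g'"
    "\<forall>A\<in>sets M. (\<integral>\<^sup>+ x\<in>A. g' x \<partial>M) \<le> ennreal (1 / (\<beta> - \<alpha>)) *
       ((\<integral>\<^sup>+ x\<in>A. g x * indicator {x. \<alpha> < v x \<and> v x < \<beta>} x \<partial>M) + ennreal \<delta> * (\<integral>\<^sup>+ x\<in>A. g x \<partial>M))"
    using admissible_ramp[OF admissible fin \<alpha>\<beta> \<delta>] .
  have [measurable]: "g' \<in> borel_measurable M" by (rule admissibleD[OF g'(1)])
  have one: "emeasure M {y \<in> ball s (2 * r). \<beta> \<le> v y}
      \<le> ennreal (3 * CP * (2 * r)) * (\<integral>\<^sup>+ y\<in>ball s (2 * \<Lambda> * r). g' y \<partial>M)" if s: "s \<in> S" for s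
  proof -
    let ?B = "ball s (2 * r)"
    have "emeasure M {y \<in> ?B. \<beta> \<le> v y} \<le> (\<integral>\<^sup>+ y\<in>?B. ennreal (ramp \<alpha> \<beta> (v y)) \<partial>M)"
    proof -
      have "emeasure M {y \<in> ?B. \<beta> \<le> v y} = (\<integral>\<^sup>+ y. indicator {y \<in> ?B. \<beta> \<le> v y} y \<partial>M)"
        by (rule nn_integral_indicator[symmetric]) (rule sets_level; simp)
      also have "\<dots> \<le> (\<integral>\<^sup>+ y\<in>?B. ennreal (ramp \<alpha> \<beta> (v y)) \<partial>M)"
        using ramp_simps(4)[OF \<alpha>\<beta>(2)] by (intro nn_integral_mono) (auto simp: indicator_def)
      finally show ?thesis .
    qed
    also have "\<dots> \<le> ennreal ((1 + 1 / (1/2)) * CP * (2 * r)) * (\<integral>\<^sup>+ y\<in>ball s (\<Lambda> * (2 * r)). g' y \<partial>M)"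
    proof (rule integral_le_of_zero_portion[OF g'(1)])
      have "2 * emeasure M {y \<in> ?B. \<alpha> < v y} \<le> emeasure M ?B" using s S(1) r by (intro low) auto
      moreover have "emeasure M {y \<in> ?B. \<alpha> < v y} + emeasure M {y \<in> ?B. v y \<le> \<alpha>} = emeasure M ?B"
      proof -
        have S: "{y \<in> ?B. \<alpha> < v y} \<in> sets M" "{y \<in> ?B. v y \<le> \<alpha>} \<in> sets M" by (rule sets_level; simp)+
        have "{y \<in> ?B. \<alpha> < v y} \<union> {y \<in> ?B. v y \<le> \<alpha>} = ?B" by auto
        moreover have "{y \<in> ?B. \<alpha> < v y} \<inter> {y \<in> ?B. v y \<le> \<alpha>} = {}" by auto
        ultimately show ?thesis using plus_emeasure[OF S] by (simp only:)
      qed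
      moreover have eB: "emeasure M ?B = ennreal (V s (2 * r))" using r by (simp add: emeasure_ball)
      ultimately have "ennreal (V s (2 * r)) \<le> 2 * emeasure M {y \<in> ?B. v y \<le> \<alpha>}"
      proof -
        define e where "e = measure M {y \<in> ?B. \<alpha> < v y}"
        define e' where "e' = measure M {y \<in> ?B. v y \<le> \<alpha>}"
        have lt: "emeasure M {y \<in> ?B. P y} < \<infinity>" for P
        proof -
          have "emeasure M {y \<in> ?B. P y} \<le> emeasure M ?B" by (intro emeasure_mono) auto
          then show ?thesis unfolding eB by (rule le_less_trans) simp
        qed
        have e: "emeasure M {y \<in> ?B. \<alpha> < v y} = ennreal e" "emeasure M {y \<in> ?B. v y \<le> \<alpha>} = ennreal e'"
          unfolding e_def e'_def using lt[of "\<lambda>y. \<alpha> < v y"] lt[of "\<lambda>y. v y \<le> \<alpha>"]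
          by (simp_all add: emeasure_eq_ennreal_measure)
        have nn: "0 \<le> e" "0 \<le> e'" by (simp_all add: e_def e'_def)
        assume "2 * emeasure M {y \<in> ?B. \<alpha> < v y} \<le> emeasure M ?B"
          "emeasure M {y \<in> ?B. \<alpha> < v y} + emeasure M {y \<in> ?B. v y \<le> \<alpha>} = emeasure M ?B"
        then have a: "ennreal (2 * e) \<le> ennreal (V s (2 * r))" and b: "ennreal (e + e') = ennreal (V s (2 * r))"
          unfolding e eB using nn by (simp_all add: ennreal_mult)
        have "2 * e \<le> V s (2 * r)" using a V_nonneg by (simp add: ennreal_le_iff)
        moreover have "e + e' = V s (2 * r)" using b V_nonneg nn
          by (metis add_nonneg_nonneg ennreal_inj)
        ultimately have "V s (2 * r) \<le> 2 * e'" by linarith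
        then have "ennreal (V s (2 * r)) \<le> ennreal (2 * e')" by (rule ennreal_leI)
        then show ?thesis unfolding e using nn by (simp add: ennreal_mult)
      qed
      then have "ennreal (1/2) * ennreal (V s (2 * r)) \<le> ennreal (1/2) * (2 * emeasure M {y \<in> ?B. v y \<le> \<alpha>})"
        by (rule mult_left_mono) simp
      also have "\<dots> = emeasure M {y \<in> ?B. v y \<le> \<alpha>}"
      proof -
        have "ennreal (1/2) * ennreal 2 = ennreal (1/2 * 2)" by (rule ennreal_mult[symmetric]) simp_all
        moreover have "1/2 * 2 = (1::real)" by simp
        ultimately have "ennreal (1/2) * 2 = 1" unfolding ennreal_numeral ennreal_1 by (metis ennreal_1)
        then show ?thesis unfolding mult.assoc[symmetric] by (simp only: mult_1)
      qed
      also have "\<dots> \<le> emeasure M {y \<in> ?B. ramp \<alpha> \<beta> (v y) = 0}"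
        using ramp_simps(3)[OF \<alpha>\<beta>(2)] admissibleD(1)[OF g'(1)] by (intro emeasure_mono sets_level) auto
      finally have half: "ennreal (1/2) * ennreal (V s (2 * r)) \<le> emeasure M {y \<in> ?B. ramp \<alpha> \<beta> (v y) = 0}" .
      have "ennreal (1/2 * V s (2 * r)) = ennreal (1/2) * ennreal (V s (2 * r))"
        by (rule ennreal_mult) (simp_all add: V_nonneg)
      then show "ennreal (1/2 * V s (2 * r)) \<le> emeasure M {y \<in> ?B. ramp \<alpha> \<beta> (v y) = 0}"
        using half by (simp only:)
    qed (use r in auto)
    finally show ?thesis by (simp add: mult_ac)
  qed
  have "{y \<in> nbhd Z r. \<beta> \<le> v y} \<subseteq> (\<Union>s\<in>S. {y \<in> ball s (2 * r). \<beta> \<le> v y})"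
  proof
    fix y assume y: "y \<in> {y \<in> nbhd Z r. \<beta> \<le> v y}"
    then obtain z where z: "z \<in> Z" "dist z y < r" by (auto simp: nbhd_def)
    obtain s where s: "s \<in> S" "dist s z < r" using S(3)[OF z(1)] by blast
    have "dist s y < 2 * r" using z s dist_triangle[of s y z] by linarith
    then show "y \<in> (\<Union>s\<in>S. {y \<in> ball s (2 * r). \<beta> \<le> v y})" using s y by auto
  qed
  then have "emeasure M {y \<in> nbhd Z r. \<beta> \<le> v y} \<le> emeasure M (\<Union>s\<in>S. {y \<in> ball s (2 * r). \<beta> \<le> v y})"
    using finS by (intro emeasure_mono sets.finite_UN sets_level) auto
  also have "\<dots> \<le> (\<Sum>s\<in>S. emeasure M {y \<in> ball s (2 * r). \<beta> \<le> v y})"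
    by (intro emeasure_subadditive_finite finS image_subsetI sets_level) simp_all
  also have "\<dots> \<le> (\<Sum>s\<in>S. ennreal (3 * CP * (2 * r)) * (\<integral>\<^sup>+ y\<in>ball s (2 * \<Lambda> * r). g' y \<partial>M))"
    by (intro sum_mono one)
  also have "\<dots> = ennreal (3 * CP * (2 * r)) * (\<Sum>s\<in>S. \<integral>\<^sup>+ y\<in>ball s (2 * \<Lambda> * r). g' y \<partial>M)"
    by (simp add: sum_distrib_left)
  also have "\<dots> \<le> ennreal (3 * CP * (2 * r)) * (of_nat overlap * (\<integral>\<^sup>+ y\<in>nbhd Z (2 * \<Lambda> * r). g' y \<partial>M))"
  proof (intro mult_left_mono sum_integrals_overlap finS overlap_bound[OF S(2) r(1)])
    show "ball s (2 * \<Lambda> * r) \<subseteq> nbhd Z (2 * \<Lambda> * r)" if "s \<in> S" for s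
      using that S(1) by (auto simp: nbhd_def)
  qed auto
  also have "\<dots> \<le> ennreal (3 * CP * (2 * r)) * (of_nat overlap * (ennreal (1 / (\<beta> - \<alpha>)) *
     ((\<integral>\<^sup>+ x\<in>nbhd Z (2 * \<Lambda> * r). g x * indicator {x. \<alpha> < v x} x \<partial>M) + ennreal \<delta> * (\<integral>\<^sup>+ x. g x \<partial>M))))"
  proof (intro mult_left_mono)
    have "(\<integral>\<^sup>+ x\<in>nbhd Z (2 * \<Lambda> * r). g' x \<partial>M) \<le> ennreal (1 / (\<beta> - \<alpha>)) *
       ((\<integral>\<^sup>+ x\<in>nbhd Z (2 * \<Lambda> * r). g x * indicator {x. \<alpha> < v x \<and> v x < \<beta>} x \<partial>M) +
        ennreal \<delta> * (\<integral>\<^sup>+ x\<in>nbhd Z (2 * \<Lambda> * r). g x \<partial>M))" by (rule bspec[OF g'(2)]) simp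
    also have "\<dots> \<le> ennreal (1 / (\<beta> - \<alpha>)) *
     ((\<integral>\<^sup>+ x\<in>nbhd Z (2 * \<Lambda> * r). g x * indicator {x. \<alpha> < v x} x \<partial>M) + ennreal \<delta> * (\<integral>\<^sup>+ x. g x \<partial>M))"
      by (intro mult_left_mono add_mono nn_integral_mono) (auto simp: indicator_def)
    finally show "(\<integral>\<^sup>+ x\<in>nbhd Z (2 * \<Lambda> * r). g' x \<partial>M) \<le> \<dots>" .
  qed auto
  also have "\<dots> = ennreal (level_const * r / (\<beta> - \<alpha>)) *
     ((\<integral>\<^sup>+ x\<in>nbhd Z (2 * \<Lambda> * r). g x * indicator {x. \<alpha> < v x} x \<partial>M) + ennreal \<delta> * (\<integral>\<^sup>+ x. g x \<partial>M))"
  proof -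
    have "level_const * r / (\<beta> - \<alpha>) = 3 * CP * (2 * r) * (real overlap * (1 / (\<beta> - \<alpha>)))"
      by (simp add: level_const_def)
    then have "ennreal (level_const * r / (\<beta> - \<alpha>)) =
        ennreal (3 * CP * (2 * r)) * (of_nat overlap * ennreal (1 / (\<beta> - \<alpha>)))"
      using CP r \<alpha>\<beta> by (simp only: ennreal_of_nat_eq_real_of_nat) (simp add: ennreal_mult[symmetric])
    then show ?thesis by (simp add: mult.assoc)
  qed
  finally show ?thesis .
qed

text \<open>
  The competitor is the minimum of a truncation of \<open>v\<close> and a cutoff function of slope \<open>1 / r\<close>
  around \<open>Z\<close>. It lives on the part of \<open>{v > \<alpha>}\<close> within distance \<open>r\<close> of \<open>Z\<close>, and so, again by
  truncation, does its upper gradient.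
\<close>

lemma cap_level_cutoff:
  assumes admissible: "admissible v g" and \<alpha>\<beta>: "\<alpha> < \<beta>" and r: "0 < r" and \<delta>: "0 < \<delta>" and K: "0 \<le> K"
    and Z: "Z \<noteq> {}" "\<And>x. x \<in> Z \<Longrightarrow> \<beta> \<le> v x"
    and fin: "emeasure M {x \<in> nbhd Z r. \<alpha> < v x} < \<infinity>"
  shows "cap K Z \<le> ennreal (1 / (\<beta> - \<alpha>)) * (\<integral>\<^sup>+ x\<in>nbhd Z r. g x * indicator {x. \<alpha> < v x} x \<partial>M)
     + ennreal (1 / r + K) * emeasure M {x \<in> nbhd Z r. \<alpha> < v x} + ennreal \<delta> * (\<integral>\<^sup>+ x. g x \<partial>M)"
proof -
  have [measurable]: "v \<in> borel_measurable M" "g \<in> borel_measurable M" "g \<in> borel_measurable borel" by (rule admissibleD[OF admissible])+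
  define S where "S = {x \<in> nbhd Z r. \<alpha> < v x}"
  have S [measurable]: "S \<in> sets M" unfolding S_def by (rule sets_level) simp_all
  obtain W where W: "W \<in> sets borel" "S \<subseteq> W" "AE x in M. x \<in> W \<longrightarrow> x \<in> S"
    using borel_hull[OF S] fin unfolding S_def by blast
  have [measurable]: "W \<in> sets M" "W \<in> sets borel" using W(1) borel_sets_M by auto
  define w where "w x = min (ramp \<alpha> \<beta> (v x)) (cutoff Z r x)" for x
  define h where "h x = ennreal (1 / (\<beta> - \<alpha>)) * g x + ennreal (1 / r)" for x
  have w01: "0 \<le> w x" "w x \<le> 1" for x
    using ramp_simps(1,2)[OF \<alpha>\<beta>, of "v x"] cutoff_bounds[OF r, of Z x] by (auto simp: w_def)
  have wS: "x \<in> S" if "0 < w x" for x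
  proof -
    have "x \<in> nbhd Z r" using that cutoff_support[OF _ Z(1) r] by (simp add: w_def)
    moreover have "\<alpha> < v x" using that ramp_simps(3)[OF \<alpha>\<beta>, of "v x"] by (cases "v x \<le> \<alpha>") (auto simp: w_def)
    ultimately show ?thesis by (simp add: S_def)
  qed
  have "upper_gradient_real w h"
    unfolding w_def h_def by (rule upper_gradient_min_cutoff[OF admissibleD(4)[OF admissible] \<alpha>\<beta> r])
  then have "upper_gradient_real (\<lambda>x. max 0 (min 1 (w x))) (\<lambda>x. max (h x * indicator W x) (ennreal \<delta> * g x))"
  proof (rule upper_gradient_truncation)
    show "{x. 0 < w x \<and> w x < 1} \<subseteq> W" using wS W(2) by blast
    show "(\<lambda>x. ennreal \<delta> * g x) \<in> borel_measurable borel" by measurable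
    fix c :: "'a curve" assume c: "c \<in> curves" and inf: "curve_integral c h = \<infinity>"
    obtain a b \<gamma> where abc: "c = (a, b, \<gamma>)" by (metis surj_pair)
    have len: "curve_length a b \<gamma> < \<infinity>" using c by (simp add: abc curves_def)
    have "curve_integral c h = curve_integral c (\<lambda>x. ennreal (1 / (\<beta> - \<alpha>)) * g x) + curve_integral c (\<lambda>x. ennreal (1 / r))"
      unfolding h_def by (rule curve_integral_add[OF c]) measurable
    also have "\<dots> = ennreal (1 / (\<beta> - \<alpha>)) * curve_integral c g + ennreal (1 / r) * curve_length a b \<gamma>"
      using c by (simp add: curve_integral_cmult abc curve_integral_const)
    finally have "ennreal (1 / (\<beta> - \<alpha>)) * curve_integral c g + ennreal (1 / r) * curve_length a b \<gamma> = top"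
      using inf by simp
    moreover have "ennreal (1 / r) * curve_length a b \<gamma> < top" using len by (simp add: ennreal_mult_less_top)
    ultimately have "ennreal (1 / (\<beta> - \<alpha>)) * curve_integral c g = top" by (auto simp: ennreal_add_eq_top)
    then have "curve_integral c g = \<infinity>" by (simp add: ennreal_mult_eq_top_iff)
    then show "curve_integral c (\<lambda>x. ennreal \<delta> * g x) = \<infinity>"
      using c \<delta> by (simp add: curve_integral_cmult ennreal_mult_top)
  qed (use W in auto)
  then have "upper_gradient_real w (\<lambda>x. max (h x * indicator W x) (ennreal \<delta> * g x))"
    using w01 by (simp add: max_absorb2 min_absorb2)
  moreover have "w \<in> borel_measurable M"
  proof -
    have "cutoff Z r \<in> borel_measurable M"
      by (intro borel_measurable_M borel_measurable_continuous_onI continuous_cutoff)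
    then show ?thesis unfolding w_def ramp_def by measurable
  qed
  ultimately have "admissible w (\<lambda>x. max (h x * indicator W x) (ennreal \<delta> * g x))"
    using w01 by (simp add: admissible_def)
  then have "cap K Z \<le> energy K w (\<lambda>x. max (h x * indicator W x) (ennreal \<delta> * g x))"
    by (rule cap_le) (use Z(2) ramp_simps(4)[OF \<alpha>\<beta>] in \<open>auto simp: w_def cutoff_one\<close>)
  also have "\<dots> \<le> (ennreal (1 / (\<beta> - \<alpha>)) * (\<integral>\<^sup>+ x. g x * indicator S x \<partial>M) + ennreal (1 / r) * emeasure M S + ennreal \<delta> * (\<integral>\<^sup>+ x. g x \<partial>M))
       + ennreal K * emeasure M S"
    unfolding energy_def
  proof (intro add_mono mult_left_mono)
    have "(\<integral>\<^sup>+ x. max (h x * indicator W x) (ennreal \<delta> * g x) \<partial>M)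
      \<le> (\<integral>\<^sup>+ x. ennreal (1 / (\<beta> - \<alpha>)) * (g x * indicator S x) + ennreal (1 / r) * indicator S x + ennreal \<delta> * g x \<partial>M)"
    proof (rule nn_integral_mono_AE)
      show "AE x in M. max (h x * indicator W x) (ennreal \<delta> * g x)
        \<le> ennreal (1 / (\<beta> - \<alpha>)) * (g x * indicator S x) + ennreal (1 / r) * indicator S x + ennreal \<delta> * g x"
        using W(3)
      proof eventually_elim
        case (elim x)
        have "h x * indicator W x \<le> ennreal (1 / (\<beta> - \<alpha>)) * (g x * indicator S x) + ennreal (1 / r) * indicator S x"
          using elim by (cases "x \<in> W") (simp_all add: h_def)
        then show ?case
          by (intro max.boundedI) (auto intro: order_trans add_increasing2 add_increasing)
      qed
    qed
    also have "\<dots> = ennreal (1 / (\<beta> - \<alpha>)) * (\<integral>\<^sup>+ x. g x * indicator S x \<partial>M) + ennreal (1 / r) * emeasure M S + ennreal \<delta> * (\<integral>\<^sup>+ x. g x \<partial>M)"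
      by (simp add: nn_integral_add nn_integral_cmult nn_integral_cmult_indicator)
    finally show "(\<integral>\<^sup>+ x. max (h x * indicator W x) (ennreal \<delta> * g x) \<partial>M) \<le> \<dots>" .
    have "(\<integral>\<^sup>+ x. ennreal (w x) \<partial>M) \<le> (\<integral>\<^sup>+ x. indicator S x \<partial>M)"
    proof (rule nn_integral_mono)
      fix x
      show "ennreal (w x) \<le> indicator S x"
        using w01[of x] wS[of x] by (cases "0 < w x") (auto simp: ennreal_le_1 ennreal_neg not_less)
    qed
    then show "(\<integral>\<^sup>+ x. ennreal (w x) \<partial>M) \<le> emeasure M S" using S by simp
  qed simp
  also have "(\<integral>\<^sup>+ x. g x * indicator S x \<partial>M) = (\<integral>\<^sup>+ x\<in>nbhd Z r. g x * indicator {x. \<alpha> < v x} x \<partial>M)"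
    by (intro nn_integral_cong) (auto simp: S_def indicator_def)
  also have "(ennreal (1 / (\<beta> - \<alpha>)) * (\<integral>\<^sup>+ x\<in>nbhd Z r. g x * indicator {x. \<alpha> < v x} x \<partial>M) + ennreal (1 / r) * emeasure M S
      + ennreal \<delta> * (\<integral>\<^sup>+ x. g x \<partial>M)) + ennreal K * emeasure M S
      \<le> (ennreal (1 / (\<beta> - \<alpha>)) * (\<integral>\<^sup>+ x\<in>nbhd Z r. g x * indicator {x. \<alpha> < v x} x \<partial>M)
        + ennreal (1 / r + K) * emeasure M S + ennreal \<delta> * (\<integral>\<^sup>+ x. g x \<partial>M))"
  proof -
    have "ennreal (1 / r + K) = ennreal (1 / r) + ennreal K" using r K by (intro ennreal_plus) simp_all
    then show ?thesis by (simp only: distrib_right add_ac order_refl)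
  qed
  finally show ?thesis unfolding S_def .
qed

text \<open>
  The neighbourhoods \<open>nbhd Z r\<close> decrease to the closure of \<open>Z\<close> as \<open>r\<close> tends to 0.
\<close>

lemma integral_nbhd_tendsto:
  assumes [measurable]: "h \<in> borel_measurable M" and fin: "(\<integral>\<^sup>+ x. h x \<partial>M) < \<infinity>"
    and null: "(\<integral>\<^sup>+ x\<in>closure Z. h x \<partial>M) = 0" and e: "0 < e" and c: "0 < c"
  obtains r0 where "0 < r0" "\<And>r. 0 < r \<Longrightarrow> r < r0 \<Longrightarrow> (\<integral>\<^sup>+ x\<in>nbhd Z (c * r). h x \<partial>M) < ennreal e"
proof -
  define r where "r n = c / real (Suc n)" for n
  define \<nu> where "\<nu> = density M h"
  have em: "emeasure \<nu> A = (\<integral>\<^sup>+ x\<in>A. h x \<partial>M)" if "A \<in> sets M" for A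
    using that unfolding \<nu>_def by (simp add: emeasure_density)
  have rpos: "0 < r n" for n using c by (simp add: r_def)
  have "(\<lambda>n. c * (1 / real (Suc n))) \<longlonglongrightarrow> c * 0"
    by (intro tendsto_mult_left LIMSEQ_Suc lim_1_over_n)
  moreover have "(\<lambda>n. c * (1 / real (Suc n))) = r" by (simp add: r_def fun_eq_iff)
  ultimately have rlim: "r \<longlonglongrightarrow> 0" by (simp only: mult_zero_right)
  have dec: "decseq (\<lambda>n. nbhd Z (r n))"
    unfolding decseq_def r_def using c by (intro allI impI nbhd_mono divide_left_mono) auto
  have "(\<lambda>n. emeasure \<nu> (nbhd Z (r n))) \<longlonglongrightarrow> emeasure \<nu> (\<Inter>n. nbhd Z (r n))"
  proof (rule Lim_emeasure_decseq[OF _ dec])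
    show "range (\<lambda>n. nbhd Z (r n)) \<subseteq> sets \<nu>" unfolding \<nu>_def by auto
    show "emeasure \<nu> (nbhd Z (r n)) \<noteq> \<infinity>" for n
    proof -
      have "emeasure \<nu> (nbhd Z (r n)) \<le> (\<integral>\<^sup>+ x. h x \<partial>M)"
        by (subst em) (auto intro!: nn_integral_mono simp: indicator_def)
      then show ?thesis using fin by auto
    qed
  qed
  also have "(\<Inter>n. nbhd Z (r n)) = closure Z" by (rule Inter_nbhd[OF rpos rlim])
  also have "emeasure \<nu> (closure Z) = 0" using null by (simp add: em)
  finally have "eventually (\<lambda>n. emeasure \<nu> (nbhd Z (r n)) < ennreal e) sequentially"
    using e by (intro order_tendstoD(2)) auto
  then obtain n where n: "emeasure \<nu> (nbhd Z (r n)) < ennreal e"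
    using eventually_happens'[OF sequentially_bot] by blast
  show ?thesis
  proof (rule that)
    show "0 < 1 / real (Suc n)" by simp
    fix s :: real assume s: "0 < s" "s < 1 / real (Suc n)"
    then have "c * s \<le> r n" using c mult_left_mono[of s "1 / real (Suc n)" c] by (simp add: r_def)
    then have sub: "nbhd Z (c * s) \<subseteq> nbhd Z (r n)" by (rule nbhd_mono)
    have "(\<integral>\<^sup>+ x\<in>nbhd Z (c * s). h x \<partial>M) \<le> (\<integral>\<^sup>+ x\<in>nbhd Z (r n). h x \<partial>M)"
      using sub by (intro nn_integral_mono) (auto simp: indicator_def)
    also have "\<dots> < ennreal e" using n by (simp add: em)
    finally show "(\<integral>\<^sup>+ x\<in>nbhd Z (c * s). h x \<partial>M) < ennreal e" .
  qed
qed

text \<open>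
  The estimate \<open>level_estimate\<close> is used twice. Between the levels 1/2 and 3/4, with the total energy on
  the right-hand side, it shows that \<open>v < 3/4\<close> almost everywhere on the closure of \<open>Z\<close>. Hence the
  energy above the level 3/4 in small neighbourhoods of \<open>Z\<close> tends to zero. Between 3/4 and 7/8 it
  then bounds the measure of \<open>{v > 7/8}\<close> within distance \<open>r\<close> of \<open>Z\<close> by \<open>r\<close> times a small
  number, which outweighs the slope \<open>1 / r\<close> of the cutoff function.
\<close>

lemma cap_low_density_bounded:
  assumes admissible: "admissible v g" and fin: "(\<integral>\<^sup>+ x. ennreal (v x) \<partial>M) < \<infinity>" "(\<integral>\<^sup>+ x. g x \<partial>M) < \<infinity>"
    and Z: "Z \<subseteq> ball ctr k" "\<And>x. x \<in> Z \<Longrightarrow> v x = 1"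
    and \<tau>: "0 < \<tau>"
    and low: "\<And>x \<rho>. x \<in> Z \<Longrightarrow> 0 < \<rho> \<Longrightarrow> \<rho> < \<tau> \<Longrightarrow>
        2 * emeasure M {y \<in> ball x \<rho>. 1/2 < v y} \<le> emeasure M (ball x \<rho>)"
    and K: "0 \<le> K"
  shows "cap K Z = 0"
proof (cases "Z = {}")
  case False
  have [measurable]: "v \<in> borel_measurable M" "g \<in> borel_measurable M" by (rule admissibleD[OF admissible])+
  obtain G where G: "0 \<le> G" "(\<integral>\<^sup>+ x. g x \<partial>M) = ennreal G"
    using fin(2) by (metis ennreal_cases infinity_ennreal_def less_irrefl)
  have "emeasure M {y \<in> closure Z. 3/4 \<le> v y} = 0"
  proof (rule ennreal_zero_if_small)
    show "0 < \<tau> / 2" using \<tau> by simp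
    fix r :: real assume r: "0 < r" "r < \<tau> / 2"
    have "emeasure M {y \<in> closure Z. 3/4 \<le> v y} \<le> emeasure M {y \<in> nbhd Z r. 3/4 \<le> v y}"
      using closure_subset_nbhd[OF r(1), of Z] by (intro emeasure_mono sets_level) auto
    also have "\<dots> \<le> ennreal (level_const * r / (3/4 - 1/2)) *
     ((\<integral>\<^sup>+ x\<in>nbhd Z (2 * \<Lambda> * r). g x * indicator {x. 1/2 < v x} x \<partial>M) + ennreal 1 * (\<integral>\<^sup>+ x. g x \<partial>M))"
      by (rule level_estimate[OF admissible fin(1) Z(1) low]) (use r in auto)
    also have "\<dots> \<le> ennreal (level_const * r / (3/4 - 1/2)) * (ennreal G + ennreal 1 * ennreal G)"
      unfolding G(2)[symmetric]
      by (intro mult_left_mono add_mono nn_integral_mono) (auto simp: indicator_def)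
    also have "\<dots> = ennreal (level_const * r / (3/4 - 1/2)) * ennreal (2 * G)"
      using G(1) by (simp flip: ennreal_plus)
    also have "\<dots> = ennreal (level_const * r / (3/4 - 1/2) * (2 * G))"
      using G(1) r level_const_nonneg by (intro ennreal_mult[symmetric]) auto
    also have "level_const * r / (3/4 - 1/2) * (2 * G) = (8 * level_const * G) * r" by simp
    finally show "emeasure M {y \<in> closure Z. 3/4 \<le> v y} \<le> ennreal ((8 * level_const * G) * r)" .
  qed
  then have "AE x in M. x \<notin> {y \<in> closure Z. 3/4 \<le> v y}"
    by (intro AE_not_in null_setsI sets_level) simp_all
  define h where "h x = g x * indicator {x. 3/4 < v x} x" for x
  have hm [measurable]: "h \<in> borel_measurable M"
  proof -
    have "{x. 3/4 < v x} \<in> sets M" using sets_level(1)[of v UNIV "3/4"] sets.top[of M] by simp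
    then show ?thesis unfolding h_def by measurable
  qed
  have hfin: "(\<integral>\<^sup>+ x. h x \<partial>M) < \<infinity>"
    by (rule le_less_trans[OF nn_integral_mono fin(2)]) (auto simp: h_def indicator_def)
  have "(\<integral>\<^sup>+ x\<in>closure Z. h x \<partial>M) = (\<integral>\<^sup>+ x. 0 \<partial>M)"
  proof (rule nn_integral_cong_AE)
    show "AE x in M. h x * indicator (closure Z) x = 0"
      using \<open>AE x in M. x \<notin> {y \<in> closure Z. 3/4 \<le> v y}\<close>
      by eventually_elim (auto simp: h_def indicator_def)
  qed
  then have hnull: "(\<integral>\<^sup>+ x\<in>closure Z. h x \<partial>M) = 0" by simp
  define c where "c = 8 + (1 + K) * (8 * level_const * 2) + 1"
  show ?thesis
  proof (rule ennreal_zero_if_small)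
    show "(0::real) < 1" by simp
    fix e :: real assume e: "0 < e" "e < 1"
    obtain r0 where r0: "0 < r0" "\<And>r. 0 < r \<Longrightarrow> r < r0 \<Longrightarrow> (\<integral>\<^sup>+ x\<in>nbhd Z (2 * \<Lambda> * r). h x \<partial>M) < ennreal e"
      by (rule integral_nbhd_tendsto[OF hm hfin hnull e(1), of "2 * \<Lambda>"]) (use \<Lambda> that in auto)
    define r where "r = min (min (r0 / 2) (\<tau> / 4)) (1/2)"
    have r: "0 < r" "r < r0" "2 * r < \<tau>" "r < 1" using r0(1) \<tau> by (auto simp: r_def)
    define \<delta> where "\<delta> = e / (G + 1)"
    have \<delta>: "0 < \<delta>" "\<delta> * G \<le> e" using e G(1) by (auto simp: \<delta>_def field_simps)
    define I where "I = (\<integral>\<^sup>+ x\<in>nbhd Z (2 * \<Lambda> * r). h x \<partial>M)"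
    have I: "I \<le> ennreal e" using r0(2)[OF r(1,2)] by (simp add: I_def)
    have dG: "ennreal \<delta> * (\<integral>\<^sup>+ x. g x \<partial>M) \<le> ennreal e"
      unfolding G(2) using \<delta> G(1) by (simp add: ennreal_mult[symmetric] ennreal_leI)
    define E where "E = emeasure M {y \<in> nbhd Z r. 7/8 < v y}"
    have "E \<le> emeasure M {y \<in> nbhd Z r. 7/8 \<le> v y}"
      unfolding E_def by (intro emeasure_mono sets_level) auto
    also have "\<dots> \<le> ennreal (level_const * r / (7/8 - 3/4)) *
     ((\<integral>\<^sup>+ x\<in>nbhd Z (2 * \<Lambda> * r). g x * indicator {x. 3/4 < v x} x \<partial>M) + ennreal \<delta> * (\<integral>\<^sup>+ x. g x \<partial>M))"
    proof (rule level_estimate[OF admissible fin(1) Z(1), where \<tau> = \<tau>])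
      fix x \<rho> assume x: "x \<in> Z" "0 < \<rho>" "\<rho> < \<tau>"
      have "emeasure M {y \<in> ball x \<rho>. 3/4 < v y} \<le> emeasure M {y \<in> ball x \<rho>. 1/2 < v y}"
        by (intro emeasure_mono sets_level) auto
      then have "2 * emeasure M {y \<in> ball x \<rho>. 3/4 < v y} \<le> 2 * emeasure M {y \<in> ball x \<rho>. 1/2 < v y}"
        by (rule mult_left_mono) simp
      then show "2 * emeasure M {y \<in> ball x \<rho>. 3/4 < v y} \<le> emeasure M (ball x \<rho>)"
        using low[OF x] by (rule order_trans)
    qed (use r \<delta> in auto)
    also have "\<dots> \<le> ennreal (level_const * r / (7/8 - 3/4)) * (ennreal e + ennreal e)"
      using I dG unfolding I_def h_def by (intro mult_left_mono add_mono) simp_all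
    also have "\<dots> = ennreal (level_const * r / (7/8 - 3/4)) * ennreal (e + e)"
      using e by (simp flip: ennreal_plus)
    also have "\<dots> = ennreal (level_const * r / (7/8 - 3/4) * (e + e))"
      using e r level_const_nonneg by (intro ennreal_mult[symmetric]) auto
    also have "level_const * r / (7/8 - 3/4) * (e + e) = 8 * level_const * 2 * e * r" by simp
    finally have E: "E \<le> ennreal (8 * level_const * 2 * e * r)" .
    have "cap K Z \<le> ennreal (1 / (1 - 7/8)) * (\<integral>\<^sup>+ x\<in>nbhd Z r. g x * indicator {x. 7/8 < v x} x \<partial>M)
     + ennreal (1 / r + K) * emeasure M {x \<in> nbhd Z r. 7/8 < v x} + ennreal \<delta> * (\<integral>\<^sup>+ x. g x \<partial>M)"
    proof (rule cap_level_cutoff[OF admissible _ r(1) \<delta>(1) K False])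
      show "emeasure M {x \<in> nbhd Z r. 7/8 < v x} < \<infinity>"
        using E unfolding E_def by (rule le_less_trans) simp
    qed (use Z(2) in auto)
    also have "\<dots> \<le> ennreal (1 / (1 - 7/8)) * ennreal e + ennreal (1 / r + K) * ennreal (8 * level_const * 2 * e * r) + ennreal e"
    proof (intro add_mono mult_left_mono dG)
      have "nbhd Z r \<subseteq> nbhd Z (2 * \<Lambda> * r)"
        using r \<Lambda> by (intro nbhd_mono) simp
      then have "(\<integral>\<^sup>+ x\<in>nbhd Z r. g x * indicator {x. 7/8 < v x} x \<partial>M) \<le> I"
        unfolding I_def h_def by (intro nn_integral_mono) (auto simp: indicator_def)
      then show "(\<integral>\<^sup>+ x\<in>nbhd Z r. g x * indicator {x. 7/8 < v x} x \<partial>M) \<le> ennreal e" using I by simp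
      show "emeasure M {x \<in> nbhd Z r. 7/8 < v x} \<le> ennreal (8 * level_const * 2 * e * r)" using E by (simp add: E_def)
    qed simp_all
    also have "\<dots> = ennreal (8 * e + (1 / r + K) * (8 * level_const * 2 * e * r) + e)"
    proof -
      have nn: "0 \<le> 8 * level_const * 2 * e * r" "0 \<le> 1 / r + K" using e r K level_const_nonneg by simp_all
      have eight: "1 / (1 - 7/8) = (8::real)" by simp
      have "ennreal 8 * ennreal e = ennreal (8 * e)" using e by (intro ennreal_mult[symmetric]) auto
      moreover have "ennreal (1 / r + K) * ennreal (8 * level_const * 2 * e * r) = ennreal ((1 / r + K) * (8 * level_const * 2 * e * r))"
        using nn by (intro ennreal_mult[symmetric])
      moreover have "ennreal (8 * e) + ennreal ((1 / r + K) * (8 * level_const * 2 * e * r)) + ennreal e =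
        ennreal (8 * e + (1 / r + K) * (8 * level_const * 2 * e * r) + e)"
        using nn e by (simp only: ennreal_plus[symmetric] mult_nonneg_nonneg add_nonneg_nonneg less_imp_le zero_le_numeral)
      ultimately show ?thesis unfolding eight by (simp only:)
    qed
    also have "\<dots> \<le> ennreal (c * e)"
    proof (rule ennreal_leI)
      have "(1 / r + K) * r \<le> 1 + K" using r K by (simp add: distrib_right mult_left_le)
      then have "(1 / r + K) * r * (8 * level_const * 2 * e) \<le> (1 + K) * (8 * level_const * 2 * e)"
        using e level_const_nonneg by (intro mult_right_mono) auto
      moreover have "(1 / r + K) * (8 * level_const * 2 * e * r) = (1 / r + K) * r * (8 * level_const * 2 * e)"
        by (simp only: mult_ac)
      moreover have "c * e = 8 * e + (1 + K) * (8 * level_const * 2 * e) + e"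
        by (simp add: c_def algebra_simps)
      ultimately show "8 * e + (1 / r + K) * (8 * level_const * 2 * e * r) + e \<le> c * e" by linarith
    qed
    finally show "cap K Z \<le> ennreal (c * e)" .
  qed
qed simp

text \<open>
  A limit of averages of \<open>v\<close> at such a point cannot be equal to \<open>v x\<close>; the set plays the role of the
  non-Lebesgue points.
\<close>

definition low_density_points :: "('a \<Rightarrow> real) \<Rightarrow> 'a set" where
  "low_density_points v = {x. v x = 1 \<and> (\<exists>\<tau>>0. \<forall>\<rho>. 0 < \<rho> \<and> \<rho> < \<tau> \<longrightarrow>
     2 * emeasure M {y \<in> ball x \<rho>. 1/2 < v y} \<le> emeasure M (ball x \<rho>))}"

text \<open>
  The set is exhausted by countably many bounded sets on which the radius \<open>\<tau>\<close> is uniform.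
\<close>

lemma cap_low_density_points:
  assumes admissible: "admissible v g" and fin: "(\<integral>\<^sup>+ x. ennreal (v x) \<partial>M) < \<infinity>" "(\<integral>\<^sup>+ x. g x \<partial>M) < \<infinity>"
    and K: "0 \<le> K"
  shows "cap K (low_density_points v) = 0"
proof -
  obtain ctr :: 'a where True by simp
  define Z where "Z = (\<lambda>(n::nat, m::nat). {x \<in> ball ctr (real m). v x = 1 \<and> (\<forall>\<rho>. 0 < \<rho> \<and> \<rho> < 1 / real (Suc n) \<longrightarrow>
     2 * emeasure M {y \<in> ball x \<rho>. 1/2 < v y} \<le> emeasure M (ball x \<rho>))})"
  have "cap K (\<Union>p\<in>UNIV. Z p) = 0"
  proof (rule cap_countable_null)
    fix p :: "nat \<times> nat"
    obtain n m where p: "p = (n, m)" by (metis surj_pair)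
    show "cap K (Z p) = 0"
      by (rule cap_low_density_bounded[OF admissible fin _ _ _ _ K, where ctr = ctr and k = "real m" and \<tau> = "1 / real (Suc n)"])
        (auto simp: Z_def p)
  qed simp
  moreover have "low_density_points v \<subseteq> (\<Union>p\<in>UNIV. Z p)"
  proof
    fix x assume "x \<in> low_density_points v"
    then obtain \<tau> where x: "v x = 1" "0 < \<tau>" "\<And>\<rho>. 0 < \<rho> \<Longrightarrow> \<rho> < \<tau> \<Longrightarrow>
       2 * emeasure M {y \<in> ball x \<rho>. 1/2 < v y} \<le> emeasure M (ball x \<rho>)"
      unfolding low_density_points_def by blast
    obtain n where n: "1 / real (Suc n) < \<tau>" using nat_approx_posE[OF x(2)] .
    obtain m :: nat where m: "dist ctr x < real m" using reals_Archimedean2 by blast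
    have "x \<in> Z (n, m)" unfolding Z_def using x m n by (auto intro: less_trans)
    then show "x \<in> (\<Union>p\<in>UNIV. Z p)" by blast
  qed
  ultimately have "cap K (low_density_points v) \<le> 0" using cap_mono[of "low_density_points v" "\<Union>p\<in>UNIV. Z p" K] by simp
  then show ?thesis by simp
qed


section \<open>The boxing inequality\<close>

text \<open>
  The two halves carry at most \<open>x\<close> together, so one of them carries at most \<open>x / 2\<close>.
\<close>

lemma halved_level_interval:
  fixes a b x :: real
  assumes fm [measurable]: "f \<in> borel_measurable M" and vm: "v \<in> borel_measurable M"
    and ab: "a < b" and x: "0 \<le> x"
    and le: "(\<integral>\<^sup>+ y. f y * indicator {y. a < v y \<and> v y \<le> b} y \<partial>M) \<le> ennreal x"
  shows "\<exists>a' b'. a \<le> a' \<and> b' \<le> b \<and> b' - a' = (b - a) / 2 \<and>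
    (\<integral>\<^sup>+ y. f y * indicator {y. a' < v y \<and> v y \<le> b'} y \<partial>M) \<le> ennreal (x / 2)"
proof -
  define c where "c = (a + b) / 2"
  define \<Phi> where "\<Phi> s t = (\<integral>\<^sup>+ y. f y * indicator {y. s < v y \<and> v y \<le> t} y \<partial>M)" for s t
  have S: "{y. s < v y \<and> v y \<le> t} \<in> sets M" for s t
  proof -
    have eq: "{y. s < v y \<and> v y \<le> t} = {y \<in> UNIV. s < v y} \<inter> {y \<in> UNIV. v y \<le> t}" by auto
    have U: "UNIV \<in> sets M" using sets.top[of M] by simp
    show ?thesis unfolding eq by (rule sets.Int[OF sets_level(1)[OF vm U] sets_level(4)[OF vm U]])
  qed
  have c: "a < c" "c < b" "c - a = (b - a) / 2" "b - c = (b - a) / 2" using ab by (auto simp: c_def field_simps)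
  have "\<Phi> a c + \<Phi> c b = (\<integral>\<^sup>+ y. f y * indicator {y. a < v y \<and> v y \<le> c} y + f y * indicator {y. c < v y \<and> v y \<le> b} y \<partial>M)"
    unfolding \<Phi>_def using S by (intro nn_integral_add[symmetric]) auto
  also have "\<dots> = \<Phi> a b"
    unfolding \<Phi>_def using c by (intro nn_integral_cong) (auto simp: indicator_def)
  finally have sum: "\<Phi> a c + \<Phi> c b \<le> ennreal x" using le by (simp add: \<Phi>_def)
  have "\<Phi> a c \<le> ennreal (x / 2) \<or> \<Phi> c b \<le> ennreal (x / 2)"
  proof (rule ccontr)
    assume "\<not> ?thesis"
    then have gt: "ennreal (x / 2) < \<Phi> a c" "ennreal (x / 2) < \<Phi> c b" by auto
    have "\<Phi> a c \<le> ennreal x" "\<Phi> c b \<le> ennreal x" using sum by (auto intro: order_trans[OF _ sum] add_increasing add_increasing2)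
    then obtain p q where p: "\<Phi> a c = ennreal p" "0 \<le> p" and q: "\<Phi> c b = ennreal q" "0 \<le> q"
      by (metis ennreal_cases ennreal_less_top leD)
    have "x / 2 < p" "x / 2 < q" using gt x p q by (simp_all add: ennreal_less_iff)
    moreover have "p + q \<le> x" using sum x p q by (simp add: ennreal_le_iff flip: ennreal_plus)
    ultimately show False by linarith
  qed
  then show ?thesis
  proof
    assume "\<Phi> a c \<le> ennreal (x / 2)"
    then show ?thesis using c unfolding \<Phi>_def by (intro exI[of _ a] exI[of _ c]) auto
  next
    assume "\<Phi> c b \<le> ennreal (x / 2)"
    then show ?thesis using c unfolding \<Phi>_def by (intro exI[of _ c] exI[of _ b]) auto
  qed
qed

text \<open>
  A substitute for the coarea formula: the masses of the strips decrease as fast as their widths. All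
  levels stay above 1/4, so that the superlevel sets have finite measure, and below 1/2, the level in the
  definition of the points of low density.
\<close>

lemma nested_level_intervals:
  assumes [measurable]: "f \<in> borel_measurable M" "v \<in> borel_measurable M"
    and m: "0 \<le> m" "(\<integral>\<^sup>+ y. f y \<partial>M) \<le> ennreal m"
  obtains a b :: "nat \<Rightarrow> real" where "\<forall>n. 1/4 \<le> a n" "\<forall>n. b n \<le> 1/2" "decseq b" "\<forall>n. b n - a n = 1/4 / 2 ^ n"
    "\<forall>n. (\<integral>\<^sup>+ y. f y * indicator {y. a n < v y \<and> v y \<le> b n} y \<partial>M) \<le> ennreal (m / 2 ^ n)"
proof -
  define P where "P n p \<longleftrightarrow> 1/4 \<le> fst p \<and> snd p \<le> 1/2 \<and> snd p - fst p = 1/4 / 2 ^ n \<and>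
     (\<integral>\<^sup>+ y. f y * indicator {y. fst p < v y \<and> v y \<le> snd p} y \<partial>M) \<le> ennreal (m / 2 ^ n)"
    for n :: nat and p :: "real \<times> real"
  have "\<exists>q. \<forall>n. P n (q n) \<and> snd (q (Suc n)) \<le> snd (q n)"
  proof (rule dependent_nat_choice)
    have "(\<integral>\<^sup>+ y. f y * indicator {y. 1/4 < v y \<and> v y \<le> 1/2} y \<partial>M) \<le> (\<integral>\<^sup>+ y. f y \<partial>M)"
      by (intro nn_integral_mono) (auto simp: indicator_def)
    then have "P 0 (1/4, 1/2)" using m(2) by (auto simp: P_def intro: order_trans)
    then show "\<exists>p. P 0 p" by blast
    fix p n assume p: "P n p"
    then have "fst p < snd p" by (simp add: P_def) (smt (verit) divide_pos_pos zero_less_power)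
    then obtain a' b' where "fst p \<le> a'" "b' \<le> snd p" "b' - a' = (snd p - fst p) / 2"
      "(\<integral>\<^sup>+ y. f y * indicator {y. a' < v y \<and> v y \<le> b'} y \<partial>M) \<le> ennreal (m / 2 ^ n / 2)"
      using halved_level_interval[of f v "fst p" "snd p" "m / 2 ^ n"] m(1) p by (auto simp: P_def)
    then show "\<exists>q. P (Suc n) q \<and> snd q \<le> snd p"
      using p by (intro exI[of _ "(a', b')"]) (auto simp: P_def mult.commute)
  qed
  then obtain q where q: "\<And>n. P n (q n)" "\<And>n. snd (q (Suc n)) \<le> snd (q n)" by blast
  show ?thesis
    by (rule that[of "\<lambda>n. fst (q n)" "\<lambda>n. snd (q n)"]) (use q in \<open>auto simp: P_def decseq_SucI\<close>)
qed

definition boxing_const :: real where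
  "boxing_const = Cd ^ (LEAST q. 5 * \<Lambda> \<le> 2 ^ q) * (9 * (8 + 4 * Cd * CP))"

lemma boxing_const_pos: "0 < boxing_const"
  using Cd CP by (auto simp: boxing_const_def intro!: mult_pos_pos add_pos_pos)

lemma dilated_volume_ratio:
  assumes "0 < r"
  shows "V x (5 * \<Lambda> * r) / (5 * \<Lambda> * r) \<le> Cd ^ (LEAST q. 5 * \<Lambda> \<le> 2 ^ q) * (V x r / r)"
proof -
  define q where "q = (LEAST q. 5 * \<Lambda> \<le> 2 ^ q)"
  obtain k where "5 * \<Lambda> < 2 ^ k" using real_arch_pow[of 2 "5 * \<Lambda>"] by auto
  then have q: "5 * \<Lambda> \<le> 2 ^ q" unfolding q_def using LeastI[of "\<lambda>q. 5 * \<Lambda> \<le> 2 ^ q" k] by simp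
  have V: "V x (5 * \<Lambda> * r) \<le> Cd ^ q * V x r"
  proof (rule V_compare)
    show "dist x x + 5 * \<Lambda> * r \<le> 2 ^ q * r" using q assms by simp
  qed (use assms \<Lambda> in auto)
  have "V x (5 * \<Lambda> * r) / (5 * \<Lambda> * r) \<le> V x (5 * \<Lambda> * r) / r"
    using assms \<Lambda> V_nonneg[of x "5 * \<Lambda> * r"] by (intro divide_left_mono mult_pos_pos) auto
  also have "\<dots> \<le> Cd ^ q * V x r / r" using V assms by (intro divide_right_mono) auto
  finally show ?thesis by (simp add: q_def)
qed

text \<open>
  The radius \<open>R\<close> is halved until the density of \<open>E\<close> reaches \<open>1 / (2 * Cd)\<close> for the first time. One
  step before, the density was below that, so by doubling it is still at most 1/2.
\<close>

lemma intermediate_density_radius: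
  assumes E: "E \<in> sets M" and R: "0 < R"
    and big: "2 * measure M (E \<inter> ball x R) \<le> V x R"
    and small: "0 < \<rho>" "\<rho> < R" "V x \<rho> < 2 * measure M (E \<inter> ball x \<rho>)"
  obtains r where "0 < r" "r \<le> R" "V x r \<le> 2 * Cd * measure M (E \<inter> ball x r)"
    "2 * measure M (E \<inter> ball x r) \<le> V x r"
proof -
  define rad where "rad k = R / 2 ^ k" for k :: nat
  define e where "e r = measure M (E \<inter> ball x r)" for r
  have radpos: "0 < rad k" for k using R by (simp add: rad_def)
  have emono: "e r \<le> e s" if "r \<le> s" "0 < s" for r s
  proof -
    have "ball x s \<in> fmeasurable M" using that emeasure_ball_finite[of s x] by (intro fmeasurableI) auto
    then have "E \<inter> ball x s \<in> fmeasurable M" using E by (metis Int_commute fmeasurable_Int_fmeasurable)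
    then show ?thesis unfolding e_def using E that by (intro measure_mono_fmeasurable) auto
  qed
  define Q where "Q k \<longleftrightarrow> V x (rad k) \<le> 2 * Cd * e (rad k)" for k
  have "\<exists>k. Q k"
  proof -
    \<comment> \<open>The dyadic radius next to \<open>\<rho>\<close>.\<close>
    obtain k where k: "rad (Suc k) < \<rho>" "\<rho> \<le> rad k"
    proof -
      obtain j where "R / \<rho> < 2 ^ j" using real_arch_pow[of 2 "R / \<rho>"] by auto
      then have j: "rad j < \<rho>" using small by (simp add: rad_def field_simps)
      define i where "i = (LEAST i. rad i < \<rho>)"
      have i: "rad i < \<rho>" unfolding i_def using LeastI[of "\<lambda>i. rad i < \<rho>" j] j by simp
      have "i \<noteq> 0"
      proof
        assume "i = 0"
        then show False using i small by (simp add: rad_def)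
      qed
      then obtain l where l: "i = Suc l" using not0_implies_Suc by blast
      have "\<not> rad l < \<rho>" using not_less_Least[of l "\<lambda>i. rad i < \<rho>"] l unfolding i_def by simp
      then show ?thesis using that[of l] i l by simp
    qed
    have "V x (rad k) = V x (2 * rad (Suc k))" by (simp add: rad_def)
    also have "\<dots> \<le> Cd * V x (rad (Suc k))" by (rule V_double[OF radpos])
    also have "\<dots> \<le> Cd * V x \<rho>" using k Cd radpos[of "Suc k"] small by (intro mult_left_mono V_mono subset_ball) auto
    also have "\<dots> \<le> Cd * (2 * e \<rho>)" using small Cd by (intro mult_left_mono) (auto simp: e_def)
    also have "\<dots> \<le> Cd * (2 * e (rad k))" using emono[OF k(2) radpos] Cd by (intro mult_left_mono) auto
    finally show ?thesis unfolding Q_def by (intro exI[of _ k]) (simp add: mult_ac)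
  qed
  define k where "k = (LEAST k. Q k)"
  have Qk: "Q k" using \<open>\<exists>k. Q k\<close> unfolding k_def by (rule LeastI_ex)
  have "2 * e (rad k) \<le> V x (rad k)"
  proof (cases k)
    case 0
    then show ?thesis using big by (simp add: rad_def e_def)
  next
    case (Suc l)
    then have "\<not> Q l" using not_less_Least[of l Q] by (simp add: k_def)
    have d: "rad l = 2 * rad k" by (simp add: Suc rad_def)
    have "2 * e (rad k) \<le> 2 * e (rad l)" using emono[of "rad k" "rad l"] radpos[of k] by (simp add: d)
    moreover have "Cd * (2 * e (rad l)) \<le> Cd * V x (rad k)"
      using \<open>\<not> Q l\<close> V_double[OF radpos[of k], of x] by (simp add: Q_def d mult_ac)
    ultimately show ?thesis using Cd by (simp add: mult_le_cancel_left_pos)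
  qed
  moreover have "rad k \<le> R" using R by (simp add: rad_def field_simps)
  ultimately show ?thesis using that[of "rad k"] radpos[of k] Qk by (simp add: Q_def e_def)
qed

lemma increasing_union_density:
  fixes E :: "nat \<Rightarrow> 'a set"
  assumes E: "incseq E" "\<And>n. E n \<in> sets M" and r: "0 < r" and lt: "c < measure M ((\<Union>n. E n) \<inter> ball x r)"
  shows "eventually (\<lambda>n. c < measure M (E n \<inter> ball x r)) sequentially"
proof -
  have "(\<lambda>n. measure M (E n \<inter> ball x r)) \<longlonglongrightarrow> measure M (\<Union>n. E n \<inter> ball x r)"
  proof (rule Lim_measure_incseq)
    show "range (\<lambda>n. E n \<inter> ball x r) \<subseteq> sets M" using E(2) by (intro image_subsetI sets.Int) simp_all
    show "incseq (\<lambda>n. E n \<inter> ball x r)" using E(1) by (auto simp: incseq_def)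
    have "emeasure M (\<Union>n. E n \<inter> ball x r) \<le> emeasure M (ball x r)" by (intro emeasure_mono) auto
    also have "\<dots> < \<infinity>" by (rule emeasure_ball_finite[OF r])
    finally show "emeasure M (\<Union>n. E n \<inter> ball x r) \<noteq> \<infinity>" by simp
  qed
  moreover have "(\<Union>n. E n \<inter> ball x r) = (\<Union>n. E n) \<inter> ball x r" by auto
  ultimately show ?thesis using lt order_tendstoD(1) by fastforce
qed

text \<open>
  Let \<open>E\<close> be the union of the increasing sets \<open>{v > b n}\<close>. If \<open>E\<close> fills more than half of the
  ball of radius \<open>R = 1 / K\<close> around \<open>x\<close>, the integral of \<open>K * v\<close> bounds the volume, since
  \<open>v \<ge> 1/4\<close> on \<open>E\<close>. Otherwise there is a smaller ball in which \<open>E\<close> has intermediate density, because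
  \<open>x\<close> is not a point of low density. For large \<open>n\<close> the sets where the \<open>n\<close>-th truncation is 1 and 0 both
  fill a definite part of that ball, as the measure of the strip between \<open>a n\<close> and \<open>b n\<close> tends to zero.
  The functions \<open>f n\<close> combine both cases.
\<close>

lemma boxing_radius:
  assumes admissible: "admissible v g" and fin: "(\<integral>\<^sup>+ x. ennreal (v x) \<partial>M) < \<infinity>"
    and K: "0 < K" and m: "0 \<le> m" "energy K v g \<le> ennreal m"
  obtains f :: "nat \<Rightarrow> 'a \<Rightarrow> ennreal" where "\<forall>n. f n \<in> borel_measurable M" "\<forall>n. (\<integral>\<^sup>+ x. f n x \<partial>M) \<le> ennreal (9 * m)"
    "\<forall>x. v x = 1 \<and> x \<notin> low_density_points v \<longrightarrow> (\<exists>r. 0 < r \<and> r \<le> 1 / K \<and>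
       eventually (\<lambda>n. ennreal (V x r / r) \<le> ennreal (8 + 4 * Cd * CP) * (\<integral>\<^sup>+ y\<in>ball x (\<Lambda> * r). f n y \<partial>M)) sequentially)"
proof -
  have vm [measurable]: "v \<in> borel_measurable M" and [measurable]: "g \<in> borel_measurable M" by (rule admissibleD[OF admissible])+
  define F where "F y = g y + ennreal K * ennreal (v y)" for y
  have Fm [measurable]: "F \<in> borel_measurable M" unfolding F_def by measurable
  have Fint: "(\<integral>\<^sup>+ y. F y \<partial>M) = energy K v g"
    unfolding F_def energy_def by (simp add: nn_integral_add nn_integral_cmult)
  obtain a b :: "nat \<Rightarrow> real" where a: "\<forall>n. 1/4 \<le> a n" and b: "\<forall>n. b n \<le> 1/2" "decseq b"
    and ba: "\<forall>n. b n - a n = 1/4 / 2 ^ n"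
    and \<Phi>: "\<forall>n. (\<integral>\<^sup>+ y. F y * indicator {y. a n < v y \<and> v y \<le> b n} y \<partial>M) \<le> ennreal (m / 2 ^ n)"
    using nested_level_intervals[of F v m] m Fint by auto
  have ab: "a n < b n" for n using ba[rule_format, of n] by (smt (verit) divide_pos_pos zero_less_power)
  \<comment> \<open>The error \<open>\<delta> * g\<close> of a truncation with \<open>\<delta> = 1 / 2 ^ n\<close> is as small as the mass of the strip.\<close>
  have "\<exists>g'. admissible (\<lambda>x. ramp (a n) (b n) (v x)) g' \<and> (\<integral>\<^sup>+ x. g' x \<partial>M) \<le> ennreal (8 * m)" for n
  proof -
    obtain g' where g': "admissible (\<lambda>x. ramp (a n) (b n) (v x)) g'"
      "\<forall>A\<in>sets M. (\<integral>\<^sup>+ x\<in>A. g' x \<partial>M) \<le> ennreal (1 / (b n - a n)) *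
       ((\<integral>\<^sup>+ x\<in>A. g x * indicator {x. a n < v x \<and> v x < b n} x \<partial>M) + ennreal (1 / 2 ^ n) * (\<integral>\<^sup>+ x\<in>A. g x \<partial>M))"
      using admissible_ramp[OF admissible fin _ ab, of n "1 / 2 ^ n"] a[rule_format, of n] by auto
    have "(\<integral>\<^sup>+ x. g' x \<partial>M) \<le> ennreal (1 / (b n - a n)) *
       ((\<integral>\<^sup>+ x. g x * indicator {x. a n < v x \<and> v x < b n} x \<partial>M) + ennreal (1 / 2 ^ n) * (\<integral>\<^sup>+ x. g x \<partial>M))"
      using bspec[OF g'(2), of UNIV] sets.top[of M] by simp
    also have "\<dots> \<le> ennreal (1 / (b n - a n)) * (ennreal (m / 2 ^ n) + ennreal (1 / 2 ^ n) * ennreal m)"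
    proof (intro mult_left_mono add_mono)
      have "(\<integral>\<^sup>+ x. g x * indicator {x. a n < v x \<and> v x < b n} x \<partial>M) \<le>
        (\<integral>\<^sup>+ y. F y * indicator {y. a n < v y \<and> v y \<le> b n} y \<partial>M)"
        by (intro nn_integral_mono mult_mono) (auto simp: F_def indicator_def)
      then show "(\<integral>\<^sup>+ x. g x * indicator {x. a n < v x \<and> v x < b n} x \<partial>M) \<le> ennreal (m / 2 ^ n)"
        using \<Phi> by (blast intro: order_trans)
      have "(\<integral>\<^sup>+ x. g x \<partial>M) \<le> energy K v g" by (simp add: energy_def)
      then show "(\<integral>\<^sup>+ x. g x \<partial>M) \<le> ennreal m" using m(2) by (rule order_trans)
    qed simp_all
    also have "\<dots> = ennreal (8 * m)"
    proof -
      have "ennreal (1 / 2 ^ n) * ennreal m = ennreal (1 / 2 ^ n * m)" using m(1) by (intro ennreal_mult[symmetric]) simp_all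
      moreover have "ennreal (m / 2 ^ n) + ennreal (1 / 2 ^ n * m) = ennreal (m / 2 ^ n + 1 / 2 ^ n * m)"
        using m(1) by (intro ennreal_plus[symmetric]) simp_all
      moreover have "ennreal (1 / (b n - a n)) * ennreal (m / 2 ^ n + 1 / 2 ^ n * m) = ennreal (1 / (b n - a n) * (m / 2 ^ n + 1 / 2 ^ n * m))"
        using m(1) ab[of n] by (intro ennreal_mult[symmetric]) simp_all
      moreover have "1 / (b n - a n) * (m / 2 ^ n + 1 / 2 ^ n * m) = 8 * m"
        unfolding ba[rule_format, of n] by (simp add: field_simps)
      ultimately show ?thesis by (simp only:)
    qed
    finally show ?thesis using g'(1) by blast
  qed
  then obtain g' where g': "\<And>n. admissible (\<lambda>x. ramp (a n) (b n) (v x)) (g' n)" "\<And>n. (\<integral>\<^sup>+ x. g' n x \<partial>M) \<le> ennreal (8 * m)"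
    by metis
  have g'm [measurable]: "g' n \<in> borel_measurable M" for n by (rule admissibleD[OF g'(1)])
  define f where "f n y = g' n y + ennreal K * ennreal (v y)" for n y
  define E where "E n = {y \<in> UNIV. b n < v y}" for n
  have U: "UNIV \<in> sets M" using sets.top[of M] by simp
  have En: "E n \<in> sets M" for n unfolding E_def by (rule sets_level(1)[OF vm U])
  have Einc: "incseq E" using b(2) by (fastforce simp: E_def incseq_def decseq_def)
  define EE where "EE = (\<Union>n. E n)"
  have EE: "EE \<in> sets M" unfolding EE_def using En by (intro sets.countable_UN) auto
  have EEv: "1/4 \<le> v y" if y: "y \<in> EE" for y
  proof -
    obtain n where "b n < v y" using y unfolding EE_def E_def by blast
    then show ?thesis using a[rule_format, of n] ab[of n] by linarith
  qed
  have halfEE: "y \<in> EE" if "1/2 < v y" for y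
  proof -
    have "b 0 < v y" using that b(1)[rule_format, of 0] by linarith
    then show ?thesis unfolding EE_def E_def by blast
  qed
  define Gap where "Gap n = {y \<in> UNIV. a n < v y \<and> v y \<le> b n}" for n
  have Gapm: "Gap n \<in> sets M" for n
  proof -
    have eq: "Gap n = {y \<in> UNIV. a n < v y} \<inter> {y \<in> UNIV. v y \<le> b n}" by (auto simp: Gap_def)
    show ?thesis unfolding eq by (rule sets.Int[OF sets_level(1)[OF vm U] sets_level(4)[OF vm U]])
  qed
  have Gapsmall: "measure M (Gap n \<inter> A) \<le> 4 * m / K / 2 ^ n" if "A \<in> sets M" for n A
  proof -
    have "ennreal (K / 4) * emeasure M (Gap n \<inter> A) = (\<integral>\<^sup>+ y. ennreal (K / 4) * indicator (Gap n \<inter> A) y \<partial>M)"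
      using Gapm that by (simp add: nn_integral_cmult_indicator)
    also have "\<dots> \<le> (\<integral>\<^sup>+ y. F y * indicator {y. a n < v y \<and> v y \<le> b n} y \<partial>M)"
    proof (rule nn_integral_mono)
      fix y
      show "ennreal (K / 4) * indicator (Gap n \<inter> A) y \<le> F y * indicator {y. a n < v y \<and> v y \<le> b n} y"
      proof (cases "y \<in> Gap n \<inter> A")
        case True
        then have v: "1/4 \<le> v y" using a[rule_format, of n] by (auto simp: Gap_def)
        have "ennreal (K / 4) \<le> ennreal (K * v y)" using v K by (intro ennreal_leI) simp
        also have "\<dots> = ennreal K * ennreal (v y)" using v K by (intro ennreal_mult) auto
        also have "\<dots> \<le> F y" by (simp add: F_def)
        finally show ?thesis using True by (simp add: Gap_def)
      qed simp
    qed
    also have "\<dots> \<le> ennreal (m / 2 ^ n)" using \<Phi> by blast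
    finally have le: "ennreal (K / 4) * emeasure M (Gap n \<inter> A) \<le> ennreal (m / 2 ^ n)" .
    then have "ennreal (K / 4) * emeasure M (Gap n \<inter> A) < top" by (rule le_less_trans) simp
    then have "emeasure M (Gap n \<inter> A) < top" using K by (auto simp: ennreal_mult_less_top)
    then have "emeasure M (Gap n \<inter> A) = ennreal (measure M (Gap n \<inter> A))"
      by (simp add: emeasure_eq_ennreal_measure)
    moreover have "ennreal (K / 4 * measure M (Gap n \<inter> A)) = ennreal (K / 4) * ennreal (measure M (Gap n \<inter> A))"
      using K by (intro ennreal_mult) simp_all
    ultimately have "ennreal (K / 4 * measure M (Gap n \<inter> A)) \<le> ennreal (m / 2 ^ n)"
      using le by (simp only:)
    then have "K / 4 * measure M (Gap n \<inter> A) \<le> m / 2 ^ n" using m(1) by (simp add: ennreal_le_iff)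
    then show ?thesis using K by (simp add: field_simps)
  qed
  have fm: "f n \<in> borel_measurable M" for n unfolding f_def by measurable
  show ?thesis
  proof (rule that[of f], safe)
    show "f n \<in> borel_measurable M" for n by (rule fm)
    show "(\<integral>\<^sup>+ x. f n x \<partial>M) \<le> ennreal (9 * m)" for n
    proof -
      have "(\<integral>\<^sup>+ x. f n x \<partial>M) = (\<integral>\<^sup>+ x. g' n x \<partial>M) + ennreal K * (\<integral>\<^sup>+ x. ennreal (v x) \<partial>M)"
        unfolding f_def by (simp add: nn_integral_add nn_integral_cmult)
      also have "\<dots> \<le> ennreal (8 * m) + ennreal m"
      proof (intro add_mono g'(2))
        have "ennreal K * (\<integral>\<^sup>+ x. ennreal (v x) \<partial>M) \<le> energy K v g" by (simp add: energy_def)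
        then show "ennreal K * (\<integral>\<^sup>+ x. ennreal (v x) \<partial>M) \<le> ennreal m" using m(2) by (rule order_trans)
      qed
      also have "\<dots> = ennreal (9 * m)" using m(1) by (simp flip: ennreal_plus)
      finally show ?thesis .
    qed
    fix x assume x: "v x = 1" "x \<notin> low_density_points v"
    define R where "R = 1 / K"
    have R: "0 < R" using K by (simp add: R_def)
    have fmeas: "A \<inter> ball x r \<in> fmeasurable M" if "A \<in> sets M" "0 < r" for A r
    proof -
      have "ball x r \<in> fmeasurable M" using emeasure_ball_finite[OF that(2)] by (intro fmeasurableI) auto
      then show ?thesis using that(1) by (metis Int_commute fmeasurable_Int_fmeasurable)
    qed
    show "\<exists>r. 0 < r \<and> r \<le> 1 / K \<and>
       eventually (\<lambda>n. ennreal (V x r / r) \<le> ennreal (8 + 4 * Cd * CP) * (\<integral>\<^sup>+ y\<in>ball x (\<Lambda> * r). f n y \<partial>M)) sequentially"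
    proof (cases "V x R < 2 * measure M (EE \<inter> ball x R)")
      case True
      have le: "ennreal (V x R / R) \<le> ennreal (8 + 4 * Cd * CP) * (\<integral>\<^sup>+ y\<in>ball x (\<Lambda> * R). f n y \<partial>M)" for n
      proof -
        have "ennreal (V x R / R) \<le> ennreal (K * 2 * measure M (EE \<inter> ball x R))"
          using True K by (intro ennreal_leI) (simp add: R_def)
        also have "\<dots> = ennreal (K * 2) * emeasure M (EE \<inter> ball x R)"
          unfolding emeasure_eq_measure2[OF fmeas[OF EE R]] using K by (intro ennreal_mult) simp_all
        also have "\<dots> = (\<integral>\<^sup>+ y. ennreal (K * 2) * indicator (EE \<inter> ball x R) y \<partial>M)"
          using EE by (simp add: nn_integral_cmult_indicator)
        also have "\<dots> \<le> (\<integral>\<^sup>+ y. ennreal 8 * (f n y * indicator (ball x (\<Lambda> * R)) y) \<partial>M)"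
        proof (rule nn_integral_mono)
          fix y
          show "ennreal (K * 2) * indicator (EE \<inter> ball x R) y \<le> ennreal 8 * (f n y * indicator (ball x (\<Lambda> * R)) y)"
          proof (cases "y \<in> EE \<inter> ball x R")
            case True
            have "R \<le> \<Lambda> * R" using R \<Lambda> by simp
            then have y: "y \<in> ball x (\<Lambda> * R)" using True by auto
            have "ennreal (K * 2) \<le> ennreal (8 * (K * v y))" using EEv[of y] True K by (intro ennreal_leI) simp
            also have "\<dots> = ennreal 8 * ennreal (K * v y)" using EEv[of y] True K by (intro ennreal_mult) auto
            also have "ennreal (K * v y) = ennreal K * ennreal (v y)" using EEv[of y] True K by (intro ennreal_mult) auto
            also have "ennreal 8 * \<dots> \<le> ennreal 8 * f n y" unfolding f_def by (intro mult_left_mono) simp_all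
            finally show ?thesis using True y by simp
          qed simp
        qed
        also have "\<dots> = ennreal 8 * (\<integral>\<^sup>+ y\<in>ball x (\<Lambda> * R). f n y \<partial>M)"
          using fm by (intro nn_integral_cmult) auto
        also have "\<dots> \<le> ennreal (8 + 4 * Cd * CP) * (\<integral>\<^sup>+ y\<in>ball x (\<Lambda> * R). f n y \<partial>M)"
          using Cd CP by (intro mult_right_mono ennreal_leI) auto
        finally show ?thesis .
      qed
      show ?thesis
        by (intro exI[of _ R] conjI R always_eventually allI le) (simp add: R_def)
    next
      case False
      obtain \<rho> where \<rho>: "0 < \<rho>" "\<rho> < R" "V x \<rho> < 2 * measure M (EE \<inter> ball x \<rho>)"
      proof -
        have "\<not> (\<forall>\<rho>. 0 < \<rho> \<and> \<rho> < R \<longrightarrow> 2 * emeasure M {y \<in> ball x \<rho>. 1/2 < v y} \<le> emeasure M (ball x \<rho>))"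
          using x R unfolding low_density_points_def by blast
        then obtain \<rho> where \<rho>: "0 < \<rho>" "\<rho> < R" "\<not> 2 * emeasure M {y \<in> ball x \<rho>. 1/2 < v y} \<le> emeasure M (ball x \<rho>)"
          by blast
        have "emeasure M {y \<in> ball x \<rho>. 1/2 < v y} \<le> emeasure M (EE \<inter> ball x \<rho>)"
          using halfEE EE by (intro emeasure_mono) auto
        also have "\<dots> = ennreal (measure M (EE \<inter> ball x \<rho>))" using fmeas[OF EE \<rho>(1)] by (simp add: emeasure_eq_measure2)
        finally have le: "emeasure M {y \<in> ball x \<rho>. 1/2 < v y} \<le> ennreal (measure M (EE \<inter> ball x \<rho>))" .
        have "V x \<rho> < 2 * measure M (EE \<inter> ball x \<rho>)"
        proof (rule ccontr)
          assume neg: "\<not> V x \<rho> < 2 * measure M (EE \<inter> ball x \<rho>)"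
          have "2 * emeasure M {y \<in> ball x \<rho>. 1/2 < v y} \<le> 2 * ennreal (measure M (EE \<inter> ball x \<rho>))"
            using le by (rule mult_left_mono) simp
          also have "\<dots> = ennreal (2 * measure M (EE \<inter> ball x \<rho>))" by (simp add: ennreal_mult)
          also have "\<dots> \<le> ennreal (V x \<rho>)" using neg by (intro ennreal_leI) simp
          finally show False using \<rho>(3) emeasure_ball[OF \<rho>(1), of x] by simp
        qed
        then show ?thesis using that \<rho> by blast
      qed
      obtain r where r: "0 < r" "r \<le> R" "V x r \<le> 2 * Cd * measure M (EE \<inter> ball x r)" "2 * measure M (EE \<inter> ball x r) \<le> V x r"
        using intermediate_density_radius[OF EE R _ \<rho>] False by auto
      define \<theta> where "\<theta> = 1 / (4 * Cd)"
      have \<theta>: "0 < \<theta>" "\<theta> \<le> 1/4" using Cd by (auto simp: \<theta>_def field_simps)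
      have Vr: "0 < V x r" by (rule V_pos[OF r(1)])
      have "\<theta> * V x r < measure M ((\<Union>n. E n) \<inter> ball x r)"
      proof -
        have "2 * (Cd * (2 * (\<theta> * V x r))) = V x r" using Cd by (simp add: \<theta>_def)
        then have "2 * (Cd * (2 * (\<theta> * V x r))) \<le> 2 * (Cd * measure M (EE \<inter> ball x r))"
          using r(3) by (simp only: mult.assoc)
        then have "Cd * (2 * (\<theta> * V x r)) \<le> Cd * measure M (EE \<inter> ball x r)" by linarith
        then have "2 * (\<theta> * V x r) \<le> measure M (EE \<inter> ball x r)"
          by (rule mult_left_le_imp_le) (use Cd in simp)
        moreover have "0 < \<theta> * V x r" using \<theta> Vr by simp
        ultimately show ?thesis unfolding EE_def by linarith
      qed
      then have ev1: "eventually (\<lambda>n. \<theta> * V x r < measure M (E n \<inter> ball x r)) sequentially"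
        by (rule increasing_union_density[OF Einc En r(1)])
      have "(\<lambda>n. 4 * m / K * (1 / 2) ^ n) \<longlonglongrightarrow> 4 * m / K * 0"
        by (intro tendsto_mult_left LIMSEQ_power_zero) simp
      then have "eventually (\<lambda>n. 4 * m / K * (1 / 2) ^ n < V x r / 4) sequentially"
        using Vr by (intro order_tendstoD(2)) auto
      then have ev2: "eventually (\<lambda>n. 4 * m / K / 2 ^ n < V x r / 4) sequentially"
        by (simp add: power_one_over)
      have "eventually (\<lambda>n. ennreal (V x r / r) \<le> ennreal (8 + 4 * Cd * CP) * (\<integral>\<^sup>+ y\<in>ball x (\<Lambda> * r). f n y \<partial>M)) sequentially"
        using ev1 ev2
      proof eventually_elim
        case (elim n)
        let ?B = "ball x r"
        have one: "ennreal (\<theta> * V x r) \<le> emeasure M {y \<in> ?B. ramp (a n) (b n) (v y) = 1}"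
        proof -
          have "ennreal (\<theta> * V x r) \<le> ennreal (measure M (E n \<inter> ?B))" using elim(1) by (intro ennreal_leI) simp
          also have "\<dots> = emeasure M (E n \<inter> ?B)" using fmeas[OF En r(1)] by (simp add: emeasure_eq_measure2)
          also have "\<dots> \<le> emeasure M {y \<in> ?B. ramp (a n) (b n) (v y) = 1}"
            using ramp_simps(4)[OF ab, of n] admissibleD(1)[OF g'(1)[of n]] by (intro emeasure_mono sets_level) (auto simp: E_def)
          finally show ?thesis .
        qed
        have zero: "ennreal (\<theta> * V x r) \<le> emeasure M {y \<in> ?B. ramp (a n) (b n) (v y) = 0}"
        proof -
          define L where "L = {y \<in> UNIV. v y \<le> a n}"
          have Lm: "L \<in> sets M" unfolding L_def by (rule sets_level(4)[OF vm U])
          have "V x r \<le> measure M ((E n \<inter> ?B) \<union> (Gap n \<inter> ?B) \<union> (L \<inter> ?B))"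
            unfolding V_def using fmeas[OF En r(1)] fmeas[OF Gapm r(1)] fmeas[OF Lm r(1)]
            by (intro measure_mono_fmeasurable fmeasurable.Un) (auto simp: E_def Gap_def L_def)
          also have "\<dots> \<le> measure M (E n \<inter> ?B) + measure M (Gap n \<inter> ?B) + measure M (L \<inter> ?B)"
            using fmeas[OF En r(1)] fmeas[OF Gapm r(1)] fmeas[OF Lm r(1)]
            by (intro order_trans[OF measure_Un_le] add_mono measure_Un_le order_refl) (auto simp: fmeasurableD)
          also have "measure M (E n \<inter> ?B) \<le> measure M (EE \<inter> ?B)"
            using fmeas[OF EE r(1)] En by (intro measure_mono_fmeasurable) (auto simp: EE_def)
          also have "measure M (Gap n \<inter> ?B) \<le> V x r / 4" using Gapsmall[of ?B n] elim(2) by simp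
          finally have "V x r / 4 \<le> measure M (L \<inter> ?B)" using r(4) by linarith
          moreover have "\<theta> * V x r \<le> 1/4 * V x r" using \<theta> Vr by (intro mult_right_mono) auto
          ultimately have "ennreal (\<theta> * V x r) \<le> ennreal (measure M (L \<inter> ?B))" by (intro ennreal_leI) simp
          also have "\<dots> = emeasure M (L \<inter> ?B)" using fmeas[OF Lm r(1)] by (simp add: emeasure_eq_measure2)
          also have "\<dots> \<le> emeasure M {y \<in> ?B. ramp (a n) (b n) (v y) = 0}"
            using ramp_simps(3)[OF ab, of _ n] admissibleD(1)[OF g'(1)[of n]] by (intro emeasure_mono sets_level) (auto simp: L_def)
          finally show ?thesis .
        qed
        have P: "ennreal (\<theta> * V x r) \<le> ennreal (CP * r) * (\<integral>\<^sup>+ y\<in>ball x (\<Lambda> * r). g' n y \<partial>M)"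
          by (rule volume_le_of_zero_one_portions[OF g'(1) r(1) \<theta>(1) zero one])
        have "ennreal (V x r / r) = ennreal (4 * Cd / r) * ennreal (\<theta> * V x r)"
          using Cd r(1) \<theta> Vr by (simp add: \<theta>_def ennreal_mult[symmetric])
        also have "\<dots> \<le> ennreal (4 * Cd / r) * (ennreal (CP * r) * (\<integral>\<^sup>+ y\<in>ball x (\<Lambda> * r). g' n y \<partial>M))"
          by (intro mult_left_mono P) simp
        also have "\<dots> = ennreal (4 * Cd * CP) * (\<integral>\<^sup>+ y\<in>ball x (\<Lambda> * r). g' n y \<partial>M)"
        proof -
          have "ennreal (4 * Cd / r) * ennreal (CP * r) = ennreal (4 * Cd / r * (CP * r))"
            using Cd CP r(1) by (intro ennreal_mult[symmetric]) auto
          also have "4 * Cd / r * (CP * r) = 4 * Cd * CP" using r(1) by simp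
          finally show ?thesis by (simp only: mult.assoc[symmetric])
        qed
        also have "\<dots> \<le> ennreal (8 + 4 * Cd * CP) * (\<integral>\<^sup>+ y\<in>ball x (\<Lambda> * r). f n y \<partial>M)"
          by (intro mult_mono ennreal_leI nn_integral_mono) (auto simp: f_def)
        finally show ?case .
      qed
      then show ?thesis using r(1,2) by (intro exI[of _ r]) (simp add: R_def)
    qed
  qed
qed

text \<open>
  Vitali's covering lemma selects disjoint balls. For finitely many of them a common index \<open>n\<close> can be used
  in \<open>boxing_radius\<close>, and their contributions add up to at most the integral of \<open>f n\<close> over the whole
  space.
\<close>

lemma boxing:
  assumes admissible: "admissible v g" and K: "0 < K" and fin: "energy K v g < \<infinity>" and A: "\<And>x. x \<in> A \<Longrightarrow> v x = 1"
  obtains C \<rho> where "countable C" "C \<subseteq> A" "\<forall>x\<in>C. 0 < \<rho> x \<and> \<rho> x \<le> 5 * \<Lambda> / K"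
    "A - low_density_points v \<subseteq> (\<Union>x\<in>C. ball x (\<rho> x))"
    "\<forall>F. finite F \<and> F \<subseteq> C \<longrightarrow> (\<Sum>x\<in>F. ennreal (V x (\<rho> x) / \<rho> x)) \<le> ennreal boxing_const * energy K v g"
proof -
  obtain m where m: "0 \<le> m" "energy K v g = ennreal m"
    using fin by (metis ennreal_cases infinity_ennreal_def less_irrefl)
  have "ennreal K * (\<integral>\<^sup>+ x. ennreal (v x) \<partial>M) \<le> energy K v g" by (simp add: energy_def)
  then have "ennreal K * (\<integral>\<^sup>+ x. ennreal (v x) \<partial>M) < \<infinity>" using fin by (rule le_less_trans)
  then have vfin: "(\<integral>\<^sup>+ x. ennreal (v x) \<partial>M) < \<infinity>" using K by (auto simp: ennreal_mult_less_top)
  let ?c = "8 + 4 * Cd * CP"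
  obtain f :: "nat \<Rightarrow> 'a \<Rightarrow> ennreal" where fm: "\<forall>n. f n \<in> borel_measurable M" and fint: "\<forall>n. (\<integral>\<^sup>+ x. f n x \<partial>M) \<le> ennreal (9 * m)"
    and rad: "\<forall>x. v x = 1 \<and> x \<notin> low_density_points v \<longrightarrow> (\<exists>r. 0 < r \<and> r \<le> 1 / K \<and>
       eventually (\<lambda>n. ennreal (V x r / r) \<le> ennreal ?c * (\<integral>\<^sup>+ y\<in>ball x (\<Lambda> * r). f n y \<partial>M)) sequentially)"
    using boxing_radius[OF admissible vfin K m(1)] m(2) by auto
  define N where "N = A - low_density_points v"
  have "\<forall>x\<in>N. \<exists>r. 0 < r \<and> r \<le> 1 / K \<and>
       eventually (\<lambda>n. ennreal (V x r / r) \<le> ennreal ?c * (\<integral>\<^sup>+ y\<in>ball x (\<Lambda> * r). f n y \<partial>M)) sequentially"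
    using rad A unfolding N_def by blast
  from bchoice[OF this] obtain r where r: "\<forall>x\<in>N. 0 < r x \<and> r x \<le> 1 / K \<and>
       eventually (\<lambda>n. ennreal (V x (r x) / r x) \<le> ennreal ?c * (\<integral>\<^sup>+ y\<in>ball x (\<Lambda> * r x). f n y \<partial>M)) sequentially"
    by (elim exE)
  have rK: "0 < \<Lambda> * r x \<and> \<Lambda> * r x \<le> \<Lambda> * (1 / K)" if "x \<in> N" for x
  proof -
    have "0 < r x" "r x \<le> 1 / K" using r that by auto
    then show ?thesis using \<Lambda> mult_left_mono[of "r x" "1 / K" \<Lambda>] by simp
  qed
  obtain C where C: "C \<subseteq> N" "disjoint_family_on (\<lambda>x. ball x (\<Lambda> * r x)) C" "N \<subseteq> (\<Union>x\<in>C. ball x (5 * (\<Lambda> * r x)))"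
    using disjoint_balls_five_cover[OF rK] .
  define \<rho> where "\<rho> x = 5 * \<Lambda> * r x" for x
  have rpos: "0 < r x" "r x \<le> 1 / K" if "x \<in> C" for x using that C(1) r by auto
  show ?thesis
  proof (rule that[of C \<rho>])
    show "countable C" by (rule disjoint_balls_countable[OF C(2)]) (use rpos \<Lambda> in auto)
    show "C \<subseteq> A" using C(1) by (auto simp: N_def)
    show "\<forall>x\<in>C. 0 < \<rho> x \<and> \<rho> x \<le> 5 * \<Lambda> / K"
    proof (intro ballI conjI)
      fix x assume x: "x \<in> C"
      show "0 < \<rho> x" using rpos[OF x] \<Lambda> by (simp add: \<rho>_def)
      have "5 * \<Lambda> * r x \<le> 5 * \<Lambda> * (1 / K)" using rpos[OF x] \<Lambda> by (intro mult_left_mono) auto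
      then show "\<rho> x \<le> 5 * \<Lambda> / K" by (simp add: \<rho>_def)
    qed
    show "A - low_density_points v \<subseteq> (\<Union>x\<in>C. ball x (\<rho> x))"
      using C(3) by (simp add: N_def \<rho>_def mult.assoc)
    show "\<forall>F. finite F \<and> F \<subseteq> C \<longrightarrow> (\<Sum>x\<in>F. ennreal (V x (\<rho> x) / \<rho> x)) \<le> ennreal boxing_const * energy K v g"
    proof (intro allI impI)
      fix F assume F: "finite F \<and> F \<subseteq> C"
      have "eventually (\<lambda>n. \<forall>x\<in>F. ennreal (V x (r x) / r x) \<le> ennreal ?c * (\<integral>\<^sup>+ y\<in>ball x (\<Lambda> * r x). f n y \<partial>M)) sequentially"
        using F r C(1) by (intro eventually_ball_finite) auto
      then obtain n where n: "\<forall>x\<in>F. ennreal (V x (r x) / r x) \<le> ennreal ?c * (\<integral>\<^sup>+ y\<in>ball x (\<Lambda> * r x). f n y \<partial>M)"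
        using eventually_happens'[OF sequentially_bot] by blast
      define D where "D = Cd ^ (LEAST q. 5 * \<Lambda> \<le> 2 ^ q)"
      have D: "0 \<le> D" using Cd by (simp add: D_def)
      have "(\<Sum>x\<in>F. ennreal (V x (\<rho> x) / \<rho> x)) \<le> (\<Sum>x\<in>F. ennreal D * (ennreal ?c * (\<integral>\<^sup>+ y\<in>ball x (\<Lambda> * r x). f n y \<partial>M)))"
      proof (rule sum_mono)
        fix x assume x: "x \<in> F"
        then have rx: "0 < r x" using F rpos by blast
        have "ennreal (V x (\<rho> x) / \<rho> x) \<le> ennreal (D * (V x (r x) / r x))"
          unfolding \<rho>_def D_def by (intro ennreal_leI dilated_volume_ratio rx)
        also have "\<dots> = ennreal D * ennreal (V x (r x) / r x)"
          using D rx V_nonneg by (intro ennreal_mult) auto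
        also have "\<dots> \<le> ennreal D * (ennreal ?c * (\<integral>\<^sup>+ y\<in>ball x (\<Lambda> * r x). f n y \<partial>M))"
          using n x by (intro mult_left_mono) auto
        finally show "ennreal (V x (\<rho> x) / \<rho> x) \<le> ennreal D * (ennreal ?c * (\<integral>\<^sup>+ y\<in>ball x (\<Lambda> * r x). f n y \<partial>M))" .
      qed
      also have "\<dots> = ennreal D * (ennreal ?c * (\<Sum>x\<in>F. \<integral>\<^sup>+ y\<in>ball x (\<Lambda> * r x). f n y \<partial>M))"
        by (simp only: sum_distrib_left)
      also have "\<dots> \<le> ennreal D * (ennreal ?c * ennreal (9 * m))"
      proof (intro mult_left_mono)
        have "(\<Sum>x\<in>F. \<integral>\<^sup>+ y\<in>ball x (\<Lambda> * r x). f n y \<partial>M) \<le> of_nat 1 * (\<integral>\<^sup>+ y\<in>UNIV. f n y \<partial>M)"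
        proof (rule sum_integrals_overlap)
          show "card {x \<in> F. y \<in> ball x (\<Lambda> * r x)} \<le> 1" for y
          proof (rule card_le_Suc0_iff_eq[THEN iffD2, folded One_nat_def])
            show "finite {x \<in> F. y \<in> ball x (\<Lambda> * r x)}" using F by simp
            show "\<forall>p\<in>{x \<in> F. y \<in> ball x (\<Lambda> * r x)}. \<forall>q\<in>{x \<in> F. y \<in> ball x (\<Lambda> * r x)}. p = q"
            proof (intro ballI, rule ccontr)
              fix p q assume pq: "p \<in> {x \<in> F. y \<in> ball x (\<Lambda> * r x)}" "q \<in> {x \<in> F. y \<in> ball x (\<Lambda> * r x)}" "p \<noteq> q"
              then have "p \<in> C" "q \<in> C" using F by auto
              from disjoint_family_onD[OF C(2) this \<open>p \<noteq> q\<close>] show False using pq by blast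
            qed
          qed
        qed (use F fm sets.top[of M] in auto)
        also have "\<dots> \<le> ennreal (9 * m)" using fint by simp
        finally show "(\<Sum>x\<in>F. \<integral>\<^sup>+ y\<in>ball x (\<Lambda> * r x). f n y \<partial>M) \<le> ennreal (9 * m)" .
      qed simp_all
      also have "\<dots> = ennreal boxing_const * energy K v g"
      proof -
        have c: "0 \<le> ?c" using Cd CP by simp
        have "ennreal D * (ennreal ?c * ennreal (9 * m)) = ennreal (D * (?c * (9 * m)))"
          using D c m(1) by (simp only: ennreal_mult[symmetric] mult_nonneg_nonneg zero_le_numeral)
        also have "D * (?c * (9 * m)) = boxing_const * m" by (simp add: boxing_const_def D_def)
        also have "ennreal (boxing_const * m) = ennreal boxing_const * ennreal m"
          using boxing_const_pos m(1) by (intro ennreal_mult) auto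
        finally show ?thesis by (simp only: m(2))
      qed
      finally show "(\<Sum>x\<in>F. ennreal (V x (\<rho> x) / \<rho> x)) \<le> ennreal boxing_const * energy K v g" .
    qed
  qed
qed


section \<open>Connectedness and a Sobolev inequality\<close>

text \<open>
  The indicator function of a clopen set has the upper gradient 0, since curves are connected, and would
  violate the Poincare inequality in a ball that meets both the set and its complement.
\<close>

lemma connected_space: "connected (UNIV :: 'a set)"
proof (rule ccontr)
  assume "\<not> connected (UNIV :: 'a set)"
  then obtain A B :: "'a set" where AB: "open A" "open B" "A \<inter> B = {}" "A \<union> B = UNIV" "A \<noteq> {}" "B \<noteq> {}"
    unfolding connected_def by auto
  define v :: "'a \<Rightarrow> real" where "v = indicator A"
  have "v \<in> borel_measurable M" unfolding v_def using AB(1) by (intro borel_measurable_indicator) simp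
  moreover have "upper_gradient_real v (\<lambda>_. 0)"
    unfolding upper_gradient_real_iff
  proof (intro conjI allI impI)
    fix a b and \<gamma> :: "real \<Rightarrow> 'a" assume c: "(a, b, \<gamma>) \<in> curves"
    then have ab: "a \<le> b" and cont: "continuous_on {a..b} \<gamma>" by (simp_all add: curves_def)
    have "connected (\<gamma> ` {a..b})" by (intro connected_continuous_image cont) simp
    then have "A \<inter> \<gamma> ` {a..b} = {} \<or> B \<inter> \<gamma> ` {a..b} = {}"
      using connectedD[of "\<gamma> ` {a..b}" A B] AB by auto
    moreover have "\<gamma> a \<in> \<gamma> ` {a..b}" "\<gamma> b \<in> \<gamma> ` {a..b}" using ab by simp_all
    ultimately have "\<gamma> a \<in> A \<longleftrightarrow> \<gamma> b \<in> A" using AB by blast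
    then have "v (\<gamma> a) = v (\<gamma> b)" by (simp add: v_def indicator_def)
    then show "ennreal \<bar>v (\<gamma> a) - v (\<gamma> b)\<bar> \<le> curve_integral (a, b, \<gamma>) (\<lambda>_. 0)" by simp
  qed simp
  ultimately have admissible: "admissible v (\<lambda>_. 0)" by (simp add: admissible_def v_def indicator_def)
  obtain p q where p: "p \<in> A" and q: "q \<in> B" using AB by blast
  obtain s where s: "0 < s" "ball p s \<subseteq> A" using AB(1) p by (auto simp: open_contains_ball)
  obtain t where t: "0 < t" "ball q t \<subseteq> B" using AB(2) q by (auto simp: open_contains_ball)
  define r where "r = s + dist p q + t"
  have r: "0 < r" using s t zero_le_dist[of p q] by (simp add: r_def add_pos_nonneg add_nonneg_pos)
  have sub1: "ball p s \<subseteq> {y \<in> ball p r. v y = 1}"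
  proof
    fix y assume y: "y \<in> ball p s"
    then have "dist p y < s" by simp
    then have "dist p y < r" using t(1) zero_le_dist[of p q] unfolding r_def by linarith
    then show "y \<in> {y \<in> ball p r. v y = 1}" using y s(2) by (auto simp: v_def)
  qed
  have sub0: "ball q t \<subseteq> {y \<in> ball p r. v y = 0}"
  proof
    fix y assume y: "y \<in> ball q t"
    then have "dist p y < r" using s dist_triangle[of p y q] by (simp add: r_def)
    moreover have "y \<notin> A" using y t(2) AB(3) by blast
    ultimately show "y \<in> {y \<in> ball p r. v y = 0}" by (simp add: v_def)
  qed
  define \<theta> where "\<theta> = min (V p s) (V q t) / V p r"
  have Vr: "0 < V p r" by (rule V_pos[OF r])
  have \<theta>: "0 < \<theta>" using V_pos[OF s(1), of p] V_pos[OF t(1), of q] Vr by (simp add: \<theta>_def)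
  have \<theta>V: "\<theta> * V p r = min (V p s) (V q t)" using Vr by (simp add: \<theta>_def)
  have m: "v \<in> borel_measurable M" by (rule admissibleD[OF admissible])
  have "ennreal (\<theta> * V p r) \<le> ennreal (CP * r) * (\<integral>\<^sup>+ y\<in>ball p (\<Lambda> * r). 0 \<partial>M)"
  proof (rule volume_le_of_zero_one_portions[OF admissible r \<theta>])
    have "ennreal (\<theta> * V p r) \<le> emeasure M (ball q t)" unfolding \<theta>V emeasure_ball[OF t(1)] by (intro ennreal_leI) simp
    also have "\<dots> \<le> emeasure M {y \<in> ball p r. v y = 0}" using m by (intro emeasure_mono sub0 sets_level) auto
    finally show "ennreal (\<theta> * V p r) \<le> emeasure M {y \<in> ball p r. v y = 0}" .
    have "ennreal (\<theta> * V p r) \<le> emeasure M (ball p s)" unfolding \<theta>V emeasure_ball[OF s(1)] by (intro ennreal_leI) simp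
    also have "\<dots> \<le> emeasure M {y \<in> ball p r. v y = 1}" using m by (intro emeasure_mono sub1 sets_level) auto
    finally show "ennreal (\<theta> * V p r) \<le> emeasure M {y \<in> ball p r. v y = 1}" .
  qed
  then have "\<theta> * V p r \<le> 0" by (simp add: ennreal_eq_0_iff)
  then show False using \<theta> Vr by (simp add: mult_le_0_iff)
qed

lemma point_at_distance:
  fixes p q x :: 'a
  assumes "0 \<le> s" "2 * s \<le> dist p q"
  obtains y where "dist x y = s"
proof -
  have "connected (dist x ` UNIV)"
    by (intro connected_continuous_image connected_space continuous_intros)
  moreover have "s \<le> dist x p \<or> s \<le> dist x q"
    using dist_triangle3[of p q x] assms(2) by linarith
  then obtain z where "s \<le> dist x z" by blast
  moreover have "dist x x \<in> range (dist x)" "dist x z \<in> range (dist x)" by blast+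
  ultimately have "s \<in> range (dist x)"
    using connectedD_interval[of "range (dist x)" "dist x x" "dist x z" s] assms(1) by simp
  then show ?thesis using that by blast
qed

definition sobolev_const :: real where "sobolev_const = (1 + Cd ^ 4) * CP * 6"

lemma sobolev_const_pos: "0 < sobolev_const"
  using Cd CP by (simp add: sobolev_const_def add_pos_nonneg)

text \<open>
  By connectedness there is a point at distance \<open>5 * r\<close> from \<open>x\<close>. The ball of radius \<open>r\<close> around it
  lies in the annulus between the radii \<open>4 * r\<close> and \<open>6 * r\<close>, where \<open>v\<close> vanishes, and fills a definite
  part of the ball of radius \<open>6 * r\<close>.
\<close>

lemma sobolev_inequality:
  assumes admissible: "admissible v g" and r: "0 < r" "10 * r \<le> dist p (q :: 'a)"
    and zero: "\<And>y. y \<notin> ball x (4 * r) \<Longrightarrow> v y = 0"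
  shows "(\<integral>\<^sup>+ y. ennreal (v y) \<partial>M) \<le> ennreal (sobolev_const * r) * (\<integral>\<^sup>+ y. g y \<partial>M)"
proof -
  obtain y where y: "dist x y = 5 * r" using point_at_distance[of "5 * r" p q x] r by auto
  have m: "v \<in> borel_measurable M" by (rule admissibleD[OF admissible])
  have sub: "ball y r \<subseteq> {z \<in> ball x (6 * r). v z = 0}"
  proof
    fix z assume "z \<in> ball y r"
    then have z: "dist y z < r" by simp
    have "dist x z < 6 * r" using dist_triangle[of x z y] y z by linarith
    moreover have "4 * r \<le> dist x z" using dist_triangle2[of x y z] y z by linarith
    ultimately show "z \<in> {z \<in> ball x (6 * r). v z = 0}" using zero[of z] by simp
  qed
  \<comment> \<open>\<open>dist x y + 6 * r = 11 * r \<le> 2 ^ 4 * r\<close>\<close>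
  have "V x (6 * r) \<le> Cd ^ 4 * V y r" by (rule V_compare) (use r y in auto)
  then have "1 / Cd ^ 4 * V x (6 * r) \<le> V y r" using Cd by (simp add: field_simps)
  then have "ennreal (1 / Cd ^ 4 * V x (6 * r)) \<le> emeasure M (ball y r)"
    unfolding emeasure_ball[OF r(1)] by (rule ennreal_leI)
  also have "\<dots> \<le> emeasure M {z \<in> ball x (6 * r). v z = 0}" using m by (intro emeasure_mono sub sets_level) auto
  finally have port: "ennreal (1 / Cd ^ 4 * V x (6 * r)) \<le> emeasure M {z \<in> ball x (6 * r). v z = 0}" .
  have "(\<integral>\<^sup>+ y. ennreal (v y) \<partial>M) \<le> (\<integral>\<^sup>+ y\<in>ball x (6 * r). ennreal (v y) \<partial>M)"
  proof (rule nn_integral_mono)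
    fix z
    show "ennreal (v z) \<le> ennreal (v z) * indicator (ball x (6 * r)) z"
    proof (cases "z \<in> ball x (6 * r)")
      case False
      then have "z \<notin> ball x (4 * r)" using r by auto
      then show ?thesis using zero by simp
    qed simp
  qed
  also have "\<dots> \<le> ennreal ((1 + 1 / (1 / Cd ^ 4)) * CP * (6 * r)) * (\<integral>\<^sup>+ y\<in>ball x (\<Lambda> * (6 * r)). g y \<partial>M)"
    by (rule integral_le_of_zero_portion[OF admissible _ _ port]) (use r Cd in auto)
  also have "(1 + 1 / (1 / Cd ^ 4)) * CP * (6 * r) = sobolev_const * r" by (simp add: sobolev_const_def)
  also have "ennreal (sobolev_const * r) * (\<integral>\<^sup>+ y\<in>ball x (\<Lambda> * (6 * r)). g y \<partial>M) \<le> ennreal (sobolev_const * r) * (\<integral>\<^sup>+ y. g y \<partial>M)"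
    by (intro mult_left_mono nn_integral_mono) (auto simp: indicator_def)
  finally show ?thesis .
qed


section \<open>Sets that are thin at their own points\<close>

text \<open>
  The Sobolev inequality absorbs the integral of the function into that of its upper gradient. For
  \<open>r \<le> C / K\<close> the loss is independent of \<open>K\<close>.
\<close>

lemma cap_le_of_rel_cap1:
  assumes r: "0 < r" "10 * r \<le> dist p (q :: 'a)" and K: "0 \<le> K" and B: "K * sobolev_const * r \<le> B"
    and lt: "rel_cap1 \<mu> A (ball x (4 * r)) < ennreal C"
  shows "cap K A \<le> ennreal ((1 + B) * C)"
proof -
  obtain v g where vg: "admissible v g" "\<And>x. x \<in> A \<Longrightarrow> v x = 1" "\<And>y. y \<notin> ball x (4 * r) \<Longrightarrow> v y = 0"
    "(\<integral>\<^sup>+ x. g x \<partial>M) < ennreal C" by (rule rel_cap1_approx[OF lt]) blast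
  have C: "0 < C" using vg(4) by (metis ennreal_neg linorder_not_le not_less_zero)
  have B0: "0 \<le> B" using B K sobolev_const_pos r(1) by (smt (verit) mult_nonneg_nonneg)
  have "cap K A \<le> energy K v g" by (rule cap_le[OF vg(1,2)])
  also have "\<dots> \<le> ennreal C + ennreal K * (ennreal (sobolev_const * r) * ennreal C)"
  proof -
    have "(\<integral>\<^sup>+ y. ennreal (v y) \<partial>M) \<le> ennreal (sobolev_const * r) * (\<integral>\<^sup>+ y. g y \<partial>M)"
      by (rule sobolev_inequality[OF vg(1) r vg(3)])
    also have "\<dots> \<le> ennreal (sobolev_const * r) * ennreal C" using vg(4) by (intro mult_left_mono) auto
    finally show ?thesis unfolding energy_def using vg(4) by (intro add_mono mult_left_mono) auto
  qed
  also have "\<dots> = ennreal (C + K * (sobolev_const * r * C))"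
    using C K sobolev_const_pos r(1) by (simp add: ennreal_mult[symmetric] ennreal_plus[symmetric] del: ennreal_plus)
  also have "\<dots> \<le> ennreal ((1 + B) * C)"
  proof (rule ennreal_leI)
    have "K * sobolev_const * r * C \<le> B * C" using B C by (intro mult_right_mono) auto
    then show "C + K * (sobolev_const * r * C) \<le> (1 + B) * C" by (simp add: algebra_simps)
  qed
  finally show ?thesis .
qed

lemma cap_antimono_weight: "K \<le> K' \<Longrightarrow> cap K A \<le> cap K' A"
  unfolding cap_def energy_def by (intro INF_mono) (force intro!: add_left_mono mult_right_mono ennreal_leI)

text \<open>
  The thinness for which one covering step of \<open>cap_uniformly_thin\<close> reduces the energy of an almost
  optimal competitor by the factor 1/4.
\<close>

definition thin_const :: real where
  "thin_const = 1 / (4 * boxing_const * (1 + 5 * \<Lambda> * sobolev_const))"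

lemma thin_const_eq: "0 < thin_const" "4 * (thin_const * (1 + 5 * \<Lambda> * sobolev_const) * boxing_const) = 1"
proof -
  have "0 < 1 + 5 * \<Lambda> * sobolev_const" using \<Lambda> sobolev_const_pos by (simp add: add_pos_nonneg)
  then show "0 < thin_const" "4 * (thin_const * (1 + 5 * \<Lambda> * sobolev_const) * boxing_const) = 1"
    using boxing_const_pos by (simp_all add: thin_const_def)
qed

text \<open>
  If the capacity \<open>c\<close> were positive, boxing applied to a competitor of energy less than \<open>2 * c\<close> would
  cover \<open>A\<close>, up to a null set, by balls in which \<open>E\<close> has total capacity at most \<open>c / 2\<close>. The weight
  \<open>K\<close> is chosen so large that all the balls have radii in the range in which thinness and the Sobolev
  inequality are available.
\<close>

lemma cap_uniformly_thin:
  assumes AE: "A \<subseteq> E" and \<tau>: "0 < \<tau>"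
    and thin: "\<And>x r. x \<in> A \<Longrightarrow> 0 < r \<Longrightarrow> r < \<tau> \<Longrightarrow>
      rel_cap1 \<mu> (E \<inter> ball x r) (ball x (4 * r)) < ennreal (thin_const * (V x r / r))"
    and bdd: "x0 \<in> A" "A \<subseteq> ball x0 s" "0 < s" "s < \<tau>" "10 * s \<le> dist p (q :: 'a)"
  shows "cap 1 A = 0"
proof -
  define B where "B = 5 * \<Lambda> * sobolev_const"
  define \<sigma> where "\<sigma> = min 1 s"
  have \<sigma>: "0 < \<sigma>" "\<sigma> \<le> 1" "\<sigma> \<le> s" using bdd by (auto simp: \<sigma>_def)
  \<comment> \<open>The balls provided by \<open>boxing\<close> have radii at most \<open>5 * \<Lambda> / K\<close>.\<close>
  define K where "K = 5 * \<Lambda> / \<sigma>"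
  have K: "1 \<le> K" "0 < K"
  proof -
    have "\<sigma> \<le> 5 * \<Lambda>" using \<sigma> \<Lambda> by linarith
    then show "1 \<le> K" using \<sigma> by (simp add: K_def)
    then show "0 < K" by simp
  qed
  have LK: "5 * \<Lambda> / K = \<sigma>" using \<Lambda> \<sigma> by (simp add: K_def)
  have local: "cap K (E \<inter> ball x r) \<le> ennreal ((1 + B) * (thin_const * (V x r / r)))"
    if x: "x \<in> A" "0 < r" "r \<le> \<sigma>" for x r
  proof (rule cap_le_of_rel_cap1[where p = p and q = q and x = x])
    show "10 * r \<le> dist p q" using x \<sigma> bdd by linarith
    have "K * sobolev_const * r \<le> K * sobolev_const * \<sigma>" using x K sobolev_const_pos by (intro mult_left_mono) auto
    also have "\<dots> = B" using \<sigma> by (simp add: K_def B_def)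
    finally show "K * sobolev_const * r \<le> B" .
    show "rel_cap1 \<mu> (E \<inter> ball x r) (ball x (4 * r)) < ennreal (thin_const * (V x r / r))"
      using x \<sigma> bdd by (intro thin) auto
  qed (use x K in auto)
  have "cap K A < \<infinity>"
  proof -
    have "rel_cap1 \<mu> (E \<inter> ball x0 s) (ball x0 (4 * s)) < ennreal (thin_const * (V x0 s / s))"
      using bdd by (intro thin) auto
    then have "cap K (E \<inter> ball x0 s) \<le> ennreal ((1 + K * sobolev_const * s) * (thin_const * (V x0 s / s)))"
      using bdd K by (intro cap_le_of_rel_cap1[where p = p and q = q and x = x0 and r = s]) auto
    moreover have "cap K A \<le> cap K (E \<inter> ball x0 s)" using AE bdd(2) by (intro cap_mono) blast
    ultimately have "cap K A \<le> ennreal ((1 + K * sobolev_const * s) * (thin_const * (V x0 s / s)))"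
      by (rule order_trans[rotated])
    then show ?thesis by (rule le_less_trans) simp
  qed
  then obtain c where c: "0 \<le> c" "cap K A = ennreal c"
    by (metis ennreal_cases infinity_ennreal_def less_irrefl)
  have "c = 0"
  proof (rule ccontr)
    assume "c \<noteq> 0"
    then have cpos: "0 < c" using c by simp
    then have "cap K A < ennreal (2 * c)" unfolding c(2) by (intro ennreal_lessI) auto
    then obtain v g where vg: "admissible v g" "\<And>x. x \<in> A \<Longrightarrow> v x = 1" "energy K v g < ennreal (2 * c)"
      by (rule cap_approx) blast
    have efin: "energy K v g < \<infinity>" using vg(3) by (rule less_trans) simp
    have "(\<integral>\<^sup>+ x. g x \<partial>M) \<le> energy K v g" "ennreal K * (\<integral>\<^sup>+ x. ennreal (v x) \<partial>M) \<le> energy K v g"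
      by (simp_all add: energy_def)
    then have gfin: "(\<integral>\<^sup>+ x. g x \<partial>M) < \<infinity>" and "ennreal K * (\<integral>\<^sup>+ x. ennreal (v x) \<partial>M) < \<infinity>"
      using efin by (auto intro: le_less_trans)
    then have vfin: "(\<integral>\<^sup>+ x. ennreal (v x) \<partial>M) < \<infinity>" using K by (auto simp: ennreal_mult_less_top)
    obtain C \<rho> where C: "countable C" "C \<subseteq> A" "\<forall>x\<in>C. 0 < \<rho> x \<and> \<rho> x \<le> 5 * \<Lambda> / K"
      "A - low_density_points v \<subseteq> (\<Union>x\<in>C. ball x (\<rho> x))"
      "\<forall>F. finite F \<and> F \<subseteq> C \<longrightarrow> (\<Sum>x\<in>F. ennreal (V x (\<rho> x) / \<rho> x)) \<le> ennreal boxing_const * energy K v g"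
      using boxing[OF vg(1) K(2) efin vg(2)] .
    have "cap K (\<Union>x\<in>C. E \<inter> ball x (\<rho> x)) \<le> ennreal ((1 + B) * thin_const) * (ennreal boxing_const * ennreal (2 * c))"
    proof (rule cap_countable_cover[OF C(1)])
      fix F assume F: "finite F" "F \<subseteq> C"
      have "(\<Sum>x\<in>F. cap K (E \<inter> ball x (\<rho> x))) \<le> (\<Sum>x\<in>F. ennreal ((1 + B) * thin_const) * ennreal (V x (\<rho> x) / \<rho> x))"
      proof (rule sum_mono)
        fix x assume x: "x \<in> F"
        then have x': "x \<in> A" "0 < \<rho> x" "\<rho> x \<le> \<sigma>" using F C(2,3) LK by auto
        have "0 \<le> (1 + B) * thin_const" using thin_const_eq(1) \<Lambda> sobolev_const_pos by (simp add: B_def)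
        then have "ennreal ((1 + B) * thin_const * (V x (\<rho> x) / \<rho> x)) = ennreal ((1 + B) * thin_const) * ennreal (V x (\<rho> x) / \<rho> x)"
          using x'(2) V_nonneg by (intro ennreal_mult) auto
        then show "cap K (E \<inter> ball x (\<rho> x)) \<le> ennreal ((1 + B) * thin_const) * ennreal (V x (\<rho> x) / \<rho> x)"
          using local[OF x'] by (simp add: mult.assoc)
      qed
      also have "\<dots> = ennreal ((1 + B) * thin_const) * (\<Sum>x\<in>F. ennreal (V x (\<rho> x) / \<rho> x))"
        by (simp only: sum_distrib_left)
      also have "\<dots> \<le> ennreal ((1 + B) * thin_const) * (ennreal boxing_const * energy K v g)"
        using C(5) F by (intro mult_left_mono) auto
      also have "\<dots> \<le> ennreal ((1 + B) * thin_const) * (ennreal boxing_const * ennreal (2 * c))"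
        using vg(3) by (intro mult_left_mono) auto
      finally show "(\<Sum>x\<in>F. cap K (E \<inter> ball x (\<rho> x))) \<le> ennreal ((1 + B) * thin_const) * (ennreal boxing_const * ennreal (2 * c))" .
    qed
    also have "\<dots> = ennreal ((1 + B) * thin_const * (boxing_const * (2 * c)))"
    proof -
      have "0 \<le> (1 + B) * thin_const" "0 \<le> boxing_const" "0 \<le> 2 * c"
        using thin_const_eq(1) \<Lambda> sobolev_const_pos boxing_const_pos cpos by (simp_all add: B_def)
      then show ?thesis by (simp only: ennreal_mult[symmetric] mult_nonneg_nonneg)
    qed
    also have "(1 + B) * thin_const * (boxing_const * (2 * c)) = c / 2"
    proof -
      have "4 * ((1 + B) * thin_const * (boxing_const * (2 * c))) = 4 * (thin_const * (1 + 5 * \<Lambda> * sobolev_const) * boxing_const) * (2 * c)"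
        by (simp only: B_def mult_ac)
      also have "\<dots> = 2 * c" unfolding thin_const_eq(2) by simp
      finally show ?thesis by linarith
    qed
    finally have cover: "cap K (\<Union>x\<in>C. E \<inter> ball x (\<rho> x)) \<le> ennreal (c / 2)" .
    have "A \<subseteq> low_density_points v \<union> (\<Union>x\<in>C. E \<inter> ball x (\<rho> x))" using C(4) AE by blast
    then have "cap K A \<le> cap K (low_density_points v \<union> (\<Union>x\<in>C. E \<inter> ball x (\<rho> x)))" by (rule cap_mono)
    also have "\<dots> \<le> cap K (low_density_points v) + cap K (\<Union>x\<in>C. E \<inter> ball x (\<rho> x))" by (rule cap_Un)
    also have "\<dots> \<le> ennreal (c / 2)"
      using cover cap_low_density_points[OF vg(1) vfin gfin, of K] K by simp
    finally show False unfolding c(2) using cpos by (simp add: ennreal_le_iff)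
  qed
  then have "cap K A = 0" using c by simp
  then show ?thesis using cap_antimono_weight[OF K(1), of A] by simp
qed

text \<open>
  The set is divided into countably many pieces of small diameter on which \<open>\<tau>\<close> is uniform. The weights
  used for the pieces differ, but null sets for a weight \<open>K \<ge> 1\<close> are null sets for the weight 1.
\<close>

lemma cap_thin_points:
  assumes AE: "A \<subseteq> E" and pq: "p \<noteq> (q :: 'a)"
    and thin: "\<And>x. x \<in> A \<Longrightarrow> \<exists>\<tau>>0. \<forall>r. 0 < r \<and> r < \<tau> \<longrightarrow>
      rel_cap1 \<mu> (E \<inter> ball x r) (ball x (4 * r)) < ennreal (thin_const * (V x r / r))"
  shows "cap 1 A = 0"
proof -
  obtain D :: "'a set" where D: "countable D" "\<And>x e. 0 < e \<Longrightarrow> \<exists>d\<in>D. dist d x < e"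
    by (rule countable_dense) (rule that; blast)
  \<comment> \<open>A piece contained in a ball of radius \<open>s n\<close> around \<open>d\<close> lies in the ball of radius \<open>2 * s n\<close> around
    any of its points; the factor 10 comes from \<open>cap_uniformly_thin\<close>.\<close>
  define s where "s n = min (1 / real (Suc n)) (dist p q / 10) / 4" for n
  have s: "0 < s n" "2 * s n < 1 / real (Suc n)" "10 * (2 * s n) \<le> dist p q" for n
  proof -
    define t where "t = min (1 / real (Suc n)) (dist p q / 10)"
    have "0 < t" "t \<le> 1 / real (Suc n)" "t \<le> dist p q / 10" using pq by (auto simp: t_def)
    moreover have "s n = t / 4" by (simp add: s_def t_def)
    ultimately show "0 < s n" "2 * s n < 1 / real (Suc n)" "10 * (2 * s n) \<le> dist p q" by linarith+
  qed
  define P where "P = (\<lambda>(n, d). {x \<in> A. dist d x < s n \<and> (\<forall>r. 0 < r \<and> r < 1 / real (Suc n) \<longrightarrow>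
      rel_cap1 \<mu> (E \<inter> ball x r) (ball x (4 * r)) < ennreal (thin_const * (V x r / r)))})"
  have "cap 1 (\<Union>i\<in>(UNIV :: nat set) \<times> D. P i) = 0"
  proof (rule cap_countable_null)
    show "countable ((UNIV :: nat set) \<times> D)" using D(1) by blast
    fix i assume "i \<in> (UNIV :: nat set) \<times> D"
    obtain n d where i: "i = (n, d)" by (metis surj_pair)
    show "cap 1 (P i) = 0"
    proof (cases "P i = {}")
      case False
      then obtain x0 where x0: "x0 \<in> P i" by blast
      show ?thesis
      proof (rule cap_uniformly_thin[where \<tau> = "1 / real (Suc n)" and s = "2 * s n" and p = p and q = q and E = E])
        show "P i \<subseteq> ball x0 (2 * s n)"
        proof
          fix x assume "x \<in> P i"
          then have "dist d x < s n" "dist d x0 < s n" using x0 by (auto simp: P_def i)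
          then have "dist x0 x < 2 * s n" using dist_triangle3[of x0 x d] by linarith
          then show "x \<in> ball x0 (2 * s n)" by simp
        qed
      qed (use x0 AE s[of n] in \<open>auto simp: P_def i\<close>)
    qed simp
  qed
  moreover have "A \<subseteq> (\<Union>i\<in>(UNIV :: nat set) \<times> D. P i)"
  proof
    fix x assume x: "x \<in> A"
    obtain \<tau> where \<tau>: "\<tau> > 0" "\<forall>r. 0 < r \<and> r < \<tau> \<longrightarrow>
      rel_cap1 \<mu> (E \<inter> ball x r) (ball x (4 * r)) < ennreal (thin_const * (V x r / r))" using thin[OF x] by blast
    obtain n where n: "1 / real (Suc n) < \<tau>" using nat_approx_posE[OF \<tau>(1)] .
    obtain d where d: "d \<in> D" "dist d x < s n" using D(2)[OF s(1)] by blast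
    have "x \<in> P (n, d)" unfolding P_def using x d(2) \<tau>(2) n by (auto intro: less_trans)
    then show "x \<in> (\<Union>i\<in>(UNIV :: nat set) \<times> D. P i)" using d(1) by blast
  qed
  ultimately have "cap 1 A \<le> 0" using cap_mono[of A "\<Union>i\<in>(UNIV :: nat set) \<times> D. P i" 1] by simp
  then show ?thesis by simp
qed

end


section \<open>The quasi-Lindelof principle\<close>

lemma rel_cap1_mono:
  assumes "A \<subseteq> A'" "D' \<subseteq> D"
  shows "rel_cap1 \<mu> A D \<le> rel_cap1 \<mu> A' D'"
  unfolding rel_cap1_def by (intro INF_superset_mono) (use assms in auto)

text \<open>
  For each index the infimum over the countable subfamilies is attained by the union of a minimizing
  sequence. The union over all indices is still countable and minimizes all the functionals at once.
\<close>

lemma countable_minimizing_subfamily: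
  fixes \<phi> :: "'i \<Rightarrow> 'b set \<Rightarrow> ennreal"
  assumes I: "countable I" and anti: "\<And>i W W'. W \<subseteq> W' \<Longrightarrow> \<phi> i W' \<le> \<phi> i W"
  obtains \<W> where "\<W> \<subseteq> \<V>" "countable \<W>" "\<And>i U. i \<in> I \<Longrightarrow> U \<in> \<V> \<Longrightarrow> \<phi> i \<W> \<le> \<phi> i (insert U \<W>)"
proof -
  define S where "S i = \<phi> i ` {W. W \<subseteq> \<V> \<and> countable W}" for i
  have "\<exists>W. W \<subseteq> \<V> \<and> countable W \<and> \<phi> i W \<le> Inf (S i)" for i
  proof -
    have "S i \<noteq> {}" unfolding S_def by (metis (mono_tags) countable_empty empty_iff empty_subsetI image_is_empty mem_Collect_eq)
    then obtain f :: "nat \<Rightarrow> ennreal" where f: "range f \<subseteq> S i" "Inf (S i) = (INF n. f n)"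
      using ennreal_Inf_countable_INF by metis
    then have "\<forall>n. \<exists>W. W \<subseteq> \<V> \<and> countable W \<and> f n = \<phi> i W" unfolding S_def by blast
    from choice[OF this] obtain W where W: "\<forall>n. W n \<subseteq> \<V> \<and> countable (W n) \<and> f n = \<phi> i (W n)" by (elim exE)
    have "\<phi> i (\<Union>n. W n) \<le> Inf (S i)"
      unfolding f(2)
    proof (rule INF_greatest)
      fix n
      have "\<phi> i (\<Union>n. W n) \<le> \<phi> i (W n)" by (rule anti) auto
      then show "\<phi> i (\<Union>n. W n) \<le> f n" using W by simp
    qed
    then show ?thesis using W by (intro exI[of _ "\<Union>n. W n"]) auto
  qed
  then have "\<forall>i. \<exists>W. W \<subseteq> \<V> \<and> countable W \<and> \<phi> i W \<le> Inf (S i)" by blast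
  from choice[OF this] obtain W where W: "\<forall>i. W i \<subseteq> \<V> \<and> countable (W i) \<and> \<phi> i (W i) \<le> Inf (S i)" by (elim exE)
  show ?thesis
  proof (rule that[of "\<Union>i\<in>I. W i"])
    show sub: "(\<Union>i\<in>I. W i) \<subseteq> \<V>" using W by blast
    show cnt: "countable (\<Union>i\<in>I. W i)" using W I by blast
    fix i U assume iU: "i \<in> I" "U \<in> \<V>"
    have "\<phi> i (\<Union>i\<in>I. W i) \<le> \<phi> i (W i)" using iU(1) by (intro anti) blast
    also have "\<dots> \<le> Inf (S i)" using W by blast
    also have "\<dots> \<le> \<phi> i (insert U (\<Union>i\<in>I. W i))"
      unfolding S_def using sub cnt iU(2) by (intro Inf_lower imageI) simp
    finally show "\<phi> i (\<Union>i\<in>I. W i) \<le> \<phi> i (insert U (\<Union>i\<in>I. W i))" .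
  qed
qed

context doubling_poincare_space
begin

lemma thin1_at_bound:
  assumes thin: "thin1_at \<mu> A x" and e: "0 < e"
  obtains \<tau> where "0 < \<tau>" "\<forall>r. 0 < r \<and> r < \<tau> \<longrightarrow> rel_cap1 \<mu> (A \<inter> ball x r) (ball x (2 * r)) < ennreal (e * (V x r / r))"
proof -
  have "eventually (\<lambda>r. ennreal r * (rel_cap1 \<mu> (A \<inter> ball x r) (ball x (2 * r)) / \<mu> (ball x r)) < ennreal e) (at_right 0)"
    using thin e unfolding thin1_at_def by (intro order_tendstoD(2)) auto
  then obtain \<tau> where \<tau>: "0 < \<tau>" "\<And>r. 0 < r \<Longrightarrow> r < \<tau> \<Longrightarrow>
      ennreal r * (rel_cap1 \<mu> (A \<inter> ball x r) (ball x (2 * r)) / \<mu> (ball x r)) < ennreal e"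
    by (auto simp: eventually_at_right_field)
  have "rel_cap1 \<mu> (A \<inter> ball x r) (ball x (2 * r)) < ennreal (e * (V x r / r))" if r: "0 < r" "r < \<tau>" for r
  proof (rule ccontr)
    assume neg: "\<not> rel_cap1 \<mu> (A \<inter> ball x r) (ball x (2 * r)) < ennreal (e * (V x r / r))"
    have V: "0 < V x r" by (rule V_pos[OF r(1)])
    have \<mu>V: "\<mu> (ball x r) = ennreal (V x r)" using emeasure_ball[OF r(1), of x] by (simp add: emeasure_M)
    have "ennreal e = ennreal r * (ennreal (e * (V x r / r)) / ennreal (V x r))"
      using V r e by (simp add: divide_ennreal ennreal_mult[symmetric])
    also have "\<dots> \<le> ennreal r * (rel_cap1 \<mu> (A \<inter> ball x r) (ball x (2 * r)) / ennreal (V x r))"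
      using neg by (intro mult_left_mono divide_right_mono_ennreal) auto
    finally show False using \<tau>(2)[OF r] by (simp add: \<mu>V)
  qed
  then show ?thesis using that \<tau>(1) by blast
qed

text \<open>
  With the outer ball of radius \<open>4 * r\<close> in place of \<open>2 * r\<close> there is room to pass from balls
  around \<open>x\<close> to balls with a nearby centre \<open>d\<close> and rational radii \<open>s\<close> and \<open>t\<close>, and from these
  back to the balls of radii \<open>3/2 * r\<close> and \<open>3 * r\<close> around \<open>x\<close>.
\<close>

lemma quasi_lindelof:
  assumes pq: "p \<noteq> (q :: 'a)" and fo: "\<forall>U\<in>\<V>. finely_open1 \<mu> U"
  shows "\<exists>\<V>'\<subseteq>\<V>. countable \<V>' \<and> Cap1 \<mu> (\<Union>\<V> - \<Union>\<V>') = 0"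
proof -
  obtain D :: "'a set" where D: "countable D" "\<And>x e. 0 < e \<Longrightarrow> \<exists>d\<in>D. dist d x < e"
    by (rule countable_dense) (rule that; blast)
  define \<phi> :: "'a \<times> rat \<times> rat \<Rightarrow> 'a set set \<Rightarrow> ennreal" where
    "\<phi> = (\<lambda>(d, s, t) W. rel_cap1 \<mu> (- \<Union>W \<inter> ball d (of_rat s)) (ball d (of_rat t)))"
  obtain \<W> where \<W>: "\<W> \<subseteq> \<V>" "countable \<W>"
    and min: "\<And>i U. i \<in> D \<times> UNIV \<Longrightarrow> U \<in> \<V> \<Longrightarrow> \<phi> i \<W> \<le> \<phi> i (insert U \<W>)"
  proof (rule countable_minimizing_subfamily[of "D \<times> UNIV" \<phi> \<V>])
    show "countable (D \<times> (UNIV :: (rat \<times> rat) set))" using D(1) by blast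
    fix i :: "'a \<times> rat \<times> rat" and W W' :: "'a set set" assume "W \<subseteq> W'"
    then show "\<phi> i W' \<le> \<phi> i W" unfolding \<phi>_def by (auto split: prod.split intro!: rel_cap1_mono)
  qed blast
  define E where "E = - \<Union>\<W>"
  define A where "A = \<Union>\<V> - \<Union>\<W>"
  have "cap 1 A = 0"
  proof (rule cap_thin_points[OF _ pq])
    show "A \<subseteq> E" by (auto simp: A_def E_def)
    fix x assume "x \<in> A"
    then obtain U where U: "U \<in> \<V>" "x \<in> U" by (auto simp: A_def)
    then have "thin1_at \<mu> (- U) x" using fo by (auto simp: finely_open1_def)
    then obtain \<tau> where \<tau>: "0 < \<tau>" "\<forall>r. 0 < r \<and> r < \<tau> \<longrightarrow>
        rel_cap1 \<mu> (- U \<inter> ball x r) (ball x (2 * r)) < ennreal (thin_const / Cd * (V x r / r))"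
      by (rule thin1_at_bound[where e = "thin_const / Cd"]) (use thin_const_eq(1) Cd that in auto)
    show "\<exists>\<tau>>0. \<forall>r. 0 < r \<and> r < \<tau> \<longrightarrow>
      rel_cap1 \<mu> (E \<inter> ball x r) (ball x (4 * r)) < ennreal (thin_const * (V x r / r))"
    proof (intro exI[of _ "\<tau> / 2"] conjI allI impI)
      show "0 < \<tau> / 2" using \<tau>(1) by simp
      fix r assume "0 < r \<and> r < \<tau> / 2"
      then have r: "0 < r" "3/2 * r < \<tau>" "0 < 3/2 * r" by auto
      obtain d where d: "d \<in> D" "dist d x < r / 10" using D(2)[of "r / 10" x] r by auto
      \<comment> \<open>Moving the centre by \<open>r / 10\<close> requires \<open>11/10 * r \<le> s \<le> 14/10 * r\<close> and \<open>31/10 * r \<le> t \<le> 39/10 * r\<close>.\<close>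
      obtain s where s: "11/10 * r < of_rat s" "of_rat s < 14/10 * r"
        using of_rat_dense[of "11/10 * r" "14/10 * r"] r by auto
      obtain t where t: "31/10 * r < of_rat t" "of_rat t < 39/10 * r"
        using of_rat_dense[of "31/10 * r" "39/10 * r"] r by auto
      have sub: "ball y a \<subseteq> ball z b" if "dist y z + a \<le> b" for y z :: 'a and a b :: real
      proof
        fix w assume "w \<in> ball y a"
        then show "w \<in> ball z b" using that dist_triangle[of z w y] by (simp add: dist_commute)
      qed
      have b1: "ball x r \<subseteq> ball d (of_rat s)" by (rule sub) (use d s in \<open>simp add: dist_commute\<close>)
      have b2: "ball d (of_rat t) \<subseteq> ball x (4 * r)" by (rule sub) (use d t in simp)
      have b3: "ball d (of_rat s) \<subseteq> ball x (3/2 * r)" by (rule sub) (use d s in simp)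
      have b4: "ball x (2 * (3/2 * r)) \<subseteq> ball d (of_rat t)" by (rule sub) (use d t in \<open>simp add: dist_commute\<close>)
      have "rel_cap1 \<mu> (E \<inter> ball x r) (ball x (4 * r)) \<le> \<phi> (d, s, t) \<W>"
        unfolding \<phi>_def E_def prod.case using b1 b2 by (intro rel_cap1_mono) auto
      also have "\<dots> \<le> \<phi> (d, s, t) (insert U \<W>)" using d(1) U(1) by (intro min) auto
      also have "\<dots> \<le> rel_cap1 \<mu> (- U \<inter> ball x (3/2 * r)) (ball x (2 * (3/2 * r)))"
        unfolding \<phi>_def prod.case using b3 b4 by (intro rel_cap1_mono) auto
      also have "\<dots> < ennreal (thin_const / Cd * (V x (3/2 * r) / (3/2 * r)))"
        using \<tau>(2) r by blast
      also have "\<dots> \<le> ennreal (thin_const * (V x r / r))"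
      proof (rule ennreal_leI)
        have "V x (3/2 * r) \<le> Cd ^ 1 * V x r" by (rule V_compare) (use r in auto)
        then have V: "V x (3/2 * r) \<le> Cd * V x r" by simp
        have "V x (3/2 * r) / (3/2 * r) \<le> V x (3/2 * r) / r"
          using r V_nonneg by (intro divide_left_mono) auto
        also have "\<dots> \<le> Cd * V x r / r" using V r by (intro divide_right_mono) auto
        finally have "thin_const / Cd * (V x (3/2 * r) / (3/2 * r)) \<le> thin_const / Cd * (Cd * V x r / r)"
          using thin_const_eq(1) Cd by (intro mult_left_mono) auto
        also have "\<dots> = thin_const * (V x r / r)" using Cd by simp
        finally show "thin_const / Cd * (V x (3/2 * r) / (3/2 * r)) \<le> thin_const * (V x r / r)" .
      qed
      finally show "rel_cap1 \<mu> (E \<inter> ball x r) (ball x (4 * r)) < ennreal (thin_const * (V x r / r))" .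
    qed
  qed
  then have "Cap1 \<mu> A = 0" using Cap1_le_cap[of 1 A] by simp
  then show ?thesis using \<W> by (intro exI[of _ \<W>]) (simp add: A_def)
qed

end

theorem theorem5p2:
  fixes \<mu> :: "'a::complete_space set \<Rightarrow> ennreal"
    and \<V> :: "'a set set"
  assumes two_points: "\<exists>x y :: 'a. x \<noteq> y"
    and outer_measure: "borel_regular_outer_measure \<mu>"
    and doubling: "doubling \<mu>"
    and poincare: "poincare_1_1 \<mu>"
    and finely_open: "\<forall>U\<in>\<V>. finely_open1 \<mu> U"
  shows "\<exists>\<V>'\<subseteq>\<V>. countable \<V>' \<and> Cap1 \<mu> (\<Union>\<V> - \<Union>\<V>') = 0"
proof -
  obtain Cd where Cd: "1 \<le> Cd" "\<And>x r. 0 < r \<Longrightarrow> 0 < \<mu> (ball x (2 * r)) \<and>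
      \<mu> (ball x (2 * r)) \<le> ennreal Cd * \<mu> (ball x r) \<and> ennreal Cd * \<mu> (ball x r) < \<infinity>"
    using doubling unfolding doubling_def by blast
  obtain CP \<Lambda> where P: "0 < CP" "1 \<le> \<Lambda>"
    "\<And>x r u g. 0 < r \<Longrightarrow> u \<in> L1_loc \<mu> \<Longrightarrow> upper_gradient u g \<Longrightarrow>
          (\<integral>\<^sup>+ y\<in>ball x r. e2ennreal \<bar>u y - ereal (ball_mean \<mu> u x r)\<bar> \<partial>caratheodory_measure \<mu>)
            / \<mu> (ball x r)
          \<le> ennreal (CP * r) *
             ((\<integral>\<^sup>+ y\<in>ball x (\<Lambda> * r). g y \<partial>caratheodory_measure \<mu>) / \<mu> (ball x (\<Lambda> * r)))"
    using poincare unfolding poincare_1_1_def by blast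
  interpret doubling_poincare_space \<mu> Cd CP \<Lambda>
  proof
    fix x :: 'a and r :: real assume r: "0 < r"
    show "0 < \<mu> (ball x r)" using Cd(2)[of "r / 2" x] r by simp
    show "\<mu> (ball x r) < \<infinity>" using Cd(2)[OF r, of x] Cd(1) by (auto simp: ennreal_mult_less_top)
    show "\<mu> (ball x (2 * r)) \<le> ennreal Cd * \<mu> (ball x r)" using Cd(2)[OF r] by blast
  qed (use outer_measure Cd(1) P in auto)
  obtain p q :: 'a where "p \<noteq> q" using two_points by blast
  then show ?thesis by (rule quasi_lindelof) (rule finely_open)
qed

end
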